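(* Let $k$ be an algebraically closed field of characteristic $2$ and let $G=SL_2$ over $k$. For every integer $m\geq 1$, \[\dim_k H^m(G,L(1)^{[m]})=\Pi_{m-1},\] where $\Pi_{m-1}$ is the number of partitions of $1$ into $m$ powers of $1/2$.
   Context: $G=SL_2$ is regarded as an algebraic group over $k$, and $H^m(G,V)=\mathrm{Ext}^m_G(k,V)$ denotes rational cohomology, computed in the category of rational $G$-modules. $L(1)$ is the natural $2$-dimensional $G$-module, and $L(1)^{[m]}$ is its $m$-th Frobenius twist, i.e. the module obtained by composing the representation with the $m$-th power of the Frobenius map raising matrix entries to the $2$nd power; it is the simple module $L(2^m)$ of highest weight $2^m$. The number of partitions of $1$ into $m$ powers of $1/2$ is the number of multisets $\{e_1,\dots,e_m\}$ of $m$ non-negative integers with $\sum_{i=1}^m 2^{-e_i}=1$ (for $m=1,2,3,4,5,6$ these numbers are $1,1,1,2,3,5$). *)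

theory Defs
  imports
    "HOL-Analysis.Determinants"
    "HOL-Computational_Algebra.Computational_Algebra"
    "HOL-Library.Function_Algebras"
    "HOL-Library.Multiset"
begin

section \<open>The group $SL_2$ and its rational modules\<close>

text \<open>
  Over an algebraically closed field the reduced group scheme $SL_2$ is determined by its group
  of rational points together with the algebra of regular functions on it.
\<close>

definition SL2 :: "('k::field ^ 2 ^ 2) set" where
  "SL2 = {g. det g = 1}"

text \<open>
  Polynomial functions on two-by-two matrices. Only their values on \<^const>\<open>SL2\<close> are ever used,
  and their restrictions to \<^const>\<open>SL2\<close> form the coordinate algebra $k[SL_2]$.
\<close>

inductive_set regular_functions :: "('k::field ^ 2 ^ 2 \<Rightarrow> 'k) set" where
  const: "(\<lambda>g. c) \<in> regular_functions"
| entry: "(\<lambda>g. g $ i $ j) \<in> regular_functions"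
| add: "f \<in> regular_functions \<Longrightarrow> h \<in> regular_functions \<Longrightarrow> (\<lambda>g. f g + h g) \<in> regular_functions"
| mult: "f \<in> regular_functions \<Longrightarrow> h \<in> regular_functions \<Longrightarrow> (\<lambda>g. f g * h g) \<in> regular_functions"

text \<open>
  The underlying space of a module is a subspace \<open>gspace V\<close> of the type \<open>'v\<close>, so that modules of
  different dimensions can live in one type.
\<close>

record ('k, 'v) gmod =
  gspace :: "'v set"
  gscale :: "'k \<Rightarrow> 'v \<Rightarrow> 'v"
  gact :: "'k ^ 2 ^ 2 \<Rightarrow> 'v \<Rightarrow> 'v"

text \<open>
  The last conjunct is rationality: every orbit map is given by a finite sum
  $\sum_i w_i \otimes f_i \in V \otimes k[G]$, i.e. the action comes from a $k[G]$-comodule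
  structure. In particular the module is locally finite.
\<close>

definition rational_module :: "('k::field, 'v::ab_group_add) gmod \<Rightarrow> bool" where
  "rational_module V \<longleftrightarrow>
     vector_space (gscale V) \<and> module.subspace (gscale V) (gspace V) \<and>
     (\<forall>g\<in>SL2. \<forall>v\<in>gspace V. gact V g v \<in> gspace V) \<and>
     (\<forall>g\<in>SL2. \<forall>v\<in>gspace V. \<forall>w\<in>gspace V. gact V g (v + w) = gact V g v + gact V g w) \<and>
     (\<forall>g\<in>SL2. \<forall>c. \<forall>v\<in>gspace V. gact V g (gscale V c v) = gscale V c (gact V g v)) \<and>
     (\<forall>v\<in>gspace V. gact V (mat 1) v = v) \<and>
     (\<forall>g\<in>SL2. \<forall>h\<in>SL2. \<forall>v\<in>gspace V. gact V (g ** h) v = gact V g (gact V h v)) \<and>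
     (\<forall>v\<in>gspace V. \<exists>(n::nat) f w. (\<forall>i<n. f i \<in> regular_functions \<and> w i \<in> gspace V) \<and>
        (\<forall>g\<in>SL2. gact V g v = (\<Sum>i<n. gscale V (f i g) (w i))))"

definition trivial_module :: "('k::field, 'k) gmod" where
  "trivial_module = \<lparr>gspace = UNIV, gscale = (*), gact = (\<lambda>g v. v)\<rparr>"

definition natural_module :: "('k::field, 'k ^ 2) gmod" where
  "natural_module = \<lparr>gspace = UNIV, gscale = (*s), gact = (*v)\<rparr>"

definition frobenius :: "'k::field ^ 2 ^ 2 \<Rightarrow> 'k ^ 2 ^ 2" where
  "frobenius g = (\<chi> i j. (g $ i $ j) ^ CHAR('k))"

definition frobenius_twist :: "nat \<Rightarrow> ('k::field, 'v) gmod \<Rightarrow> ('k, 'v) gmod" where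
  "frobenius_twist m V = V\<lparr>gact := (\<lambda>g. gact V ((frobenius ^^ m) g))\<rparr>"

section \<open>Homomorphisms and injective resolutions\<close>

text \<open>
  Homomorphisms are normalised to vanish outside the underlying space of their source, so that
  equality of homomorphisms is equality of functions.
\<close>

definition gHom ::
  "('k::field, 'v::ab_group_add) gmod \<Rightarrow> ('k, 'w::ab_group_add) gmod \<Rightarrow> ('v \<Rightarrow> 'w) set" where
  "gHom V W = {\<phi>.
     (\<forall>v\<in>gspace V. \<phi> v \<in> gspace W) \<and>
     (\<forall>v\<in>gspace V. \<forall>v'\<in>gspace V. \<phi> (v + v') = \<phi> v + \<phi> v') \<and>
     (\<forall>c. \<forall>v\<in>gspace V. \<phi> (gscale V c v) = gscale W c (\<phi> v)) \<and>
     (\<forall>g\<in>SL2. \<forall>v\<in>gspace V. \<phi> (gact V g v) = gact W g (\<phi> v)) \<and>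
     (\<forall>v. v \<notin> gspace V \<longrightarrow> \<phi> v = 0)}"

definition submodule_of :: "('k::field, 'v::ab_group_add) gmod \<Rightarrow> 'v set \<Rightarrow> bool" where
  "submodule_of V S \<longleftrightarrow> S \<subseteq> gspace V \<and> module.subspace (gscale V) S \<and>
     (\<forall>g\<in>SL2. \<forall>v\<in>S. gact V g v \<in> S)"

text \<open>
  The type \<open>'v\<close> is the universe of the category: its objects are the rational modules with
  underlying space in \<open>'v\<close>. Once \<open>'v\<close> admits an infinite-dimensional vector space structure,
  all finite-dimensional rational modules occur in it up to isomorphism; as rational modules are
  locally finite, injectivity then amounts to injectivity among all rational modules.
\<close>

definition injective_module :: "('k::field, 'v::ab_group_add) gmod \<Rightarrow> bool" where
  "injective_module I \<longleftrightarrow> rational_module I \<and>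
     (\<forall>(V :: ('k, 'v) gmod) S. rational_module V \<and> submodule_of V S \<longrightarrow>
        (\<forall>\<phi>\<in>gHom (V\<lparr>gspace := S\<rparr>) I. \<exists>\<psi>\<in>gHom V I. \<forall>v\<in>S. \<psi> v = \<phi> v))"

definition injective_resolution ::
  "('k::field, 'w::ab_group_add) gmod \<Rightarrow> (nat \<Rightarrow> ('k, 'v::ab_group_add) gmod) \<Rightarrow>
     ('w \<Rightarrow> 'v) \<Rightarrow> (nat \<Rightarrow> 'v \<Rightarrow> 'v) \<Rightarrow> bool" where
  "injective_resolution V I \<epsilon> d \<longleftrightarrow>
     (\<forall>n. injective_module (I n)) \<and>
     \<epsilon> \<in> gHom V (I 0) \<and> (\<forall>n. d n \<in> gHom (I n) (I (Suc n))) \<and>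
     inj_on \<epsilon> (gspace V) \<and>
     \<epsilon> ` gspace V = {x \<in> gspace (I 0). d 0 x = 0} \<and>
     (\<forall>n. d n ` gspace (I n) = {x \<in> gspace (I (Suc n)). d (Suc n) x = 0})"

section \<open>Ext groups and rational cohomology\<close>

definition Ext_cocycles ::
  "('k::field, 'u::ab_group_add) gmod \<Rightarrow> (nat \<Rightarrow> ('k, 'v::ab_group_add) gmod) \<Rightarrow>
     (nat \<Rightarrow> 'v \<Rightarrow> 'v) \<Rightarrow> nat \<Rightarrow> ('u \<Rightarrow> 'v) set" where
  "Ext_cocycles M I d n = {\<phi> \<in> gHom M (I n). \<forall>x\<in>gspace M. d n (\<phi> x) = 0}"

definition Ext_coboundaries ::
  "('k::field, 'u::ab_group_add) gmod \<Rightarrow> (nat \<Rightarrow> ('k, 'v::ab_group_add) gmod) \<Rightarrow>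
     (nat \<Rightarrow> 'v \<Rightarrow> 'v) \<Rightarrow> nat \<Rightarrow> ('u \<Rightarrow> 'v) set" where
  "Ext_coboundaries M I d n =
     (case n of 0 \<Rightarrow> {\<lambda>x. 0} | Suc i \<Rightarrow> (\<lambda>\<phi>. d i \<circ> \<phi>) ` gHom M (I i))"

text \<open>
  For subspaces \<open>B \<subseteq> Z\<close>: the quotient $Z/B$ has finite dimension \<open>N\<close>, i.e. the cosets of the
  elements of some \<open>N\<close>-element set \<open>S\<close> form a basis of it.
\<close>

definition quotient_has_dim ::
  "('k::field \<Rightarrow> 'a::ab_group_add \<Rightarrow> 'a) \<Rightarrow> 'a set \<Rightarrow> 'a set \<Rightarrow> nat \<Rightarrow> bool" where
  "quotient_has_dim sc Z B N \<longleftrightarrow>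
     (\<exists>S. finite S \<and> card S = N \<and> S \<subseteq> Z \<and>
        (\<forall>c. (\<Sum>s\<in>S. sc (c s) s) \<in> B \<longrightarrow> (\<forall>s\<in>S. c s = 0)) \<and>
        (\<forall>z\<in>Z. \<exists>c. z - (\<Sum>s\<in>S. sc (c s) s) \<in> B))"

text \<open>
  $\dim_k \mathrm{Ext}^n_G(M,V) = N$, where $\mathrm{Ext}^n_G(M,-)$ is the right derived functor of
  $\mathrm{Hom}_G(M,-)$: the module \<open>V\<close> has an injective resolution in the universe \<open>'v\<close>, and
  every such resolution \<open>I\<close> yields a complex $\mathrm{Hom}_G(M,I^\bullet)$ whose \<open>n\<close>-th cohomology
  has dimension \<open>N\<close>.
\<close>

definition Ext_has_dim ::
  "'v::ab_group_add itself \<Rightarrow> nat \<Rightarrow> ('k::field, 'u::ab_group_add) gmod \<Rightarrow>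
     ('k, 'w::ab_group_add) gmod \<Rightarrow> nat \<Rightarrow> bool" where
  "Ext_has_dim U n M V N \<longleftrightarrow>
     (\<exists>(I :: nat \<Rightarrow> ('k, 'v) gmod) \<epsilon> d. injective_resolution V I \<epsilon> d) \<and>
     (\<forall>(I :: nat \<Rightarrow> ('k, 'v) gmod) \<epsilon> d. injective_resolution V I \<epsilon> d \<longrightarrow>
        quotient_has_dim (\<lambda>c \<phi> x. gscale (I n) c (\<phi> x))
          (Ext_cocycles M I d n) (Ext_coboundaries M I d n) N)"

definition rational_cohomology_has_dim ::
  "'v::ab_group_add itself \<Rightarrow> nat \<Rightarrow> ('k::field, 'w::ab_group_add) gmod \<Rightarrow> nat \<Rightarrow> bool" where
  "rational_cohomology_has_dim U n V N \<longleftrightarrow> Ext_has_dim U n (trivial_module :: ('k, 'k) gmod) V N"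

section \<open>Partitions of 1 into powers of 1/2\<close>

text \<open>The index is shifted: \<open>half_partitions n\<close> counts the partitions with \<open>n + 1\<close> parts.\<close>

definition half_partitions :: "nat \<Rightarrow> nat" where
  "half_partitions n =
     card {E :: nat multiset. size E = n + 1 \<and> (\<Sum>e\<in>#E. (1 / 2 :: rat) ^ e) = 1}"

end

(*
  In characteristic 2 the divided powers e_j of the unipotent radical U of the Borel subgroup B
  commute and square to zero, so the cohomology of B with coefficients in V is computed by the
  torus-invariants of the Koszul-type complex V (x) k[l_0, l_1, ...] with differential
  v (x) P |-> sum_j e_j v (x) l_j P, where l_j has the weight 2^(j+1) of e_j. Injective G-modules
  are acyclic for this complex and their B-invariants are G-invariant, so dimension shifting along
  an injective G-resolution shows that the complex computes rational cohomology of G. Acyclicity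
  reduces to modules of regular functions on SL_2; of these only the part of nonnegative right
  weight matters, and it lies in k[a,b,c] + k[a,c,d], where U acts on one coordinate only.
  For the twisted natural module only the highest weight 2^m contributes, the differential
  vanishes, and the cohomology in degree m has the monomials of degree m and weight 2^m in the l_j
  as a basis. These are the partitions of 2^(m-1) into m powers of 2.
*)

theory Submission
  imports Defs
begin

no_notation fps_nth (infixl "$" 75)

section \<open>Vector-valued polynomials\<close>

text \<open>Cohomology is tested on every injective resolution inside the type \<open>'v\<close>,
  whose terms may have any dimension and any scalar multiplication. Fitting the module coinduced
  from such a term into \<open>'v\<close> would need a comparison of dimensions. Local finiteness
  avoids it: a cocycle has finitely many values, they generate a finite-dimensional submodule, and
  modules of countable dimension always fit. Negative weights never occur because the coefficient of
  a monomial in the l_j must have the torus weight of the corresponding product of the e_j. In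
  nonnegative weights ad - bc = 1 allows b or d to be eliminated; U then acts by a binomial
  expansion in the entry that is left, and by Lucas' theorem mod 2 the operator e_j either clears
  the binary digit j of an exponent or gives zero. Acyclicity thus becomes the exactness, in
  positive degrees, of a combinatorial complex on pairs of a monomial and a set of digits. The e_j
  are not given in advance: they are coefficients of polynomial orbit maps, and their relations come
  from comparing coefficients over an infinite field.\<close>

lemma infinite_alg_closed: "infinite (UNIV :: 'k::alg_closed_field set)"
proof
  assume fin: "finite (UNIV :: 'k set)"
  \<comment> \<open>Euclid's trick: over a finite field this polynomial would take the value 1
    everywhere.\<close>
  define p :: "'k poly" where "p = (\<Prod>a\<in>UNIV. [:-a, 1:]) + 1"
  have "degree (\<Prod>a\<in>(UNIV::'k set). [:-a, 1:]) = card (UNIV :: 'k set)"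
    by (subst degree_prod_eq_sum_degree) auto
  moreover have "card (UNIV :: 'k set) > 0"
    using fin by (simp add: card_gt_0_iff)
  ultimately have "degree p > 0"
    unfolding p_def by (subst degree_add_eq_left) auto
  then obtain x where "poly p x = 0"
    using alg_closed_imp_poly_has_root by blast
  moreover have "poly p x = 1"
    using fin by (auto simp: p_def poly_prod)
  ultimately show False by simp
qed

lemma infinite_nonzero: "infinite (- {0::'k::alg_closed_field})"
  using infinite_alg_closed by (metis Compl_eq_Diff_UNIV finite.emptyI finite_Diff2 finite_insert)

text \<open>Each coordinate in a basis, possibly infinite, is a scalar polynomial with infinitely
  many roots, hence zero.\<close>

lemma (in vector_space) poly_coeffs_zero:
  fixes c :: "nat \<Rightarrow> 'b"
  assumes "infinite T" and "\<And>t. t \<in> T \<Longrightarrow> (\<Sum>k<K. scale (t ^ k) (c k)) = 0" and "k < K"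
  shows "c k = 0"
proof -
  define B where "B = extend_basis {}"
  have ind: "independent B" and sp: "span B = UNIV"
    unfolding B_def using independent_extend_basis[of "{}"] span_extend_basis[of "{}"]
    by (auto simp: independent_empty)
  have "representation B (c k) b = 0" for b
  proof -
    define p where "p = (\<Sum>k<K. monom (representation B (c k) b) k)"
    have "poly p t = 0" if "t \<in> T" for t
    proof -
      have "poly p t = (\<Sum>k<K. t ^ k * representation B (c k) b)"
        by (simp add: p_def poly_sum poly_monom mult.commute)
      also have "\<dots> = representation B (\<Sum>k<K. scale (t ^ k) (c k)) b"
        using ind sp by (simp add: representation_sum representation_scale)
      also have "\<dots> = 0"
        using assms(2)[OF that] by (simp add: representation_zero)
      finally show ?thesis .
    qed
    then have "T \<subseteq> {t. poly p t = 0}" by blast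
    with \<open>infinite T\<close> have "infinite {t. poly p t = 0}"
      using finite_subset by blast
    then have "p = 0"
      using poly_roots_finite by blast
    then have "coeff p k = 0" by simp
    then show ?thesis using \<open>k < K\<close> by (simp add: p_def coeff_sum)
  qed
  then show ?thesis
    using ind sp sum_nonzero_representation_eq[of B "c k"] by simp
qed

text \<open>An element of V[t], stored as its full coefficient sequence with the degree bound
  hidden, so that equality of polynomials is equality of functions.\<close>

definition vexp :: "('k::comm_ring_1 \<Rightarrow> 'v \<Rightarrow> 'v::ab_group_add) \<Rightarrow> ('k \<Rightarrow> 'v) \<Rightarrow> (nat \<Rightarrow> 'v) \<Rightarrow> bool" where
  "vexp s \<phi> c \<longleftrightarrow> (\<exists>K. (\<forall>k\<ge>K. c k = 0) \<and> (\<forall>t. \<phi> t = (\<Sum>k<K. s (t ^ k) (c k))))"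

lemma (in vector_space) sum_pad:
  fixes c :: "nat \<Rightarrow> 'b"
  assumes "\<forall>k\<ge>K. c k = 0" and "K \<le> K'"
  shows "(\<Sum>k<K'. scale (t k) (c k)) = (\<Sum>k<K. scale (t k) (c k))"
  using assms by (intro sum.mono_neutral_right) (auto simp: not_less)

lemma (in vector_space) poly_coeffs_eq:
  assumes T: "infinite T"
    and c: "\<forall>k\<ge>K. c k = 0" and d: "\<forall>k\<ge>L. d k = 0"
    and eq: "\<And>t. t \<in> T \<Longrightarrow> (\<Sum>k<K. scale (t ^ k) (c k)) = (\<Sum>k<L. scale (t ^ k) (d k))"
  shows "c = d"
proof
  fix k
  define N where "N = Suc (max k (max K L))"
  have "c k - d k = 0"
  proof (rule poly_coeffs_zero[OF T, where K = N and c = "\<lambda>k. c k - d k"])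
    fix t assume t: "t \<in> T"
    have "(\<Sum>k<N. scale (t ^ k) (c k - d k)) =
        (\<Sum>k<N. scale (t ^ k) (c k)) - (\<Sum>k<N. scale (t ^ k) (d k))"
      by (simp add: scale_right_diff_distrib sum_subtractf)
    also have "\<dots> = (\<Sum>k<K. scale (t ^ k) (c k)) - (\<Sum>k<L. scale (t ^ k) (d k))"
      using sum_pad[OF c, of N] sum_pad[OF d, of N] by (simp add: N_def)
    finally show "(\<Sum>k<N. scale (t ^ k) (c k - d k)) = 0"
      using eq[OF t] by simp
  qed (simp add: N_def)
  then show "c k = d k" by simp
qed

lemma vexp_unique:
  fixes s :: "'k::alg_closed_field \<Rightarrow> 'v::ab_group_add \<Rightarrow> 'v"
  assumes "vector_space s" and "vexp s \<phi> c" and "vexp s \<phi> d"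
  shows "c = d"
proof -
  interpret vector_space s by fact
  obtain K L where "\<forall>k\<ge>K. c k = 0" "\<forall>t. \<phi> t = (\<Sum>k<K. s (t ^ k) (c k))"
    "\<forall>k\<ge>L. d k = 0" "\<forall>t. \<phi> t = (\<Sum>k<L. s (t ^ k) (d k))"
    using assms(2,3) by (auto simp: vexp_def)
  note KL = this
  show ?thesis
    by (rule poly_coeffs_eq[OF infinite_alg_closed KL(1,3)]) (use KL(2,4) in metis)
qed

lemma (in vector_space) vexpI:
  assumes "\<forall>k\<ge>K. c k = 0" and "\<And>t. \<phi> t = (\<Sum>k<K. scale (t ^ k) (c k))"
  shows "vexp scale \<phi> c"
  using assms by (auto simp: vexp_def)

lemma (in vector_space) vexp_bound:
  assumes "vexp scale \<phi> c"
  obtains K where "\<And>K' t. K \<le> K' \<Longrightarrow> \<phi> t = (\<Sum>k<K'. scale (t ^ k) (c k))"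
    and "\<And>k. K \<le> k \<Longrightarrow> c k = 0"
proof -
  obtain K where K: "\<forall>k\<ge>K. c k = 0" "\<forall>t. \<phi> t = (\<Sum>k<K. scale (t ^ k) (c k))"
    using assms by (auto simp: vexp_def)
  have "\<phi> t = (\<Sum>k<K'. scale (t ^ k) (c k))" if "K \<le> K'" for K' t
    using K(2) sum_pad[OF K(1) that, of "\<lambda>k. t ^ k"] by metis
  then show ?thesis
    using that K(1) by blast
qed

section \<open>Matrices and regular functions\<close>

definition mat2 :: "'k \<Rightarrow> 'k \<Rightarrow> 'k \<Rightarrow> 'k \<Rightarrow> 'k::field ^ 2 ^ 2" where
  "mat2 a b c d = vector [vector [a, b], vector [c, d]]"

lemma mat2_nth [simp]:
  "mat2 a b c d $ 1 $ 1 = a" "mat2 a b c d $ 1 $ 2 = b"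
  "mat2 a b c d $ 2 $ 1 = c" "mat2 a b c d $ 2 $ 2 = d"
  by (simp_all add: mat2_def)

lemma mat2_eta: "mat2 (g $ 1 $ 1) (g $ 1 $ 2) (g $ 2 $ 1) (g $ 2 $ 2) = g"
  by (simp add: vec_eq_iff forall_2)

lemma mat2_mult: "mat2 a b c d ** mat2 a' b' c' d' =
    mat2 (a * a' + b * c') (a * b' + b * d') (c * a' + d * c') (c * b' + d * d')"
  by (simp add: vec_eq_iff forall_2 matrix_matrix_mult_def sum_2)

lemma mat2_one: "mat2 1 0 0 1 = mat 1"
  by (simp add: vec_eq_iff forall_2 mat_def)

lemma mat2_in_SL2 [simp]: "mat2 a b c d \<in> SL2 \<longleftrightarrow> a * d - b * c = 1"
  by (simp add: SL2_def det_2)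

lemma SL2_iff: "g \<in> SL2 \<longleftrightarrow> g $ 1 $ 1 * g $ 2 $ 2 - g $ 1 $ 2 * g $ 2 $ 1 = 1"
  by (simp add: SL2_def det_2)

lemma SL2_mult: "g \<in> SL2 \<Longrightarrow> h \<in> SL2 \<Longrightarrow> g ** h \<in> SL2"
  by (simp add: SL2_def det_mul)

lemma SL2_one [simp]: "mat 1 \<in> SL2"
  by (simp add: SL2_def)

section \<open>The two root subgroups, the torus, and regular functions along them\<close>

abbreviation umat :: "'k \<Rightarrow> 'k::field ^ 2 ^ 2" where "umat t \<equiv> mat2 1 t 0 1"
abbreviation lmat :: "'k \<Rightarrow> 'k::field ^ 2 ^ 2" where "lmat t \<equiv> mat2 1 0 t 1"
abbreviation dmat :: "'k \<Rightarrow> 'k::field ^ 2 ^ 2" where "dmat t \<equiv> mat2 t 0 0 (inverse t)"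

lemma regular_on_poly_curve:
  fixes \<gamma> :: "'k \<Rightarrow> 'k::field ^ 2 ^ 2"
  assumes f: "f \<in> regular_functions" and \<gamma>: "\<And>i j. \<exists>P. \<forall>t. \<gamma> t $ i $ j = poly P t"
  shows "\<exists>P. \<forall>t. f (\<gamma> t) = poly P t"
  using f
proof induction
  case (const c)
  have "\<forall>t. c = poly [:c:] t" by simp
  then show ?case by blast
next
  case (entry i j)
  then show ?case using \<gamma> by blast
next
  case (add f h)
  then obtain P Q where "\<forall>t. f (\<gamma> t) = poly P t" "\<forall>t. h (\<gamma> t) = poly Q t" by blast
  then have "\<forall>t. f (\<gamma> t) + h (\<gamma> t) = poly (P + Q) t" by simp
  then show ?case by blast
next
  case (mult f h)
  then obtain P Q where "\<forall>t. f (\<gamma> t) = poly P t" "\<forall>t. h (\<gamma> t) = poly Q t" by blast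
  then have "\<forall>t. f (\<gamma> t) * h (\<gamma> t) = poly (P * Q) t" by simp
  then show ?case by blast
qed

lemma regular_on_dmat:
  fixes f :: "'k::field ^ 2 ^ 2 \<Rightarrow> 'k"
  assumes "f \<in> regular_functions"
  shows "\<exists>N P. \<forall>n\<ge>N. \<forall>t\<noteq>0. t ^ n * f (dmat t) = t ^ (n - N) * poly P t"
proof -
  have *: "\<exists>N P. \<forall>t\<noteq>0. t ^ N * f (dmat t) = poly P t"
    using assms
  proof induction
    case (const c)
    have "\<forall>t\<noteq>0. t ^ 0 * c = poly [:c:] t" by simp
    then show ?case by blast
  next
    case (entry i j)
    have "\<forall>t::'k. t \<noteq> 0 \<longrightarrow> t ^ 1 * dmat t $ 1 $ 1 = poly [:0,0,1:] t"
      "\<forall>t::'k. t \<noteq> 0 \<longrightarrow> t ^ 1 * dmat t $ 1 $ 2 = poly [:0:] t"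
      "\<forall>t::'k. t \<noteq> 0 \<longrightarrow> t ^ 1 * dmat t $ 2 $ 1 = poly [:0:] t"
      "\<forall>t::'k. t \<noteq> 0 \<longrightarrow> t ^ 1 * dmat t $ 2 $ 2 = poly [:1:] t"
      by simp_all
    moreover have "i = 1 \<or> i = 2" "j = 1 \<or> j = 2"
      by (rule exhaust_2)+
    ultimately have "\<exists>P. \<forall>t::'k. t \<noteq> 0 \<longrightarrow> t ^ 1 * dmat t $ i $ j = poly P t"
      by (elim disjE) (simp_all only:, blast+)
    then show ?case by blast
  next
    case (add f h)
    then obtain N P M Q where NM: "\<forall>t\<noteq>0. t ^ N * f (dmat t) = poly P t" "\<forall>t\<noteq>0. t ^ M * h (dmat t) = poly Q t"
      by blast
    have "t ^ (N + M) * (f (dmat t) + h (dmat t)) = poly (monom 1 M * P + monom 1 N * Q) t"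
      if "t \<noteq> 0" for t
    proof -
      have "t ^ (N + M) * (f (dmat t) + h (dmat t)) =
          t ^ M * (t ^ N * f (dmat t)) + t ^ N * (t ^ M * h (dmat t))"
        by (simp add: power_add distrib_left mult_ac)
      then show ?thesis using NM that by (simp add: poly_monom)
    qed
    then show ?case by blast
  next
    case (mult f h)
    then obtain N P M Q where "\<forall>t\<noteq>0. t ^ N * f (dmat t) = poly P t" "\<forall>t\<noteq>0. t ^ M * h (dmat t) = poly Q t"
      by blast
    then have "\<forall>t\<noteq>0. (t ^ N * f (dmat t)) * (t ^ M * h (dmat t)) = poly (P * Q) t"
      by simp
    then have "\<forall>t\<noteq>0. t ^ (N + M) * (f (dmat t) * h (dmat t)) = poly (P * Q) t"
      by (simp add: power_add mult_ac)
    then show ?case by blast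
  qed
  then obtain N P where NP: "\<forall>t\<noteq>0. t ^ N * f (dmat t) = poly P t" by blast
  have "t ^ n * f (dmat t) = t ^ (n - N) * poly P t" if "n \<ge> N" "t \<noteq> 0" for n t
  proof -
    have "t ^ n = t ^ (n - N) * t ^ N"
      using that by (simp flip: power_add)
    then show ?thesis using NP that by (simp add: mult.assoc)
  qed
  then show ?thesis by blast
qed

section \<open>Linear maps on subspaces\<close>

text \<open>Actions and homomorphisms are controlled only on the underlying space of a module, so
  linearity has to be relative to a subset of the type.\<close>

definition lin_on ::
  "('k::field \<Rightarrow> 'a::ab_group_add \<Rightarrow> 'a) \<Rightarrow> 'a set \<Rightarrow> ('k \<Rightarrow> 'b::ab_group_add \<Rightarrow> 'b) \<Rightarrow> ('a \<Rightarrow> 'b) \<Rightarrow> bool" where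
  "lin_on s1 S s2 L \<longleftrightarrow> (\<forall>x\<in>S. \<forall>y\<in>S. L (x + y) = L x + L y) \<and> (\<forall>c. \<forall>x\<in>S. L (s1 c x) = s2 c (L x))"

lemma lin_on_zero:
  assumes "vector_space s1" "module.subspace s1 S" "lin_on s1 S s2 L"
  shows "L 0 = 0"
proof -
  interpret vector_space s1 by fact
  have "0 \<in> S" using assms(2) by (rule subspace_0)
  then have "L (0 + 0) = L 0 + L 0" using assms(3) unfolding lin_on_def by blast
  then show ?thesis by simp
qed

lemma lin_on_sum:
  assumes "vector_space s1" "module.subspace s1 S" "lin_on s1 S s2 L" "\<And>i. i \<in> A \<Longrightarrow> f i \<in> S"
  shows "L (\<Sum>i\<in>A. s1 (a i) (f i)) = (\<Sum>i\<in>A. s2 (a i) (L (f i)))"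
proof -
  interpret vector_space s1 by fact
  show ?thesis
    using assms(4)
  proof (induction A rule: infinite_finite_induct)
    case (insert i A)
    have "(\<Sum>i\<in>A. s1 (a i) (f i)) \<in> S" "s1 (a i) (f i) \<in> S"
      using insert.prems assms(2) by (auto intro!: subspace_sum subspace_scale)
    then show ?case
      using insert assms(3) by (simp add: lin_on_def)
  qed (simp_all add: lin_on_zero[OF assms(1-3)])
qed

lemma lin_on_add_sum:
  assumes "vector_space s1" "module.subspace s1 S" "lin_on s1 S s2 L" "\<And>i. i \<in> A \<Longrightarrow> f i \<in> S"
  shows "L (\<Sum>i\<in>A. f i) = (\<Sum>i\<in>A. L (f i))"
proof -
  interpret vector_space s1 by fact
  show ?thesis
    using assms(4)
  proof (induction A rule: infinite_finite_induct)
    case (insert i A)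
    have "(\<Sum>i\<in>A. f i) \<in> S" "f i \<in> S"
      using insert.prems assms(2) by (auto intro!: subspace_sum subspace_scale)
    then show ?case
      using insert assms(3) by (simp add: lin_on_def)
  qed (simp_all add: lin_on_zero[OF assms(1-3)])
qed

lemma vexp_lin:
  assumes "vector_space s1" "module.subspace s1 S" "lin_on s1 S s2 L" "\<And>k. c k \<in> S" "vexp s1 \<phi> c"
  shows "vexp s2 (\<lambda>t. L (\<phi> t)) (\<lambda>k. L (c k))"
proof -
  obtain K where K: "\<forall>k\<ge>K. c k = 0" "\<forall>t. \<phi> t = (\<Sum>k<K. s1 (t ^ k) (c k))"
    using assms(5) by (auto simp: vexp_def)
  have "\<forall>t. L (\<phi> t) = (\<Sum>k<K. s2 (t ^ k) (L (c k)))"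
    using K(2) assms(4) by (simp add: lin_on_sum[OF assms(1-3)])
  moreover have "\<forall>k\<ge>K. L (c k) = 0"
    using K(1) by (simp add: lin_on_zero[OF assms(1-3)])
  ultimately show ?thesis unfolding vexp_def by blast
qed

text \<open>The range of the extension is the span of the images of a basis of \<open>S\<close>, so
  it stays in \<open>T\<close>. This supplies retractions onto submodules and extensions of linear
  maps, without any equivariance.\<close>

lemma lin_on_extend:
  assumes "vector_space s1" "vector_space s2" "module.subspace s1 S" "module.subspace s2 T"
    and L: "lin_on s1 S s2 L" "\<And>x. x \<in> S \<Longrightarrow> L x \<in> T"
  obtains L' where "lin_on s1 UNIV s2 L'" "\<And>x. x \<in> S \<Longrightarrow> L' x = L x" "\<And>x. L' x \<in> T"
proof -
  interpret vector_space_pair s1 s2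
    by (intro vector_space_pair.intro assms)
  obtain B where B: "B \<subseteq> S" "vs1.independent B" "S \<subseteq> vs1.span B"
    using vs1.maximal_independent_subset[of S] by blast
  obtain g where g: "Vector_Spaces.linear s1 s2 g" "\<forall>x\<in>B. g x = L x" "range g = vs2.span (L ` B)"
    using linear_independent_extend_subspace[OF B(2), of L] by blast
  interpret g: Vector_Spaces.linear s1 s2 g by fact
  have *: "g x = L x \<and> x \<in> S" if "x \<in> vs1.span B" for x
    using that
  proof (induction rule: vs1.span_induct_alt)
    case base
    show ?case
      using lin_on_zero[OF assms(1,3) L(1)] vs1.subspace_0[OF assms(3)] by simp
  next
    case (step c x y)
    have "x \<in> S" using step B(1) by blast
    then have "s1 c x \<in> S" using assms(3) by (rule vs1.subspace_scale[rotated])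
    then have "L (s1 c x + y) = s2 c (L x) + L y"
      using L(1) step \<open>x \<in> S\<close> unfolding lin_on_def by auto
    moreover have "s1 c x + y \<in> S"
      using step \<open>s1 c x \<in> S\<close> assms(3) by (auto intro: vs1.subspace_add)
    ultimately show ?case
      using g(2) step by (simp add: g.add g.scale)
  qed
  have "vs2.span (L ` B) \<subseteq> T"
    by (rule vs2.span_minimal) (use L(2) B(1) assms(4) in auto)
  then have "g x \<in> T" for x using g(3) by blast
  moreover have "lin_on s1 UNIV s2 g" by (simp add: lin_on_def g.add g.scale)
  ultimately show ?thesis using that * B(3) by blast
qed

section \<open>Rational modules\<close>

text \<open>The divided power \<open>E^(n)\<close> in the distribution algebra of the upper
  unipotent group, read off as the coefficient of \<open>t ^ n\<close> in the orbit map. The choice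
  is harmless: coefficients are unique over an infinite field.\<close>

definition gE :: "('k::field, 'v::ab_group_add) gmod \<Rightarrow> nat \<Rightarrow> 'v \<Rightarrow> 'v" where
  "gE V n v = (SOME c. vexp (gscale V) (\<lambda>t. gact V (umat t) v) c) n"

text \<open>Natural numbers suffice as weights: cochains only use the weights
  \<open>2 * wt M\<close>.\<close>

definition wsp :: "('k::field, 'v::ab_group_add) gmod \<Rightarrow> nat \<Rightarrow> 'v set" where
  "wsp V n = {v \<in> gspace V. \<forall>s. s \<noteq> 0 \<longrightarrow> gact V (dmat s) v = gscale V (s ^ n) v}"

locale rational =
  fixes V :: "('k::alg_closed_field, 'v::ab_group_add) gmod"
  assumes rational: "rational_module V"
begin

sublocale vector_space "gscale V"
  using rational by (simp add: rational_module_def)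

lemma sub: "subspace (gspace V)"
  using rational by (simp add: rational_module_def)

lemmas zero_in [simp] = subspace_0[OF sub]
lemmas add_in = subspace_add[OF sub]
lemmas scale_in = subspace_scale[OF sub]
lemmas diff_in = subspace_diff[OF sub]
lemmas sum_in = subspace_sum[OF sub]

lemma act_in: "g \<in> SL2 \<Longrightarrow> v \<in> gspace V \<Longrightarrow> gact V g v \<in> gspace V"
  using rational by (simp add: rational_module_def)

lemma act_lin: "g \<in> SL2 \<Longrightarrow> lin_on (gscale V) (gspace V) (gscale V) (gact V g)"
  using rational by (simp add: rational_module_def lin_on_def)

lemma act_add: "g \<in> SL2 \<Longrightarrow> v \<in> gspace V \<Longrightarrow> w \<in> gspace V \<Longrightarrow> gact V g (v + w) = gact V g v + gact V g w"
  using act_lin by (auto simp: lin_on_def)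

lemma act_scale: "g \<in> SL2 \<Longrightarrow> v \<in> gspace V \<Longrightarrow> gact V g (gscale V c v) = gscale V c (gact V g v)"
  using act_lin by (auto simp: lin_on_def)

lemma act_zero [simp]: "g \<in> SL2 \<Longrightarrow> gact V g 0 = 0"
  by (rule lin_on_zero[OF vector_space_axioms sub act_lin])

lemma act_one: "v \<in> gspace V \<Longrightarrow> gact V (mat 1) v = v"
  using rational by (simp add: rational_module_def)

lemma act_mult: "g \<in> SL2 \<Longrightarrow> h \<in> SL2 \<Longrightarrow> v \<in> gspace V \<Longrightarrow> gact V (g ** h) v = gact V g (gact V h v)"
  using rational by (simp add: rational_module_def)

lemma orbit:
  assumes "v \<in> gspace V"
  obtains n :: nat and f w where "\<And>i. i < n \<Longrightarrow> f i \<in> regular_functions" "\<And>i. i < n \<Longrightarrow> w i \<in> gspace V"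
    "\<And>g. g \<in> SL2 \<Longrightarrow> gact V g v = (\<Sum>i<n. gscale V (f i g) (w i))"
proof -
  have "\<exists>(n::nat) f w. (\<forall>i<n. f i \<in> regular_functions \<and> w i \<in> gspace V) \<and>
        (\<forall>g\<in>SL2. gact V g v = (\<Sum>i<n. gscale V (f i g) (w i)))"
    using rational assms unfolding rational_module_def by blast
  then show ?thesis using that by blast
qed

end

lemma poly_eq_sum:
  assumes "degree p < K"
  shows "poly p (x::'a::comm_ring_1) = (\<Sum>k<K. coeff p k * x ^ k)"
  unfolding poly_altdef
  by (intro sum.mono_neutral_left) (use assms in \<open>auto simp: coeff_eq_0\<close>)

context rational
begin

lemma sum_poly_exp:
  fixes P :: "nat \<Rightarrow> 'k poly"
  assumes w: "\<And>i. i < n \<Longrightarrow> w i \<in> gspace V"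
  obtains c K where "\<And>k. c k \<in> gspace V" "\<forall>k\<ge>K. c k = 0"
    "\<And>t. (\<Sum>i<n. gscale V (poly (P i) t) (w i)) = (\<Sum>k<K. gscale V (t ^ k) (c k))"
proof -
  define K where "K = Suc (\<Sum>i<n. degree (P i))"
  define c where "c k = (\<Sum>i<n. gscale V (coeff (P i) k) (w i))" for k
  have deg: "degree (P i) < K" if "i < n" for i
  proof -
    have "degree (P i) \<le> (\<Sum>i<n. degree (P i))"
      using that by (intro member_le_sum) auto
    then show ?thesis by (simp add: K_def)
  qed
  have "\<forall>k\<ge>K. c k = 0"
    unfolding c_def
  proof (intro allI impI sum.neutral ballI)
    fix k i assume "K \<le> k" "i \<in> {..<n}"
    then have "coeff (P i) k = 0"
      using deg[of i] by (intro coeff_eq_0) simp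
    then show "gscale V (coeff (P i) k) (w i) = 0" by simp
  qed
  moreover have "(\<Sum>i<n. gscale V (poly (P i) t) (w i)) = (\<Sum>k<K. gscale V (t ^ k) (c k))" for t
  proof -
    have "(\<Sum>i<n. gscale V (poly (P i) t) (w i)) =
        (\<Sum>i<n. \<Sum>k<K. gscale V (t ^ k) (gscale V (coeff (P i) k) (w i)))"
    proof (intro sum.cong refl)
      fix i assume "i \<in> {..<n}"
      then have "poly (P i) t = (\<Sum>k<K. coeff (P i) k * t ^ k)"
        using deg[of i] by (intro poly_eq_sum) simp
      then show "gscale V (poly (P i) t) (w i) =
          (\<Sum>k<K. gscale V (t ^ k) (gscale V (coeff (P i) k) (w i)))"
        by (simp add: scale_sum_left mult.commute)
    qed
    also have "\<dots> = (\<Sum>k<K. gscale V (t ^ k) (c k))"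
      unfolding c_def scale_sum_right by (rule sum.swap)
    finally show ?thesis .
  qed
  moreover have "c k \<in> gspace V" for k
    unfolding c_def by (intro sum_in scale_in w) simp
  ultimately show ?thesis using that by blast
qed

lemma curve_exp:
  fixes \<gamma> :: "'k \<Rightarrow> 'k ^ 2 ^ 2"
  assumes "\<And>t. \<gamma> t \<in> SL2" "\<And>i j. \<exists>P. \<forall>t. \<gamma> t $ i $ j = poly P t" "v \<in> gspace V"
  obtains c where "\<And>k. c k \<in> gspace V" "vexp (gscale V) (\<lambda>t. gact V (\<gamma> t) v) c"
proof -
  obtain n :: nat and f w where f: "\<And>i. i < n \<Longrightarrow> f i \<in> regular_functions"
    and w: "\<And>i. i < n \<Longrightarrow> w i \<in> gspace V"
    and eq: "\<And>g. g \<in> SL2 \<Longrightarrow> gact V g v = (\<Sum>i<n. gscale V (f i g) (w i))"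
    using orbit[OF assms(3)] by metis
  have "\<exists>P. \<forall>t. f i (\<gamma> t) = poly P t" if "i < n" for i
    by (rule regular_on_poly_curve[OF f[OF that] assms(2)])
  then obtain P where P: "\<And>i t. i < n \<Longrightarrow> f i (\<gamma> t) = poly (P i) t"
    by metis
  obtain c K where c: "\<And>k. c k \<in> gspace V" "\<forall>k\<ge>K. c k = 0"
    "\<And>t. (\<Sum>i<n. gscale V (poly (P i) t) (w i)) = (\<Sum>k<K. gscale V (t ^ k) (c k))"
    by (rule sum_poly_exp[OF w, where P = P]) blast+
  have "gact V (\<gamma> t) v = (\<Sum>k<K. gscale V (t ^ k) (c k))" for t
    unfolding c(3)[symmetric] using eq[OF assms(1)] P by simp
  then have "vexp (gscale V) (\<lambda>t. gact V (\<gamma> t) v) c"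
    using c(2) by (intro vexpI)
  then show ?thesis using that c(1) by blast
qed

text \<open>The decomposition of \<open>v\<close> into weight vectors, shifted by \<open>N\<close>
  to avoid negative exponents: \<open>c k\<close> has weight \<open>k - N\<close>, as verified in
  \<open>wsp_lift\<close>.\<close>

lemma torus_exp:
  assumes "v \<in> gspace V"
  obtains N c K where "\<And>k. c k \<in> gspace V" "\<forall>k\<ge>K. c k = 0"
    "\<And>t. t \<noteq> 0 \<Longrightarrow> gscale V (t ^ N) (gact V (dmat t) v) = (\<Sum>k<K. gscale V (t ^ k) (c k))"
proof -
  obtain n :: nat and f w where f: "\<And>i. i < n \<Longrightarrow> f i \<in> regular_functions"
    and w: "\<And>i. i < n \<Longrightarrow> w i \<in> gspace V"
    and eq: "\<And>g. g \<in> SL2 \<Longrightarrow> gact V g v = (\<Sum>i<n. gscale V (f i g) (w i))"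
    using orbit[OF assms] by metis
  have "\<exists>N P. \<forall>n\<ge>N. \<forall>t\<noteq>0. t ^ n * f i (dmat t) = t ^ (n - N) * poly P t" if "i < n" for i
    by (rule regular_on_dmat[OF f[OF that]])
  then obtain M Q where MQ: "\<And>i n' t. i < n \<Longrightarrow> n' \<ge> M i \<Longrightarrow> t \<noteq> 0 \<Longrightarrow>
      t ^ n' * f i (dmat t) = t ^ (n' - M i) * poly (Q i) t"
    by metis
  define N where "N = (\<Sum>i<n. M i)"
  have N: "M i \<le> N" if "i < n" for i
    using that unfolding N_def by (intro member_le_sum) auto
  define P where "P i = monom 1 (N - M i) * Q i" for i
  obtain c K where c: "\<And>k. c k \<in> gspace V" "\<forall>k\<ge>K. c k = 0"
    "\<And>t. (\<Sum>i<n. gscale V (poly (P i) t) (w i)) = (\<Sum>k<K. gscale V (t ^ k) (c k))"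
    by (rule sum_poly_exp[OF w, where P = P]) blast+
  have "gscale V (t ^ N) (gact V (dmat t) v) = (\<Sum>k<K. gscale V (t ^ k) (c k))" if "t \<noteq> 0" for t
  proof -
    have "gscale V (t ^ N) (gact V (dmat t) v) = (\<Sum>i<n. gscale V (t ^ N * f i (dmat t)) (w i))"
      using that by (simp add: eq scale_sum_right)
    also have "\<dots> = (\<Sum>i<n. gscale V (poly (P i) t) (w i))"
      using that MQ N by (intro sum.cong refl) (simp add: P_def poly_monom)
    finally show ?thesis using c(3) by simp
  qed
  then show ?thesis using that c by blast
qed

lemma umat_poly: "\<exists>P. \<forall>t::'k. umat t $ i $ j = poly P t"
proof -
  have "\<forall>t::'k. umat t $ 1 $ 1 = poly 1 t" "\<forall>t::'k. umat t $ 1 $ 2 = poly [:0,1:] t"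
    "\<forall>t::'k. umat t $ 2 $ 1 = poly 0 t" "\<forall>t::'k. umat t $ 2 $ 2 = poly 1 t" by simp_all
  moreover have "i = 1 \<or> i = 2" "j = 1 \<or> j = 2" by (rule exhaust_2)+
  ultimately show ?thesis by (elim disjE) (simp_all only:, blast+)
qed

lemma lmat_poly: "\<exists>P. \<forall>t::'k. lmat t $ i $ j = poly P t"
proof -
  have "\<forall>t::'k. lmat t $ 1 $ 1 = poly 1 t" "\<forall>t::'k. lmat t $ 2 $ 1 = poly [:0,1:] t"
    "\<forall>t::'k. lmat t $ 1 $ 2 = poly 0 t" "\<forall>t::'k. lmat t $ 2 $ 2 = poly 1 t" by simp_all
  moreover have "i = 1 \<or> i = 2" "j = 1 \<or> j = 2" by (rule exhaust_2)+
  ultimately show ?thesis by (elim disjE) (simp_all only:, blast+)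
qed

lemma E_eqI: "vexp (gscale V) (\<lambda>t. gact V (umat t) v) c \<Longrightarrow> gE V n v = c n"
  unfolding gE_def by (metis someI_ex vexp_unique[OF vector_space_axioms])

lemma
  assumes "v \<in> gspace V"
  shows E_exp: "vexp (gscale V) (\<lambda>t. gact V (umat t) v) (\<lambda>n. gE V n v)"
    and E_in: "gE V n v \<in> gspace V"
proof -
  obtain c where c: "\<And>k. c k \<in> gspace V" "vexp (gscale V) (\<lambda>t. gact V (umat t) v) c"
    using curve_exp[of umat v] umat_poly assms by auto
  then have "gE V n v = c n" for n by (intro E_eqI)
  with c show "vexp (gscale V) (\<lambda>t. gact V (umat t) v) (\<lambda>n. gE V n v)" "gE V n v \<in> gspace V"
    by auto
qed

lemma E_lin: "lin_on (gscale V) (gspace V) (gscale V) (gE V n)"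
proof -
  have "gE V n (v + w) = gE V n v + gE V n w" if vw: "v \<in> gspace V" "w \<in> gspace V" for v w
  proof -
    obtain K where K: "\<And>K' t. K \<le> K' \<Longrightarrow> gact V (umat t) v = (\<Sum>k<K'. gscale V (t ^ k) (gE V k v))"
      "\<And>k. K \<le> k \<Longrightarrow> gE V k v = 0"
      using vexp_bound[OF E_exp[OF vw(1)]] by metis
    obtain L where L: "\<And>K' t. L \<le> K' \<Longrightarrow> gact V (umat t) w = (\<Sum>k<K'. gscale V (t ^ k) (gE V k w))"
      "\<And>k. L \<le> k \<Longrightarrow> gE V k w = 0"
      using vexp_bound[OF E_exp[OF vw(2)]] by metis
    have "vexp (gscale V) (\<lambda>t. gact V (umat t) (v + w)) (\<lambda>k. gE V k v + gE V k w)"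
      by (rule vexpI[where K = "max K L"])
        (auto simp: act_add vw K(1)[of "max K L"] L(1)[of "max K L"] K(2) L(2) scale_right_distrib sum.distrib)
    then show ?thesis by (rule E_eqI)
  qed
  moreover have "gE V n (gscale V a v) = gscale V a (gE V n v)" if v: "v \<in> gspace V" for a v
  proof -
    obtain K where K: "\<And>K' t. K \<le> K' \<Longrightarrow> gact V (umat t) v = (\<Sum>k<K'. gscale V (t ^ k) (gE V k v))"
      "\<And>k. K \<le> k \<Longrightarrow> gE V k v = 0"
      using vexp_bound[OF E_exp[OF v]] by metis
    have "vexp (gscale V) (\<lambda>t. gact V (umat t) (gscale V a v)) (\<lambda>k. gscale V a (gE V k v))"
      by (rule vexpI[where K = K])
        (auto simp: act_scale v K(1)[of K] K(2) scale_sum_right mult.commute)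
    then show ?thesis by (rule E_eqI)
  qed
  ultimately show ?thesis by (auto simp: lin_on_def)
qed

lemma E_zero [simp]: "gE V n 0 = 0"
  by (rule lin_on_zero[OF vector_space_axioms sub E_lin])

lemma E_add: "v \<in> gspace V \<Longrightarrow> w \<in> gspace V \<Longrightarrow> gE V n (v + w) = gE V n v + gE V n w"
  using E_lin by (auto simp: lin_on_def)

lemma E_scale: "v \<in> gspace V \<Longrightarrow> gE V n (gscale V a v) = gscale V a (gE V n v)"
  using E_lin by (auto simp: lin_on_def)

lemmas E_sum = lin_on_add_sum[OF vector_space_axioms sub E_lin]

lemma E_diff: "v \<in> gspace V \<Longrightarrow> w \<in> gspace V \<Longrightarrow> gE V n (v - w) = gE V n v - gE V n w"
  using E_add[of "v - w" w n] by (simp add: diff_in)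

lemma E_0:
  assumes "v \<in> gspace V"
  shows "gE V 0 v = v"
proof -
  obtain K where K: "\<And>K' t. K \<le> K' \<Longrightarrow> gact V (umat t) v = (\<Sum>k<K'. gscale V (t ^ k) (gE V k v))"
    using vexp_bound[OF E_exp[OF assms]] by metis
  have "v = gact V (umat 0) v" using act_one[OF assms] by (simp add: mat2_one)
  also have "\<dots> = (\<Sum>k<Suc K. gscale V (0 ^ k) (gE V k v))" by (rule K) simp
  also have "\<dots> = gE V 0 v" by (subst sum.lessThan_Suc_shift) simp
  finally show ?thesis by simp
qed

lemma E_finite: "v \<in> gspace V \<Longrightarrow> \<exists>K. \<forall>k\<ge>K. gE V k v = 0"
  using vexp_bound[OF E_exp] by metis

text \<open>Comparison of the coefficients of \<open>s ^ i * t ^ j\<close> in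
  \<open>u(s) u(t) = u(s + t)\<close>.\<close>

lemma E_comp:
  assumes v: "v \<in> gspace V"
  shows "gE V i (gE V j v) = gscale V (of_nat ((i + j) choose j)) (gE V (i + j) v)"
proof -
  obtain K where K: "\<And>K' t. K \<le> K' \<Longrightarrow> gact V (umat t) v = (\<Sum>k<K'. gscale V (t ^ k) (gE V k v))"
      "\<And>k. K \<le> k \<Longrightarrow> gE V k v = 0"
    using vexp_bound[OF E_exp[OF v]] by metis
  define d where "d s j = (\<Sum>n<K. gscale V (of_nat (n choose j) * s ^ (n - j)) (gE V n v))" for s j
  have 1: "gact V (umat s) (gE V j v) = d s j" for s j
  proof -
    have "vexp (gscale V) (\<lambda>t. gact V (umat s) (gact V (umat t) v)) (\<lambda>j. gact V (umat s) (gE V j v))"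
      by (rule vexp_lin[OF vector_space_axioms sub act_lin _ E_exp[OF v]]) (simp_all add: E_in v)
    moreover have "vexp (gscale V) (\<lambda>t. gact V (umat s) (gact V (umat t) v)) (d s)"
    proof (rule vexpI[where K = K])
      show "\<forall>k\<ge>K. d s k = 0"
        by (auto simp: d_def binomial_eq_0 intro!: sum.neutral)
      fix t
      have "gact V (umat s) (gact V (umat t) v) = gact V (umat (t + s)) v"
        by (subst act_mult[symmetric]) (simp_all add: mat2_mult v)
      also have "\<dots> = (\<Sum>n<K. gscale V ((t + s) ^ n) (gE V n v))"
        by (rule K) simp
      also have "\<dots> = (\<Sum>n<K. \<Sum>j<K. gscale V (t ^ j) (gscale V (of_nat (n choose j) * s ^ (n - j)) (gE V n v)))"
      proof (intro sum.cong refl)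
        fix n assume "n \<in> {..<K}"
        then have "(\<Sum>j\<le>n. of_nat (n choose j) * t ^ j * s ^ (n - j)) =
            (\<Sum>j<K. of_nat (n choose j) * t ^ j * s ^ (n - j))"
          by (intro sum.mono_neutral_left) (auto simp: not_le binomial_eq_0)
        then have "(t + s) ^ n = (\<Sum>j<K. t ^ j * (of_nat (n choose j) * s ^ (n - j)))"
          by (simp add: binomial_ring mult.assoc mult.left_commute)
        then show "gscale V ((t + s) ^ n) (gE V n v) =
            (\<Sum>j<K. gscale V (t ^ j) (gscale V (of_nat (n choose j) * s ^ (n - j)) (gE V n v)))"
          by (simp add: scale_sum_left)
      qed
      also have "\<dots> = (\<Sum>j<K. gscale V (t ^ j) (d s j))"
        unfolding d_def scale_sum_right by (rule sum.swap)
      finally show "gact V (umat s) (gact V (umat t) v) = (\<Sum>k<K. gscale V (t ^ k) (d s k))" .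
    qed
    ultimately have "(\<lambda>j. gact V (umat s) (gE V j v)) = d s"
      by (rule vexp_unique[OF vector_space_axioms])
    then show ?thesis unfolding fun_eq_iff by blast
  qed
  have "vexp (gscale V) (\<lambda>s. gact V (umat s) (gE V j v))
      (\<lambda>i. gscale V (of_nat ((i + j) choose j)) (gE V (i + j) v))"
  proof (rule vexpI[where K = K])
    show "\<forall>k\<ge>K. gscale V (of_nat ((k + j) choose j)) (gE V (k + j) v) = 0"
      using K(2) by simp
    fix s
    have "d s j = (\<Sum>n<K + j. gscale V (of_nat (n choose j) * s ^ (n - j)) (gE V n v))"
      unfolding d_def by (rule sum.mono_neutral_left) (auto simp: K(2))
    also have "\<dots> = (\<Sum>n\<in>{j..<K + j}. gscale V (of_nat (n choose j) * s ^ (n - j)) (gE V n v))"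
      by (rule sum.mono_neutral_right) (auto simp: binomial_eq_0)
    also have "\<dots> = (\<Sum>i<K. gscale V (s ^ i) (gscale V (of_nat ((i + j) choose j)) (gE V (i + j) v)))"
      using sum.shift_bounds_nat_ivl[of "\<lambda>n. gscale V (of_nat (n choose j) * s ^ (n - j)) (gE V n v)" 0 j K]
      by (simp add: mult.commute lessThan_atLeast0)
    finally show "gact V (umat s) (gE V j v) =
      (\<Sum>i<K. gscale V (s ^ i) (gscale V (of_nat ((i + j) choose j)) (gE V (i + j) v)))"
      by (simp add: 1)
  qed
  then show ?thesis by (rule E_eqI)
qed

lemma wsp_sub: "subspace (wsp V n)"
  by (auto simp: subspace_def wsp_def add_in scale_in act_add act_scale scale_right_distrib mult.commute)

lemma wsp_in: "v \<in> wsp V n \<Longrightarrow> v \<in> gspace V"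
  by (simp add: wsp_def)

lemma wsp_zero [simp]: "0 \<in> wsp V n"
  by (rule subspace_0[OF wsp_sub])

text \<open>From \<open>d(s) u(t) = u(s^2 t) d(s)\<close>: the root has weight 2, so the divided
  power \<open>E^(m)\<close> raises weights by \<open>2 * m\<close>.\<close>

lemma E_wsp:
  assumes "v \<in> wsp V n"
  shows "gE V m v \<in> wsp V (n + 2 * m)"
proof -
  have v: "v \<in> gspace V" using assms by (rule wsp_in)
  obtain K where K: "\<And>K' t. K \<le> K' \<Longrightarrow> gact V (umat t) v = (\<Sum>k<K'. gscale V (t ^ k) (gE V k v))"
      "\<And>k. K \<le> k \<Longrightarrow> gE V k v = 0"
    using vexp_bound[OF E_exp[OF v]] by metis
  have "gact V (dmat s) (gE V m v) = gscale V (s ^ (n + 2 * m)) (gE V m v)" if s: "s \<noteq> 0" for s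
  proof -
    have "vexp (gscale V) (\<lambda>t. gact V (dmat s) (gact V (umat t) v)) (\<lambda>j. gact V (dmat s) (gE V j v))"
      by (rule vexp_lin[OF vector_space_axioms sub act_lin _ E_exp[OF v]]) (simp_all add: E_in v s)
    moreover have "vexp (gscale V) (\<lambda>t. gact V (dmat s) (gact V (umat t) v)) (\<lambda>j. gscale V (s ^ (n + 2 * j)) (gE V j v))"
    proof (rule vexpI[where K = K])
      show "\<forall>k\<ge>K. gscale V (s ^ (n + 2 * k)) (gE V k v) = 0" using K by simp
      fix t
      have "gact V (dmat s) (gact V (umat t) v) = gact V (umat (s^2 * t)) (gact V (dmat s) v)"
        by (subst (1 2) act_mult[symmetric]) (simp_all add: mat2_mult v s field_simps power2_eq_square)
      also have "\<dots> = gscale V (s ^ n) (gact V (umat (s^2 * t)) v)"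
        using assms s v by (simp add: wsp_def act_scale)
      also have "\<dots> = gscale V (s ^ n) (\<Sum>k<K. gscale V ((s^2 * t) ^ k) (gE V k v))"
        by (subst K(1)[of K]) simp_all
      also have "\<dots> = (\<Sum>k<K. gscale V (t ^ k) (gscale V (s ^ (n + 2 * k)) (gE V k v)))"
        by (simp add: scale_sum_right power_mult_distrib power_add mult.commute mult.left_commute flip: power_mult)
      finally show "gact V (dmat s) (gact V (umat t) v) =
        (\<Sum>k<K. gscale V (t ^ k) (gscale V (s ^ (n + 2 * k)) (gE V k v)))" .
    qed
    ultimately have "(\<lambda>j. gact V (dmat s) (gE V j v)) = (\<lambda>j. gscale V (s ^ (n + 2 * j)) (gE V j v))"
      by (rule vexp_unique[OF vector_space_axioms])
    then show ?thesis unfolding fun_eq_iff by blast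
  qed
  then show ?thesis by (simp add: wsp_def E_in v)
qed

end

section \<open>Homomorphisms\<close>

lemma gHomD:
  assumes "\<phi> \<in> gHom V W"
  shows "v \<in> gspace V \<Longrightarrow> \<phi> v \<in> gspace W"
    and "lin_on (gscale V) (gspace V) (gscale W) \<phi>"
    and "g \<in> SL2 \<Longrightarrow> v \<in> gspace V \<Longrightarrow> \<phi> (gact V g v) = gact W g (\<phi> v)"
    and "v \<notin> gspace V \<Longrightarrow> \<phi> v = 0"
  using assms by (auto simp: gHom_def lin_on_def)

lemma gHomI:
  assumes "\<And>v. v \<in> gspace V \<Longrightarrow> \<phi> v \<in> gspace W"
    and "lin_on (gscale V) (gspace V) (gscale W) \<phi>"
    and "\<And>g v. g \<in> SL2 \<Longrightarrow> v \<in> gspace V \<Longrightarrow> \<phi> (gact V g v) = gact W g (\<phi> v)"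
    and "\<And>v. v \<notin> gspace V \<Longrightarrow> \<phi> v = 0"
  shows "\<phi> \<in> gHom V W"
  using assms by (auto simp: gHom_def lin_on_def)

locale rational_hom = V: rational V + W: rational W
  for V :: "('k::alg_closed_field, 'v::ab_group_add) gmod" and W :: "('k, 'w::ab_group_add) gmod" +
  fixes \<phi>
  assumes hom: "\<phi> \<in> gHom V W"
begin

lemmas hom_in = gHomD(1)[OF hom]
lemmas lin = gHomD(2)[OF hom]
lemmas hom_act = gHomD(3)[OF hom]
lemmas hom_zero [simp] = lin_on_zero[OF V.vector_space_axioms V.sub lin]
lemmas hom_sum = lin_on_add_sum[OF V.vector_space_axioms V.sub lin]

lemma hom_add: "v \<in> gspace V \<Longrightarrow> w \<in> gspace V \<Longrightarrow> \<phi> (v + w) = \<phi> v + \<phi> w"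
  using lin by (simp add: lin_on_def)

lemma hom_scale: "v \<in> gspace V \<Longrightarrow> \<phi> (gscale V a v) = gscale W a (\<phi> v)"
  using lin by (simp add: lin_on_def)

lemma hom_diff: "v \<in> gspace V \<Longrightarrow> w \<in> gspace V \<Longrightarrow> \<phi> (v - w) = \<phi> v - \<phi> w"
  using hom_add[of "v - w" w] by (simp add: V.diff_in)

lemma hom_E:
  assumes v: "v \<in> gspace V"
  shows "\<phi> (gE V n v) = gE W n (\<phi> v)"
proof -
  have "vexp (gscale W) (\<lambda>t. \<phi> (gact V (umat t) v)) (\<lambda>j. \<phi> (gE V j v))"
    by (rule vexp_lin[OF V.vector_space_axioms V.sub lin _ V.E_exp[OF v]]) (rule V.E_in[OF v])
  then have "vexp (gscale W) (\<lambda>t. gact W (umat t) (\<phi> v)) (\<lambda>j. \<phi> (gE V j v))"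
    by (simp add: hom_act v)
  then show ?thesis by (rule W.E_eqI[symmetric])
qed

lemma hom_wsp: "v \<in> wsp V n \<Longrightarrow> \<phi> v \<in> wsp W n"
  by (auto simp: wsp_def hom_in hom_act[symmetric] hom_scale)

text \<open>Passage to weight vectors is exact because the torus is diagonalisable: the component of
  weight \<open>n\<close> of any preimage is again a preimage.\<close>

lemma wsp_lift:
  assumes v: "v \<in> gspace V" and w: "\<phi> v \<in> wsp W n"
  obtains v' where "v' \<in> wsp V n" "\<phi> v' = \<phi> v"
proof -
  obtain N c K where c: "\<And>k. c k \<in> gspace V" "\<forall>k\<ge>K. c k = 0"
    and eq: "\<And>t. t \<noteq> 0 \<Longrightarrow> gscale V (t ^ N) (gact V (dmat t) v) = (\<Sum>k<K. gscale V (t ^ k) (c k))"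
    by (rule V.torus_exp[OF v]) blast+
  note inf = infinite_nonzero[where 'k = 'k]
  \<comment> \<open>Expanding \<open>d(s) d(t) = d(s t)\<close> in powers of \<open>t\<close> shows
    that \<open>c k\<close> has weight \<open>k - N\<close>.\<close>
  have 1: "gscale V (s ^ N) (gact V (dmat s) (c k)) = gscale V (s ^ k) (c k)" if s: "s \<noteq> 0" for s k
  proof -
    have "(\<lambda>k. gscale V (s ^ N) (gact V (dmat s) (c k))) = (\<lambda>k. gscale V (s ^ k) (c k))"
    proof (rule V.poly_coeffs_eq[OF inf])
      show "\<forall>k\<ge>K. gscale V (s ^ N) (gact V (dmat s) (c k)) = 0" "\<forall>k\<ge>K. gscale V (s ^ k) (c k) = 0"
        using c(2) s by auto
      fix t :: 'k assume "t \<in> - {0}"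
      then have t: "t \<noteq> 0" by simp
      have "(\<Sum>k<K. gscale V (t ^ k) (gscale V (s ^ N) (gact V (dmat s) (c k)))) =
          gscale V (s ^ N) (\<Sum>k<K. gscale V (t ^ k) (gact V (dmat s) (c k)))"
        by (simp add: V.scale_sum_right mult.commute)
      also have "\<dots> = gscale V (s ^ N) (gact V (dmat s) (\<Sum>k<K. gscale V (t ^ k) (c k)))"
        using s by (subst lin_on_sum[OF V.vector_space_axioms V.sub V.act_lin]) (auto simp: c(1))
      also have "\<dots> = gscale V (s ^ N) (gact V (dmat s) (gscale V (t ^ N) (gact V (dmat t) v)))"
        by (simp add: eq t)
      also have "\<dots> = gscale V ((s * t) ^ N) (gact V (dmat s ** dmat t) v)"
        using s t v by (simp add: V.act_scale V.act_in V.act_mult power_mult_distrib)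
      also have "dmat s ** dmat t = dmat (s * t)"
        by (simp add: mat2_mult)
      also have "gscale V ((s * t) ^ N) (gact V (dmat (s * t)) v) = (\<Sum>k<K. gscale V ((s * t) ^ k) (c k))"
        using s t by (intro eq) simp
      also have "\<dots> = (\<Sum>k<K. gscale V (t ^ k) (gscale V (s ^ k) (c k)))"
        by (simp add: power_mult_distrib mult.commute)
      finally show "(\<Sum>k<K. gscale V (t ^ k) (gscale V (s ^ N) (gact V (dmat s) (c k)))) =
        (\<Sum>k<K. gscale V (t ^ k) (gscale V (s ^ k) (c k)))" .
    qed
    then show ?thesis unfolding fun_eq_iff by blast
  qed
  have "gact V (dmat s) (c (N + n)) = gscale V (s ^ n) (c (N + n))" if s: "s \<noteq> 0" for s
  proof -
    have "gscale V (s ^ N) (gact V (dmat s) (c (N + n))) = gscale V (s ^ N) (gscale V (s ^ n) (c (N + n)))"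
      using 1[OF s] by (simp add: power_add)
    then show ?thesis using s by (subst (asm) V.scale_cancel_left) simp
  qed
  then have "c (N + n) \<in> wsp V n" by (simp add: wsp_def c(1))
  \<comment> \<open>Since \<open>\<phi> v\<close> has weight \<open>n\<close>, its expansion
    consists of the single power \<open>t ^ (N + n)\<close>.\<close>
  moreover have "(\<lambda>k. \<phi> (c k)) = (\<lambda>k. if k = N + n then \<phi> v else 0)"
  proof (rule W.poly_coeffs_eq[OF inf, where K = K and L = "Suc (N + n)"])
    show "\<forall>k\<ge>K. \<phi> (c k) = 0" using c(2) by simp
    show "\<forall>k\<ge>Suc (N + n). (if k = N + n then \<phi> v else 0) = 0" by auto
    fix t :: 'k assume "t \<in> - {0}"
    then have t: "t \<noteq> 0" by simp
    have "(\<Sum>k<K. gscale W (t ^ k) (\<phi> (c k))) = \<phi> (gscale V (t ^ N) (gact V (dmat t) v))"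
      unfolding eq[OF t] by (rule lin_on_sum[OF V.vector_space_axioms V.sub lin, symmetric]) (rule c(1))
    also have "\<dots> = gscale W (t ^ N) (gact W (dmat t) (\<phi> v))"
      using t v by (simp add: hom_scale V.act_in hom_act)
    also have "\<dots> = gscale W (t ^ (N + n)) (\<phi> v)"
      using w t by (simp add: wsp_def power_add)
    also have "\<dots> = (\<Sum>k<Suc (N + n). gscale W (t ^ k) (if k = N + n then \<phi> v else 0))"
      by simp
    finally show "(\<Sum>k<K. gscale W (t ^ k) (\<phi> (c k))) =
      (\<Sum>k<Suc (N + n). gscale W (t ^ k) (if k = N + n then \<phi> v else 0))" .
  qed
  then have "\<phi> (c (N + n)) = \<phi> v" by (drule_tac x = "N + n" in fun_cong) simp
  ultimately show ?thesis using that by blast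
qed

end

text \<open>The vectors \<open>w i\<close> in the orbit formula of \<open>V\<close> may lie outside
  \<open>S\<close>. A linear retraction onto \<open>S\<close> moves them into \<open>S\<close> and
  fixes the orbit, whether or not it is equivariant.\<close>

lemma rational_submodule:
  fixes V :: "('k::alg_closed_field, 'v::ab_group_add) gmod"
  assumes "rational_module V" and S: "submodule_of V S"
  shows "rational_module (V\<lparr>gspace := S\<rparr>)"
proof -
  interpret rational V by standard fact
  have SV: "S \<subseteq> gspace V" and subS: "subspace S"
    and act: "\<And>g v. g \<in> SL2 \<Longrightarrow> v \<in> S \<Longrightarrow> gact V g v \<in> S"
    using S by (auto simp: submodule_of_def)
  have "lin_on (gscale V) S (gscale V) (\<lambda>x. x)" by (simp add: lin_on_def)
  then obtain P where P: "lin_on (gscale V) UNIV (gscale V) P" "\<And>x. x \<in> S \<Longrightarrow> P x = x" "\<And>x. P x \<in> S"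
    by (rule lin_on_extend[OF vector_space_axioms vector_space_axioms subS subS]) blast+
  have "\<exists>(n::nat) f w. (\<forall>i<n. f i \<in> regular_functions \<and> w i \<in> S) \<and>
        (\<forall>g\<in>SL2. gact V g v = (\<Sum>i<n. gscale V (f i g) (w i)))" if v: "v \<in> S" for v
  proof -
    obtain n :: nat and f w where f: "\<And>i. i < n \<Longrightarrow> f i \<in> regular_functions"
      and eq: "\<And>g. g \<in> SL2 \<Longrightarrow> gact V g v = (\<Sum>i<n. gscale V (f i g) (w i))"
      using orbit[OF subsetD[OF SV v]] by metis
    have "gact V g v = (\<Sum>i<n. gscale V (f i g) (P (w i)))" if g: "g \<in> SL2" for g
    proof -
      have "gact V g v = P (gact V g v)" using P(2)[OF act[OF g v]] by simp
      also have "\<dots> = (\<Sum>i<n. gscale V (f i g) (P (w i)))"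
        unfolding eq[OF g] by (rule lin_on_sum[OF vector_space_axioms subspace_UNIV P(1)]) simp
      finally show ?thesis .
    qed
    then show ?thesis
      by (intro exI[of _ n] exI[of _ f] exI[of _ "\<lambda>i. P (w i)"] conjI ballI allI impI) (simp_all add: f P(3))
  qed
  then show ?thesis
    unfolding rational_module_def
    using SV subS act by (simp add: vector_space_axioms act_add act_scale act_one act_mult subset_iff)
qed

section \<open>Parity of binomial coefficients\<close>

text \<open>Two applications of Pascal's rule produce even middle terms, so mod 2 the even rows of
  Pascal's triangle copy the whole triangle.\<close>

lemma binomial_double_parity:
  "odd ((2 * n) choose (2 * m)) = odd (n choose m)" "even ((2 * n) choose (2 * m + 1))"
proof (induction n arbitrary: m)
  case 0
  { case 1 then show ?case by (cases m) auto
  next case 2 then show ?case by simp }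
next
  case (Suc n)
  have odd_step: "(2 * n + 2) choose (2 * m + 1) =
      (2 * n choose (2 * m + 1)) + 2 * (2 * n choose (2 * m)) + (if m = 0 then 0 else 2 * n choose (2 * (m - 1) + 1))" for m
    by (cases m) (simp_all add: numeral_2_eq_2)
  have even_step: "(2 * n + 2) choose (2 * Suc m) =
      (2 * n choose (2 * Suc m)) + 2 * (2 * n choose (2 * m + 1)) + (2 * n choose (2 * m))" for m
    by (simp add: numeral_2_eq_2)
  { case 1
    show ?case
    proof (cases m)
      case (Suc m')
      have "odd (2 * Suc n choose (2 * Suc m')) = odd ((n choose Suc m') + (n choose m'))"
        using even_step[of m'] Suc.IH(1)[of "Suc m'"] Suc.IH(1)[of m'] by (simp del: binomial_Suc_Suc)
      then show ?thesis using Suc by (simp add: add.commute)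
    qed simp
  next
    case 2
    show ?case
      using odd_step[of m] Suc.IH(2)[of m] Suc.IH(2)[of "m - 1"] by (simp del: binomial_Suc_Suc) }
qed

text \<open>Lucas' theorem mod 2 for a lower index with a single binary digit.\<close>

lemma odd_binomial_power2: "odd (n choose (2 ^ j)) \<longleftrightarrow> bit n j"
proof (induction j arbitrary: n)
  case 0
  then show ?case by (simp add: bit_0)
next
  case (Suc j)
  obtain m where m: "(2::nat) ^ j = Suc m"
    using not0_implies_Suc[of "2 ^ j"] by auto
  have "odd (n choose (2 ^ Suc j)) = odd ((n div 2) choose (2 ^ j))"
  proof (cases "even n")
    case True
    then show ?thesis
      using binomial_double_parity(1)[of "n div 2" "2 ^ j"] by simp
  next
    case False
    then obtain q where q: "n = Suc (2 * q)" using oddE by (metis Suc_eq_plus1)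
    have "(2::nat) ^ Suc j = Suc (2 * m + 1)" using m by simp
    then have "n choose (2 ^ Suc j) = (2 * q choose (2 * m + 1)) + (2 * q choose (2 * 2 ^ j))"
      unfolding q by simp
    then show ?thesis
      using binomial_double_parity[of q "2 ^ j"] binomial_double_parity(2)[of q m] q by simp
  qed
  then show ?case using Suc.IH by (simp add: bit_Suc)
qed

section \<open>The Koszul complex of the Borel subgroup in characteristic 2\<close>

text \<open>
  In characteristic 2 the divided powers \<open>e\<^sub>j = E\<^bsub>2^j\<^esub>\<close> of the unipotent radical commute, square
  to zero and generate its hyperalgebra. The cochains below are the torus-invariants of the
  Koszul-dual complex $V \otimes k[\lambda_0,\lambda_1,\dots]$, a multiset \<open>M\<close> standing for the
  monomial $\prod_{j\in M}\lambda_j$.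
\<close>

definition wt :: "nat multiset \<Rightarrow> nat" where
  "wt M = (\<Sum>j\<in>#M. 2 ^ j)"

lemma wt_add [simp]: "wt (add_mset j M) = 2 ^ j + wt M" and wt_empty [simp]: "wt {#} = 0"
  by (simp_all add: wt_def)

lemma wt_remove: "j \<in># M \<Longrightarrow> wt (M - {#j#}) + 2 ^ j = wt M"
  by (metis add.commute insert_DiffM wt_add)

abbreviation ge :: "('k::field, 'v::ab_group_add) gmod \<Rightarrow> nat \<Rightarrow> 'v \<Rightarrow> 'v" where
  "ge V j \<equiv> gE V (2 ^ j)"

text \<open>The factor 2 appears because \<open>e_j\<close> has weight \<open>2 * 2 ^ j\<close>, of
  which \<open>wt\<close> counts half. Finite support makes a cochain a polynomial, not a power
  series, in the infinitely many variables.\<close>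

definition cochains :: "('k::field, 'v::ab_group_add) gmod \<Rightarrow> nat \<Rightarrow> (nat multiset \<Rightarrow> 'v) set" where
  "cochains V t = {f. (\<forall>M. f M \<in> wsp V (2 * wt M)) \<and> (\<forall>M. size M \<noteq> t \<longrightarrow> f M = 0) \<and> finite {M. f M \<noteq> 0}}"

text \<open>The sum runs over the distinct indices in \<open>M\<close>: only one monomial,
  \<open>M - {#j#}\<close>, yields \<open>M\<close> when multiplied by the variable of index
  \<open>j\<close>, whatever the multiplicity of \<open>j\<close>.\<close>

definition dK :: "('k::field, 'v::ab_group_add) gmod \<Rightarrow> (nat multiset \<Rightarrow> 'v) \<Rightarrow> nat multiset \<Rightarrow> 'v" where
  "dK V f M = (\<Sum>j\<in>set_mset M. ge V j (f (M - {#j#})))"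

definition cocycles :: "('k::field, 'v::ab_group_add) gmod \<Rightarrow> nat \<Rightarrow> (nat multiset \<Rightarrow> 'v) set" where
  "cocycles V t = {f \<in> cochains V t. \<forall>M. dK V f M = 0}"

definition coboundaries :: "('k::field, 'v::ab_group_add) gmod \<Rightarrow> nat \<Rightarrow> (nat multiset \<Rightarrow> 'v) set" where
  "coboundaries V t = (case t of 0 \<Rightarrow> {\<lambda>M. 0} | Suc i \<Rightarrow> dK V ` cochains V i)"

definition acyclic_module :: "('k::field, 'v::ab_group_add) gmod \<Rightarrow> bool" where
  "acyclic_module V \<longleftrightarrow> (\<forall>t. cocycles V (Suc t) \<subseteq> dK V ` cochains V t)"

lemma of_nat_char2:
  assumes "CHAR('a::ring_1) = 2"
  shows "(of_nat n :: 'a) = (if even n then 0 else 1)"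
proof -
  have *: "(of_nat m :: 'a) = 0" if "even m" for m
    using that assms by (simp add: of_nat_eq_0_iff_char_dvd)
  show ?thesis
  proof (cases "even n")
    case False
    then have "(of_nat n :: 'a) = of_nat (n - 1) + 1"
      by (cases n) auto
    then show ?thesis using False *[of "n - 1"] by simp
  qed (simp add: *)
qed

lemma (in vector_space) double_zero_char2:
  assumes "CHAR('a) = 2"
  shows "(x::'b) + x = 0"
proof -
  have "x + x = scale (1 + 1) x" by (simp only: scale_left_distrib scale_one)
  also have "(1 + 1 :: 'a) = of_nat 2" by simp
  also have "\<dots> = 0" using assms by (simp only: of_nat_char2) simp
  finally show ?thesis by simp
qed

section \<open>The spaces of cochains and the differential between them\<close>

context rational
begin

lemma cochainsD:
  assumes "f \<in> cochains V t"
  shows "f M \<in> wsp V (2 * wt M)" "f M \<in> gspace V" "size M \<noteq> t \<Longrightarrow> f M = 0" "finite {M. f M \<noteq> 0}"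
  using assms by (auto simp: cochains_def intro: wsp_in)

lemma cochains_zero [simp]: "(\<lambda>M. 0) \<in> cochains V t"
  by (simp add: cochains_def)

lemma cochains_add:
  assumes "f \<in> cochains V t" "h \<in> cochains V t"
  shows "(\<lambda>M. f M + h M) \<in> cochains V t"
proof -
  have "{M. f M + h M \<noteq> 0} \<subseteq> {M. f M \<noteq> 0} \<union> {M. h M \<noteq> 0}" by auto
  then have "finite {M. f M + h M \<noteq> 0}"
    by (rule finite_subset) (simp add: cochainsD(4)[OF assms(1)] cochainsD(4)[OF assms(2)])
  then show ?thesis
    using assms by (auto simp: cochains_def intro: subspace_add[OF wsp_sub])
qed

lemma cochains_scale:
  assumes "f \<in> cochains V t"
  shows "(\<lambda>M. gscale V c (f M)) \<in> cochains V t"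
proof -
  have "{M. gscale V c (f M) \<noteq> 0} \<subseteq> {M. f M \<noteq> 0}" by auto
  then have "finite {M. gscale V c (f M) \<noteq> 0}"
    by (rule finite_subset) (rule cochainsD(4)[OF assms])
  then show ?thesis
    using assms by (auto simp: cochains_def intro: subspace_scale[OF wsp_sub])
qed

lemma cochains_diff:
  assumes "f \<in> cochains V t" "h \<in> cochains V t"
  shows "(\<lambda>M. f M - h M) \<in> cochains V t"
proof -
  have "(\<lambda>M. f M + gscale V (-1) (h M)) \<in> cochains V t"
    by (intro cochains_add cochains_scale assms)
  then show ?thesis by simp
qed

lemma dK_in:
  assumes f: "f \<in> cochains V t"
  shows "dK V f \<in> cochains V (Suc t)"
proof -
  note fD = cochainsD[OF f]
  have "dK V f M \<in> wsp V (2 * wt M)" for M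
    unfolding dK_def
  proof (rule subspace_sum[OF wsp_sub])
    fix j assume j: "j \<in> set_mset M"
    have "2 * wt (M - {#j#}) + 2 * 2 ^ j = 2 * wt M"
      using wt_remove[OF j] by simp
    then show "ge V j (f (M - {#j#})) \<in> wsp V (2 * wt M)"
      using E_wsp[OF fD(1), of "2 ^ j" "M - {#j#}"] by simp
  qed
  moreover have "dK V f M = 0" if "size M \<noteq> Suc t" for M
    unfolding dK_def
  proof (intro sum.neutral ballI)
    fix j assume j: "j \<in> set_mset M"
    then have "size (M - {#j#}) \<noteq> t"
      using that by (metis size_Suc_Diff1)
    then show "ge V j (f (M - {#j#})) = 0" using fD(3) by simp
  qed
  moreover have "finite {M. dK V f M \<noteq> 0}"
  proof (rule finite_subset)
    show "{M. dK V f M \<noteq> 0} \<subseteq>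
        (\<Union>M'\<in>{M. f M \<noteq> 0}. (\<lambda>j. add_mset j M') ` {j. ge V j (f M') \<noteq> 0})"
    proof
      fix M assume "M \<in> {M. dK V f M \<noteq> 0}"
      then obtain j where j: "j \<in># M" "ge V j (f (M - {#j#})) \<noteq> 0"
        unfolding dK_def by (metis (mono_tags, lifting) mem_Collect_eq sum.neutral)
      then have "f (M - {#j#}) \<noteq> 0" by auto
      moreover have "M = add_mset j (M - {#j#})" using j by simp
      ultimately show "M \<in> (\<Union>M'\<in>{M. f M \<noteq> 0}. (\<lambda>j. add_mset j M') ` {j. ge V j (f M') \<noteq> 0})"
        using j(2) by blast
    qed
    \<comment> \<open>Orbit maps are polynomial, so only finitely many \<open>e_j\<close> are
      nonzero on a given vector.\<close>
    have "finite {j. ge V j (f M') \<noteq> 0}" for M'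
    proof -
      obtain K where K: "\<forall>k\<ge>K. gE V k (f M') = 0" using E_finite[OF fD(2)] by blast
      have "j < K" if "ge V j (f M') \<noteq> 0" for j
      proof (rule ccontr)
        assume "\<not> j < K"
        then have "K \<le> 2 ^ j" using less_exp[of j] by linarith
        then show False using K that by blast
      qed
      then have "{j. ge V j (f M') \<noteq> 0} \<subseteq> {..<K}" by blast
      then show ?thesis by (rule finite_subset) simp
    qed
    then show "finite (\<Union>M'\<in>{M. f M \<noteq> 0}. (\<lambda>j. add_mset j M') ` {j. ge V j (f M') \<noteq> 0})"
      using fD(4) by blast
  qed
  ultimately show ?thesis by (simp add: cochains_def)
qed

lemma dK_add:
  assumes "f \<in> cochains V t" "h \<in> cochains V u"
  shows "dK V (\<lambda>M. f M + h M) M = dK V f M + dK V h M"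
  unfolding dK_def using cochainsD(2)[OF assms(1)] cochainsD(2)[OF assms(2)]
  by (simp add: E_add sum.distrib)

lemma dK_diff:
  assumes "f \<in> cochains V t" "h \<in> cochains V u"
  shows "dK V (\<lambda>M. f M - h M) M = dK V f M - dK V h M"
  unfolding dK_def using cochainsD(2)[OF assms(1)] cochainsD(2)[OF assms(2)]
  by (simp add: E_diff sum_subtractf)

lemma dK_scale:
  assumes "f \<in> cochains V t"
  shows "dK V (\<lambda>M. gscale V c (f M)) M = gscale V c (dK V f M)"
  unfolding dK_def using cochainsD(2)[OF assms(1)]
  by (simp add: E_scale scale_sum_right)

end

section \<open>Characteristic 2: the square of the differential, and Borel invariants\<close>

locale rational2 = rational V for V :: "('k::alg_closed_field, 'v::ab_group_add) gmod" +
  assumes char2: "CHAR('k) = 2"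
begin

lemma double_zero: "(x::'v) + x = 0"
  using char2 by (rule double_zero_char2)

lemma E_comm: "v \<in> gspace V \<Longrightarrow> gE V i (gE V j v) = gE V j (gE V i v)"
  by (simp add: E_comp add.commute binomial_symmetric[of j "i + j"])

text \<open>The coefficient supplied by \<open>E_comp\<close> is a central binomial coefficient,
  which is even.\<close>

lemma e_square:
  assumes "v \<in> gspace V"
  shows "ge V j (ge V j v) = 0"
proof -
  have "\<not> bit (2 ^ j + 2 ^ j :: nat) j"
    by (simp add: bit_iff_odd flip: mult_2)
  then have "even ((2 ^ j + 2 ^ j) choose (2 ^ j))"
    using odd_binomial_power2 by blast
  then show ?thesis
    using assms char2 by (simp add: E_comp of_nat_char2)
qed

text \<open>Terms with \<open>i \<noteq> j\<close> come in equal pairs, which cancel in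
  characteristic 2 without signs; terms with \<open>i = j\<close> vanish because \<open>e_j\<close>
  squares to zero.\<close>

lemma dK_dK:
  assumes f: "f \<in> cochains V t"
  shows "dK V (dK V f) M = 0"
proof -
  define a where "a i j = ge V j (ge V i (f (M - {#j#} - {#i#})))" for i j
  define P where "P = (SIGMA j:set_mset M. set_mset (M - {#j#}))"
  have fin: "finite P" by (simp add: P_def)
  have "dK V (dK V f) M = (\<Sum>j\<in>set_mset M. \<Sum>i\<in>set_mset (M - {#j#}). a i j)"
    unfolding dK_def a_def
    by (intro sum.cong refl) (simp add: E_sum E_in cochainsD(2)[OF f])
  also have "\<dots> = (\<Sum>(j, i)\<in>P. a i j)"
    unfolding P_def by (rule sum.Sigma) auto
  also have "\<dots> = (\<Sum>(j, i)\<in>{p \<in> P. fst p < snd p}. a i j) + (\<Sum>(j, i)\<in>{p \<in> P. \<not> fst p < snd p}. a i j)"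
    using sum.Int_Diff[OF fin, of "\<lambda>(j, i). a i j" "{p. fst p < snd p}"]
    by (simp add: Int_def set_diff_eq)
  also have "(\<Sum>(j, i)\<in>{p \<in> P. \<not> fst p < snd p}. a i j) = (\<Sum>(j, i)\<in>{p \<in> P. snd p < fst p}. a i j)"
    using fin by (intro sum.mono_neutral_right)
      (auto simp: a_def e_square cochainsD(2)[OF f] not_less order_le_less)
  also have "\<dots> = (\<Sum>(j, i)\<in>{p \<in> P. fst p < snd p}. a i j)"
  proof (rule sum.reindex_bij_witness[of _ prod.swap prod.swap])
    fix p assume "p \<in> {p \<in> P. snd p < fst p}"
    then show "prod.swap p \<in> {p \<in> P. fst p < snd p}"
      by (auto simp: P_def in_diff_count split: if_splits)
  next
    fix p assume "p \<in> {p \<in> P. fst p < snd p}"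
    then show "prod.swap p \<in> {p \<in> P. snd p < fst p}"
      by (auto simp: P_def in_diff_count split: if_splits)
  next
    fix p assume "p \<in> {p \<in> P. snd p < fst p}"
    have "a i j = a j i" for i j
      unfolding a_def by (subst diff_right_commute) (rule E_comm[OF cochainsD(2)[OF f]])
    then show "(case prod.swap p of (j, i) \<Rightarrow> a i j) = (case p of (j, i) \<Rightarrow> a i j)"
      by (cases p) simp
  qed auto
  finally show ?thesis by (simp add: double_zero)
qed

lemma dK_cocycle: "f \<in> cochains V t \<Longrightarrow> dK V f \<in> cocycles V (Suc t)"
  by (simp add: cocycles_def dK_in dK_dK)

text \<open>If \<open>j\<close> is the leading binary digit of \<open>n\<close>, the binomial
  coefficient in \<open>E_comp\<close> is odd and \<open>E^(n) = E^(n - 2^j) E^(2^j)\<close>: the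
  \<open>e_j\<close> generate all divided powers.\<close>

lemma E_eq_zero:
  assumes v: "v \<in> gspace V" and e: "\<And>j. ge V j v = 0" and n: "n > 0"
  shows "gE V n v = 0"
proof -
  obtain j where j: "2 ^ j \<le> n" "n < 2 ^ Suc j"
    using ex_power_ivl1[of 2 n] n by auto
  have "n div 2 ^ j = 1"
    using j by (intro div_nat_eqI) auto
  then have "bit n j"
    by (simp add: bit_iff_odd)
  then have "odd (n choose 2 ^ j)" by (simp add: odd_binomial_power2)
  then have "gE V (n - 2 ^ j) (ge V j v) = gE V n v"
    using v j char2 by (simp add: E_comp of_nat_char2)
  then show ?thesis using e by simp
qed

text \<open>
  The orbit map of a Borel-fixed vector is polynomial both in the affine coordinate of the big
  cell and in its inverse, hence constant.
\<close>

lemma borel_fixed_imp_fixed: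
  assumes w: "v \<in> wsp V 0" and e: "\<And>j. ge V j v = 0" and g: "g \<in> SL2"
  shows "gact V g v = v"
proof -
  have v: "v \<in> gspace V" using w by (rule wsp_in)
  have D: "gact V (dmat s) v = v" if "s \<noteq> 0" for s
    using w that by (simp add: wsp_def)
  have U: "gact V (umat s) v = v" for s
  proof -
    obtain K where K: "\<And>K' t. K \<le> K' \<Longrightarrow> gact V (umat t) v = (\<Sum>k<K'. gscale V (t ^ k) (gE V k v))"
      using vexp_bound[OF E_exp[OF v]] by metis
    have "gact V (umat s) v = (\<Sum>k<Suc K. gscale V (s ^ k) (gE V k v))" by (rule K) simp
    also have "\<dots> = v"
      by (subst sum.lessThan_Suc_shift) (simp add: E_0 v E_eq_zero e)
    finally show ?thesis .
  qed
  define u where "u = gact V (mat2 0 (-1) 1 0) v"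
  have u: "u \<in> gspace V" by (simp add: u_def act_in v)
  have lu: "gact V (lmat z) v = gact V (umat (inverse z)) u" if z: "z \<noteq> 0" for z
  proof -
    \<comment> \<open>The Bruhat factorisation of a lower unipotent element with
      \<open>z \<noteq> 0\<close>. The two right-hand factors fix \<open>v\<close>, which leaves the
      Weyl element and a unipotent factor in \<open>inverse z\<close>.\<close>
    have "lmat z = umat (inverse z) ** (mat2 0 (-1) 1 0 ** (dmat z ** umat (inverse z)))"
      using z by (simp add: mat2_mult)
    then have "gact V (lmat z) v =
        gact V (umat (inverse z)) (gact V (mat2 0 (-1) 1 0) (gact V (dmat z) (gact V (umat (inverse z)) v)))"
      using z v by (simp add: act_mult SL2_mult act_in del: mult_minus_left)
    then show ?thesis by (simp add: U D z u_def)
  qed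
  obtain c where c: "vexp (gscale V) (\<lambda>t. gact V (lmat t) v) c"
    by (rule curve_exp[of lmat v]) (use lmat_poly v in auto)
  obtain K where K: "\<And>K' t. K \<le> K' \<Longrightarrow> gact V (lmat t) v = (\<Sum>k<K'. gscale V (t ^ k) (c k))"
    "\<And>k. K \<le> k \<Longrightarrow> c k = 0"
    using vexp_bound[OF c] by metis
  obtain L where L: "\<And>K' t. L \<le> K' \<Longrightarrow> gact V (umat t) u = (\<Sum>k<K'. gscale V (t ^ k) (gE V k u))"
    using vexp_bound[OF E_exp[OF u]] by metis
  have "infinite (- {0::'k})" by (rule infinite_nonzero)
  \<comment> \<open>After multiplication by \<open>t ^ L\<close> the expansion in \<open>t\<close>
    has only exponents at least \<open>L\<close> and the one in \<open>inverse t\<close> only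
    exponents at most \<open>L\<close>, so just the constant term survives.\<close>
  then have "(\<lambda>m. if L \<le> m then c (m - L) else 0) = (\<lambda>m. if m \<le> L then gE V (L - m) u else 0)"
  proof (rule poly_coeffs_eq[where K = "K + L" and L = "Suc L"])
    show "\<forall>k\<ge>K + L. (if L \<le> k then c (k - L) else 0) = 0" using K(2) by auto
    show "\<forall>k\<ge>Suc L. (if k \<le> L then gE V (L - k) u else 0) = 0" by auto
    fix t :: 'k assume "t \<in> - {0}"
    then have t: "t \<noteq> 0" by simp
    have "(\<Sum>k<K + L. gscale V (t ^ k) (if L \<le> k then c (k - L) else 0)) =
        (\<Sum>k\<in>{0 + L..<K + L}. gscale V (t ^ k) (if L \<le> k then c (k - L) else 0))"
      by (rule sum.mono_neutral_right) auto
    also have "\<dots> = (\<Sum>k<K. gscale V (t ^ (k + L)) (c k))"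
      by (subst sum.shift_bounds_nat_ivl) (simp add: lessThan_atLeast0)
    also have "\<dots> = gscale V (t ^ L) (gact V (lmat t) v)"
      by (simp add: K(1)[of K] scale_sum_right power_add mult.commute)
    also have "\<dots> = gscale V (t ^ L) (\<Sum>k<Suc L. gscale V (inverse t ^ k) (gE V k u))"
      using t L[of "Suc L"] by (simp add: lu del: sum.lessThan_Suc)
    also have "\<dots> = (\<Sum>k<Suc L. gscale V (t ^ (L - k)) (gE V k u))"
      unfolding scale_sum_right
    proof (intro sum.cong refl)
      fix k assume "k \<in> {..<Suc L}"
      then have "t ^ L * inverse t ^ k = t ^ (L - k)"
        using t by (simp add: power_diff field_simps)
      then show "gscale V (t ^ L) (gscale V (inverse t ^ k) (gE V k u)) = gscale V (t ^ (L - k)) (gE V k u)"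
        by simp
    qed
    also have "\<dots> = (\<Sum>k<Suc L. gscale V (t ^ k) (if k \<le> L then gE V (L - k) u else 0))"
      by (subst sum.nat_diff_reindex[symmetric]) (auto intro!: sum.cong)
    finally show "(\<Sum>k<K + L. gscale V (t ^ k) (if L \<le> k then c (k - L) else 0)) =
        (\<Sum>k<Suc L. gscale V (t ^ k) (if k \<le> L then gE V (L - k) u else 0))" .
  qed
  then have "c k = 0" if "k > 0" for k
    using that by (drule_tac x = "L + k" in fun_cong) simp
  then have "(\<Sum>k<Suc K. gscale V (z ^ k) (c k)) = c 0" for z
    by (subst sum.lessThan_Suc_shift) simp
  then have "gact V (lmat z) v = c 0" for z
    using K(1)[of "Suc K" z] by simp
  moreover have "gact V (lmat 0) v = v"
    using act_one[OF v] by (simp add: mat2_one)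
  ultimately have Lo: "gact V (lmat z) v = v" for z by metis
  have main: "gact V g v = v" if g: "g \<in> SL2" and a: "g $ 1 $ 1 \<noteq> 0" for g :: "'k ^ 2 ^ 2"
  proof -
    define a b c d where "a = g $ 1 $ 1" "b = g $ 1 $ 2" "c = g $ 2 $ 1" "d = g $ 2 $ 2"
    have ad: "a * d = 1 + b * c"
      using g by (simp add: SL2_iff a_b_c_d_def algebra_simps)
    have "a \<noteq> 0" using a by (simp add: a_b_c_d_def)
    then have "d = b * c / a + inverse a"
      using ad by (simp add: field_simps)
    then have "mat2 a b c d = lmat (c / a) ** (dmat a ** umat (b / a))"
      using \<open>a \<noteq> 0\<close> by (simp add: mat2_mult mult.commute)
    then have "g = lmat (c / a) ** (dmat a ** umat (b / a))"
      unfolding a_b_c_d_def mat2_eta .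
    then show ?thesis
      using \<open>a \<noteq> 0\<close> v by (simp add: act_mult SL2_mult U D Lo)
  qed
  show ?thesis
  proof (cases "g $ 1 $ 1 = 0")
    case False
    then show ?thesis using main g by blast
  next
    case True
    \<comment> \<open>If the upper left entry is zero, the lower left one is not, and subtracting
      the second row from the first reduces to the case already treated.\<close>
    define h where "h = umat (-1) ** g"
    have h: "h \<in> SL2" using g by (simp add: h_def SL2_mult)
    have "g $ 2 $ 1 \<noteq> 0" using g True by (auto simp: SL2_iff)
    moreover have "h $ 1 $ 1 = g $ 1 $ 1 - g $ 2 $ 1"
      unfolding h_def by (subst mat2_eta[of g, symmetric]) (simp add: mat2_mult)
    ultimately have "gact V h v = v" using True h by (intro main) auto
    moreover have "umat 1 ** h = g"
      unfolding h_def matrix_mul_assoc by (simp add: mat2_mult mat2_one)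
    ultimately show ?thesis
      using h v act_mult[of "umat 1" h v] by (simp add: U)
  qed
qed

text \<open>Degree 0 gives the invariants of \<open>SL2\<close>, not only of the Borel subgroup:
  weight 0 and annihilation by all \<open>e_j\<close> make a vector Borel-fixed, and
  \<open>borel_fixed_imp_fixed\<close> applies.\<close>

lemma cocycles_0_iff: "f \<in> cocycles V 0 \<longleftrightarrow>
   (\<forall>M. M \<noteq> {#} \<longrightarrow> f M = 0) \<and> f {#} \<in> gspace V \<and> (\<forall>g\<in>SL2. gact V g (f {#}) = f {#})"
proof
  assume f: "f \<in> cocycles V 0"
  then have fc: "f \<in> cochains V 0" by (simp add: cocycles_def)
  have "ge V j (f {#}) = 0" for j
  proof -
    have "dK V f {#j#} = 0" using f by (simp add: cocycles_def)
    then show ?thesis by (simp add: dK_def)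
  qed
  then show "(\<forall>M. M \<noteq> {#} \<longrightarrow> f M = 0) \<and> f {#} \<in> gspace V \<and> (\<forall>g\<in>SL2. gact V g (f {#}) = f {#})"
    using cochainsD[OF fc] borel_fixed_imp_fixed[of "f {#}"] cochainsD(1)[OF fc, of "{#}"] by auto
next
  assume f: "(\<forall>M. M \<noteq> {#} \<longrightarrow> f M = 0) \<and> f {#} \<in> gspace V \<and> (\<forall>g\<in>SL2. gact V g (f {#}) = f {#})"
  then have w: "f {#} \<in> wsp V 0" by (simp add: wsp_def)
  have "vexp (gscale V) (\<lambda>t. gact V (umat t) (f {#})) (\<lambda>n. if n = 0 then f {#} else 0)"
    by (rule vexpI[where K = 1]) (use f in auto)
  then have E: "gE V n (f {#}) = (if n = 0 then f {#} else 0)" for n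
    by (rule E_eqI)
  have "f M \<in> wsp V (2 * wt M)" for M
    using f w by (cases "M = {#}") auto
  moreover have "finite {M. f M \<noteq> 0}"
    by (rule finite_subset[of _ "{{#}}"]) (use f in auto)
  moreover have "dK V f M = 0" for M
    unfolding dK_def
  proof (intro sum.neutral ballI)
    fix j assume "j \<in># M"
    show "ge V j (f (M - {#j#})) = 0"
      by (cases "M - {#j#} = {#}") (use f E in auto)
  qed
  ultimately show "f \<in> cocycles V 0"
    using f by (auto simp: cocycles_def cochains_def)
qed

end

context rational_hom
begin

lemma comp_cochains:
  assumes f: "f \<in> cochains V t"
  shows "(\<lambda>M. \<phi> (f M)) \<in> cochains W t"
proof -
  have "{M. \<phi> (f M) \<noteq> 0} \<subseteq> {M. f M \<noteq> 0}" by auto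
  then have "finite {M. \<phi> (f M) \<noteq> 0}" using V.cochainsD(4)[OF f] finite_subset by blast
  then show ?thesis using V.cochainsD[OF f] by (auto simp: cochains_def hom_wsp)
qed

lemma comp_dK:
  assumes f: "f \<in> cochains V t"
  shows "dK W (\<lambda>M. \<phi> (f M)) M = \<phi> (dK V f M)"
  unfolding dK_def by (simp add: hom_sum V.E_in V.cochainsD[OF f] hom_E)

lemma lift_cochain:
  assumes f: "f \<in> cochains W t" and surj: "\<And>M. f M \<in> \<phi> ` gspace V"
  obtains h where "h \<in> cochains V t" "\<And>M. \<phi> (h M) = f M"
proof -
  have "\<exists>v\<in>wsp V (2 * wt M). \<phi> v = f M" for M
  proof -
    obtain v where "v \<in> gspace V" "\<phi> v = f M" using surj by (metis imageE)
    then show ?thesis using wsp_lift[of v "2 * wt M"] W.cochainsD(1)[OF f, of M] by metis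
  qed
  then obtain h where h: "\<And>M. h M \<in> wsp V (2 * wt M)" "\<And>M. \<phi> (h M) = f M" by metis
  \<comment> \<open>Lifting zero values by zero preserves the finite support and the degree.\<close>
  define h' where "h' M = (if f M = 0 then 0 else h M)" for M
  have "{M. h' M \<noteq> 0} \<subseteq> {M. f M \<noteq> 0}" by (auto simp: h'_def)
  then have "finite {M. h' M \<noteq> 0}" using W.cochainsD(4)[OF f] finite_subset by blast
  then have "h' \<in> cochains V t"
    using W.cochainsD(3)[OF f] h(1) by (auto simp: cochains_def h'_def)
  moreover have "\<phi> (h' M) = f M" for M by (simp add: h'_def h)
  ultimately show ?thesis using that by blast
qed

end

section \<open>Exactness of the Koszul complex of the additive group\<close>

lemma bit_plus_power2: "\<not> bit (n::nat) j \<Longrightarrow> bit (n + 2 ^ j) k \<longleftrightarrow> k = j \<or> bit n k"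
  using bit_set_bit_iff[of j n k] by (auto simp: set_bit_eq)

lemma bit_plus_power2_self: "bit (n + 2 ^ j :: nat) j \<longleftrightarrow> \<not> bit n j"
  by (simp add: bit_iff_odd)

lemma bit_imp_le: "bit (n::nat) j \<Longrightarrow> 2 ^ j \<le> n"
  by (metis bit_iff_odd div_less even_zero not_less)

lemma bit_minus_power2: "bit (n::nat) j \<Longrightarrow> bit (n - 2 ^ j) k \<longleftrightarrow> k \<noteq> j \<and> bit n k"
  using bit_plus_power2[of "n - 2 ^ j" j k] bit_plus_power2_self[of "n - 2 ^ j" j] bit_imp_le[of n j]
  by auto

definition koszul_homotopy :: "nat \<Rightarrow> (nat multiset \<Rightarrow> 'v::zero) \<Rightarrow> nat multiset \<Rightarrow> 'v" where
  "koszul_homotopy N C M = (let j = LEAST j. bit (N - wt M) j \<or> j \<in># M in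
     if bit (N - wt M) j then C (add_mset j M) else 0)"

text \<open>
  A pair of a multiset \<open>M\<close> and the set of binary digits of \<open>N - wt M\<close> is a basis element of
  polynomial ring tensor exterior algebra; the homotopy moves the least index that occurs in
  either factor from the polynomial to the exterior side.
\<close>

lemma koszul_homotopy:
  fixes C :: "nat multiset \<Rightarrow> 'v::ab_group_add"
  assumes dbl: "\<And>x::'v. x + x = 0" and C: "\<And>M. wt M > N \<Longrightarrow> C M = 0"
    and cocycle: "\<And>M. (\<Sum>j\<in>set_mset M. if bit (N - wt (M - {#j#})) j then C (M - {#j#}) else 0) = 0"
    and M: "M \<noteq> {#}"
  shows "(\<Sum>j\<in>set_mset M. if bit (N - wt (M - {#j#})) j then koszul_homotopy N C (M - {#j#}) else 0) = C M"
proof (cases "wt M \<le> N")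
  case False
  have "\<not> bit (N - wt (M - {#j#})) j" if j: "j \<in># M" for j
    using bit_imp_le[of "N - wt (M - {#j#})" j] wt_remove[OF j] False
    by (auto simp: not_le)
  then show ?thesis using C False by (simp add: not_le)
next
  case True
  define n where "n = N - wt M"
  define m where "m = (LEAST k. bit n k \<or> k \<in># M)"
  have m: "bit n m \<or> m \<in># M"
    using LeastI_ex[of "\<lambda>k. bit n k \<or> k \<in># M"] multiset_nonemptyE[OF M] unfolding m_def by blast
  \<comment> \<open>Removing \<open>j\<close> from the monomial adds \<open>2 ^ j\<close> to the
    exterior part, where digit \<open>j\<close> becomes set exactly if it was clear before.\<close>
  have rem: "N - wt (M - {#j#}) = n + 2 ^ j" if j: "j \<in># M" for j
    using wt_remove[OF j] True by (simp add: n_def)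
  have H: "koszul_homotopy N C (M - {#j#}) = (if m = j \<or> bit n m then C (add_mset m (M - {#j#})) else 0)"
    if j: "j \<in># M" and b: "\<not> bit n j" for j
  proof -
    have "(bit (n + 2 ^ j) k \<or> k \<in># M - {#j#}) = (bit n k \<or> k \<in># M)" for k
    proof -
      have "k \<in># M \<longleftrightarrow> k = j \<or> k \<in># M - {#j#}"
        using insert_DiffM[OF j] by (metis add_mset_remove_trivial insert_iff set_mset_add_mset_insert)
      then show ?thesis using b by (auto simp: bit_plus_power2)
    qed
    then show ?thesis
      using b by (simp add: koszul_homotopy_def rem[OF j] Let_def bit_plus_power2 flip: m_def)
  qed
  have "(\<Sum>j\<in>set_mset M. if bit (N - wt (M - {#j#})) j then koszul_homotopy N C (M - {#j#}) else 0) =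
      (\<Sum>j\<in>set_mset M. if \<not> bit n j then (if m = j \<or> bit n m then C (add_mset m (M - {#j#})) else 0) else 0)"
    by (intro sum.cong refl) (auto simp: rem bit_plus_power2_self H)
  also have "\<dots> = C M"
  proof (cases "bit n m")
    case False
    \<comment> \<open>With digit \<open>m\<close> clear, the least index comes from \<open>M\<close>
      and only the summand \<open>j = m\<close> can be nonzero.\<close>
    then have mM: "m \<in># M" using m by blast
    have "(\<Sum>j\<in>set_mset M. if \<not> bit n j then (if m = j \<or> bit n m then C (add_mset m (M - {#j#})) else 0) else 0) =
        (\<Sum>j\<in>set_mset M. if j = m then C M else 0)"
      using False mM by (intro sum.cong refl) auto
    then show ?thesis using mM by simp
  next
    case mb: True
    \<comment> \<open>The terms of the sum occur in the cocycle condition at \<open>M\<close>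
      enlarged by \<open>m\<close>, whose remaining summand, at \<open>m\<close>, is
      \<open>C M\<close>.\<close>
    define M' where "M' = add_mset m M"
    have rem': "N - wt (M' - {#j#}) = n - 2 ^ m + 2 ^ j" if j: "j \<in># M'" for j
    proof -
      have "2 ^ m \<le> n" using mb by (rule bit_imp_le)
      then show ?thesis using wt_remove[OF j] True by (simp add: n_def M'_def)
    qed
    have bm: "bit (n - 2 ^ m + 2 ^ j) j \<longleftrightarrow> (j = m \<or> \<not> bit n j)" for j
      using mb by (auto simp: bit_plus_power2_self bit_minus_power2)
    have "(\<Sum>j\<in>insert m (set_mset M). if j = m \<or> \<not> bit n j then C (M' - {#j#}) else 0) =
        (\<Sum>j\<in>set_mset M'. if bit (N - wt (M' - {#j#})) j then C (M' - {#j#}) else 0)"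
      by (rule sum.cong) (simp_all add: rem' bm, simp add: M'_def)
    also have "\<dots> = 0" by (rule cocycle)
    also have "(\<Sum>j\<in>insert m (set_mset M). if j = m \<or> \<not> bit n j then C (M' - {#j#}) else 0) = C M + (\<Sum>j\<in>set_mset M - {m}. if j = m \<or> \<not> bit n j then C (M' - {#j#}) else 0)"
      by (subst sum.insert_remove) (simp_all add: M'_def)
    also have "(\<Sum>j\<in>set_mset M - {m}. if j = m \<or> \<not> bit n j then C (M' - {#j#}) else 0) =
        (\<Sum>j\<in>set_mset M. if \<not> bit n j then (if m = j \<or> bit n m then C (add_mset m (M - {#j#})) else 0) else 0)"
      using mb by (intro sum.mono_neutral_cong_left) (auto simp: M'_def)
    finally have "C M + (\<Sum>j\<in>set_mset M. if \<not> bit n j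
        then (if m = j \<or> bit n m then C (add_mset m (M - {#j#})) else 0) else 0) = C M + C M"
      by (simp only: dbl)
    then show ?thesis by (simp only: add_left_cancel)
  qed
  finally show ?thesis .
qed

lemma koszul_homotopy_nonzero:
  assumes "koszul_homotopy N C M \<noteq> 0"
  obtains j where "C (add_mset j M) \<noteq> 0" "wt (add_mset j M) \<le> N"
proof -
  define j where "j = (LEAST j. bit (N - wt M) j \<or> j \<in># M)"
  have *: "bit (N - wt M) j" "C (add_mset j M) \<noteq> 0"
    using assms by (auto simp: koszul_homotopy_def Let_def j_def split: if_splits)
  then have "2 ^ j \<le> N - wt M" using bit_imp_le by blast
  moreover have "(2::nat) ^ j > 0" by simp
  ultimately have "wt (add_mset j M) \<le> N" unfolding wt_add by linarith
  then show ?thesis using * that by blast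
qed

section \<open>Coinduced modules\<close>

lemma sum_fun: "(\<Sum>i\<in>A. f i) x = (\<Sum>i\<in>A. f i x)"
  by (induction A rule: infinite_finite_induct) auto

abbreviation (input) pw :: "('k \<Rightarrow> 'v \<Rightarrow> 'v) \<Rightarrow> 'k \<Rightarrow> ('a \<Rightarrow> 'v) \<Rightarrow> 'a \<Rightarrow> 'v" where
  "pw s \<equiv> (\<lambda>c \<phi> x. s c (\<phi> x))"

lemma vector_space_pw:
  assumes "vector_space s"
  shows "vector_space (pw s)"
proof -
  interpret vector_space s by fact
  show ?thesis
    by unfold_locales (auto simp: fun_eq_iff scale_right_distrib scale_left_distrib)
qed

text \<open>Linearity of every \<open>G i\<close> merges the summands with the same index, so one
  coefficient in \<open>W\<close> per index is enough.\<close>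

lemma span_family:
  fixes G :: "'i \<Rightarrow> 'v::ab_group_add \<Rightarrow> 'u::ab_group_add"
  assumes "vector_space s" "vector_space s'" and W: "module.subspace s W"
    and G: "\<And>i. i \<in> J \<Longrightarrow> lin_on s W s' (G i)"
    and x: "x \<in> module.span s' {G i w | i w. i \<in> J \<and> w \<in> W}"
  obtains I C where "finite I" "I \<subseteq> J" "\<And>i. C i \<in> W" "x = (\<Sum>i\<in>I. G i (C i))"
proof -
  interpret s: vector_space s by fact
  interpret s': vector_space s' by fact
  have "\<exists>I C. finite I \<and> I \<subseteq> J \<and> (\<forall>i. C i \<in> W) \<and> x = (\<Sum>i\<in>I. G i (C i))"
    using x
  proof (induction rule: s'.span_induct_alt)
    case base
    show ?case
      by (rule exI[of _ "{}"], rule exI[of _ "\<lambda>_. 0"]) (use s.subspace_0[OF W] in auto)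
  next
    case (step c y z)
    then obtain I C i w where *: "finite I" "I \<subseteq> J" "\<forall>i. C i \<in> W" "z = (\<Sum>i\<in>I. G i (C i))"
      and y: "y = G i w" "i \<in> J" "w \<in> W" by auto
    define C' where "C' = (\<lambda>k. (if k \<in> I then C k else 0) + (if k = i then s c w else 0))"
    have W0: "0 \<in> W" using W by (rule s.subspace_0)
    have cw: "s c w \<in> W" using W y by (auto intro: s.subspace_scale)
    have C': "C' k \<in> W" for k
      using * cw W W0 by (auto simp: C'_def intro!: s.subspace_add)
    have Gadd: "G k (C' k) = G k (if k \<in> I then C k else 0) + G k (if k = i then s c w else 0)" if "k \<in> J" for k
      using G[OF that] * cw W0 by (simp add: lin_on_def C'_def)
    have G0: "G k 0 = 0" if "k \<in> J" for k
      using lin_on_zero[OF assms(1) W G[OF that]] .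
    have sub: "insert i I \<subseteq> J" using * y by auto
    have "(\<Sum>k\<in>insert i I. G k (C' k)) =
        (\<Sum>k\<in>insert i I. G k (if k \<in> I then C k else 0)) + (\<Sum>k\<in>insert i I. G k (if k = i then s c w else 0))"
      unfolding sum.distrib[symmetric] by (intro sum.cong refl Gadd) (use sub in auto)
    also have "(\<Sum>k\<in>insert i I. G k (if k \<in> I then C k else 0)) = z"
      unfolding *(4) by (rule sum.mono_neutral_cong_right) (use *(1) sub in \<open>auto simp: G0\<close>)
    also have "(\<Sum>k\<in>insert i I. G k (if k = i then s c w else 0)) = (\<Sum>k\<in>{i}. G k (s c w))"
      by (rule sum.mono_neutral_cong_right) (use *(1) sub in \<open>auto simp: G0\<close>)
    also have "\<dots> = s' c y"
      using G[OF y(2)] y by (simp add: lin_on_def)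
    finally have "s' c y + z = (\<Sum>k\<in>insert i I. G k (C' k))" by (simp add: add.commute)
    then show ?case
      using * sub C' by (intro exI[of _ "insert i I"] exI[of _ C']) auto
  qed
  then show ?thesis using that by blast
qed

text \<open>The exponents follow the entries in reading order. \<open>x\<close> and \<open>y\<close>
  belong to the first column, which right translation by \<open>dmat t\<close> scales by
  \<open>t\<close>; \<open>p\<close> and \<open>q\<close> belong to the second, scaled by
  \<open>inverse t\<close>.\<close>

definition mon :: "nat \<times> nat \<times> nat \<times> nat \<Rightarrow> 'k::field ^ 2 ^ 2 \<Rightarrow> 'k" where
  "mon m g = (case m of (x, p, y, q) \<Rightarrow> g $ 1 $ 1 ^ x * g $ 1 $ 2 ^ p * g $ 2 $ 1 ^ y * g $ 2 $ 2 ^ q)"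

lemma regular_power: "f \<in> regular_functions \<Longrightarrow> (\<lambda>g. f g ^ n) \<in> regular_functions"
  by (induction n) (auto intro: regular_functions.intros)

lemma regular_mon: "mon m \<in> regular_functions"
proof -
  obtain x p y q where m: "m = (x, p, y, q)" by (cases m) auto
  have "(\<lambda>g. g $ 1 $ 1 ^ x * g $ 1 $ 2 ^ p * g $ 2 $ 1 ^ y * g $ 2 $ 2 ^ q) \<in> regular_functions"
    by (intro regular_functions.mult regular_power regular_functions.entry)
  then show ?thesis by (simp add: mon_def[abs_def] m)
qed

lemma mon_mult: "mon (x, p, y, q) g * mon (x', p', y', q') g = mon (x + x', p + p', y + y', q + q') g"
  by (simp add: mon_def power_add mult_ac)

lemma regular_in_span_mon:
  fixes f :: "'k::field ^ 2 ^ 2 \<Rightarrow> 'k"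
  assumes "f \<in> regular_functions"
  shows "f \<in> module.span (pw (*)) (range mon)"
proof -
  interpret vector_space "pw (*) :: 'k::field \<Rightarrow> ('k ^ 2 ^ 2 \<Rightarrow> 'k) \<Rightarrow> ('k ^ 2 ^ 2 \<Rightarrow> 'k)"
    by (rule vector_space_pw) (unfold_locales, simp_all add: algebra_simps)
  have span_mult: "(\<lambda>g. f g * h g) \<in> span (range mon)"
    if f: "f \<in> span (range mon)" and h: "h \<in> span (range mon)" for f h :: "'k ^ 2 ^ 2 \<Rightarrow> 'k"
    using f
  proof (induction rule: span_induct_alt)
    case base
    show ?case using span_zero[of "range mon"] by (simp add: zero_fun_def)
  next
    case (step c f f')
    have "(\<lambda>g. f g * h g) \<in> span (range mon)"
      using h
    proof (induction rule: span_induct_alt)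
      case base
      show ?case using span_zero[of "range mon"] by (simp add: zero_fun_def)
    next
      case (step d h h')
      then obtain m m' where m: "f = mon m" "h = mon m'"
        using \<open>f \<in> range mon\<close> by blast
      have "(\<lambda>g. f g * h g) \<in> range mon"
        unfolding m by (cases m; cases m'; simp only: mon_mult) (rule rangeI)
      then have "(\<lambda>g. d * (f g * h g)) + (\<lambda>g. f g * h' g) \<in> span (range mon)"
        using step by (intro span_add) (auto intro: span_scale[of "\<lambda>g. f g * h g" for h] span_base)
      then show ?case by (simp add: algebra_simps plus_fun_def)
    qed
    then have "(\<lambda>g. c * (f g * h g)) + (\<lambda>g. f' g * h g) \<in> span (range mon)"
      using step by (intro span_add) (auto intro: span_scale[of "\<lambda>g. f g * h g" for f])
    then show ?case by (simp add: algebra_simps plus_fun_def)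
  qed
  have one: "(\<lambda>g. 1) \<in> span (range mon)"
    by (rule span_base, rule image_eqI[of _ _ "(0, 0, 0, 0)"]) (auto simp: mon_def)
  show ?thesis
    using assms
  proof induction
    case (const c)
    show ?case using span_scale[OF one, of c] by simp
  next
    case (entry i j)
    have e: "(\<lambda>g. g $ 1 $ 1) = mon (1, 0, 0, 0)" "(\<lambda>g. g $ 1 $ 2) = mon (0, 1, 0, 0)"
      "(\<lambda>g. g $ 2 $ 1) = mon (0, 0, 1, 0)" "(\<lambda>g. g $ 2 $ 2) = mon (0, 0, 0, 1)"
      by (simp_all add: mon_def fun_eq_iff)
    have "i = 1 \<or> i = 2" "j = 1 \<or> j = 2" by (rule exhaust_2)+
    then have "(\<lambda>g. g $ i $ j) \<in> range mon"
      by (elim disjE; simp only: e) (rule rangeI)+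
    then show ?case by (rule span_base)
  next
    case (add f h)
    then show ?case using span_add[of f _ h] by (simp add: plus_fun_def)
  next
    case (mult f h)
    then show ?case by (intro span_mult)
  qed
qed

text \<open>The comultiplication of the coordinate algebra, with values written as finite lists of
  pure tensors.\<close>

lemma regular_comult:
  assumes "f \<in> regular_functions"
  shows "\<exists>xs. (\<forall>(p, q)\<in>set xs. p \<in> regular_functions \<and> q \<in> regular_functions) \<and>
    (\<forall>g h. f (g ** h) = (\<Sum>(p, q)\<leftarrow>xs. p g * q h))"
  using assms
proof induction
  case (const c)
  then show ?case
    by (intro exI[of _ "[(\<lambda>g. c, \<lambda>g. 1)]"]) (auto intro: regular_functions.const)
next
  case (entry i j)
  then show ?case
    by (intro exI[of _ "[(\<lambda>g. g $ i $ 1, \<lambda>h. h $ 1 $ j), (\<lambda>g. g $ i $ 2, \<lambda>h. h $ 2 $ j)]"])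
      (auto intro: regular_functions.entry simp: matrix_matrix_mult_def sum_2)
next
  case (add f h)
  then obtain xs ys where
    "\<forall>(p, q)\<in>set xs. p \<in> regular_functions \<and> q \<in> regular_functions"
    "\<forall>g h. f (g ** h) = (\<Sum>(p, q)\<leftarrow>xs. p g * q h)"
    "\<forall>(p, q)\<in>set ys. p \<in> regular_functions \<and> q \<in> regular_functions"
    "\<forall>g h'. h (g ** h') = (\<Sum>(p, q)\<leftarrow>ys. p g * q h')"
    by blast
  then show ?case by (intro exI[of _ "xs @ ys"]) auto
next
  case (mult f h)
  then obtain xs ys where xs:
    "\<forall>(p, q)\<in>set xs. p \<in> regular_functions \<and> q \<in> regular_functions"
    "\<forall>g h. f (g ** h) = (\<Sum>(p, q)\<leftarrow>xs. p g * q h)"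
    and ys: "\<forall>(p, q)\<in>set ys. p \<in> regular_functions \<and> q \<in> regular_functions"
    "\<forall>g h'. h (g ** h') = (\<Sum>(p, q)\<leftarrow>ys. p g * q h')"
    by blast
  define zs where "zs = concat (map (\<lambda>(p, q). map (\<lambda>(p', q'). (\<lambda>g. p g * p' g, \<lambda>g. q g * q' g)) ys) xs)"
  have "(\<Sum>(p, q)\<leftarrow>zs. p g * q h') = (\<Sum>(p, q)\<leftarrow>xs. p g * q h') * (\<Sum>(p, q)\<leftarrow>ys. p g * q h')" for g h'
    unfolding zs_def
  proof (induction xs)
    case (Cons a xs)
    have "(\<Sum>(p, q)\<leftarrow>map (\<lambda>(p', q'). (\<lambda>g. fst a g * p' g, \<lambda>g. snd a g * q' g)) ys. p g * q h') =
        (fst a g * snd a h') * (\<Sum>(p, q)\<leftarrow>ys. p g * q h')"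
      by (induction ys) (auto simp: algebra_simps)
    then show ?case
      using Cons.IH by (auto simp: algebra_simps split: prod.splits)
  qed simp
  moreover have "\<forall>(p, q)\<in>set zs. p \<in> regular_functions \<and> q \<in> regular_functions"
    using xs(1) ys(1) by (auto simp: zs_def intro!: regular_functions.mult)
  ultimately show ?case using xs(2) ys(2) by (intro exI[of _ zs]) simp
qed

lemma sum_list_map_nth: "(\<Sum>x\<leftarrow>xs. F x) = (\<Sum>i<length xs. F (xs ! i))"
  by (simp add: sum_list_sum_nth atLeast0LessThan)

text \<open>The pure tensor of a function and a vector, seen as a vector-valued function on the
  group.\<close>

definition elem :: "('k \<Rightarrow> 'v \<Rightarrow> 'v::zero) \<Rightarrow> ('k::field ^ 2 ^ 2 \<Rightarrow> 'k) \<Rightarrow> 'v \<Rightarrow> 'k ^ 2 ^ 2 \<Rightarrow> 'v" where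
  "elem s f w g = (if g \<in> SL2 then s (f g) w else 0)"

text \<open>
  Regular functions are extended by 0 outside \<open>SL2\<close>, so that equality on the group is equality.
\<close>

definition coind :: "('k \<Rightarrow> 'v \<Rightarrow> 'v) \<Rightarrow> 'v set \<Rightarrow> ('k::field, 'k ^ 2 ^ 2 \<Rightarrow> 'v::ab_group_add) gmod" where
  "coind s W = \<lparr>gspace = module.span (pw s) {elem s (mon m) w | m w. w \<in> W},
     gscale = pw s, gact = (\<lambda>h \<phi> g. if g \<in> SL2 then \<phi> (g ** h) else 0)\<rparr>"

lemma coind_sel [simp]: "gscale (coind s W) = pw s"
  "gact (coind s W) h \<phi> g = (if g \<in> SL2 then \<phi> (g ** h) else 0)"
  by (simp_all add: coind_def)

locale coinduction = vector_space s for s :: "'k::alg_closed_field \<Rightarrow> 'v::ab_group_add \<Rightarrow> 'v" +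
  fixes W assumes subW: "subspace W"
begin

abbreviation A where "A \<equiv> coind s W"

sublocale pw: vector_space "pw s :: 'k \<Rightarrow> ('k ^ 2 ^ 2 \<Rightarrow> 'v) \<Rightarrow> 'k ^ 2 ^ 2 \<Rightarrow> 'v"
  by (rule vector_space_pw) (rule vector_space_axioms)

lemma elem_lin: "lin_on s S (pw s) (elem s f)"
  by (auto simp: lin_on_def elem_def fun_eq_iff scale_right_distrib mult.commute)

lemma elem_regular:
  assumes f: "f \<in> regular_functions" and w: "w \<in> W"
  shows "elem s f w \<in> gspace A"
proof -
  interpret k: vector_space "pw (*) :: 'k \<Rightarrow> ('k ^ 2 ^ 2 \<Rightarrow> 'k) \<Rightarrow> ('k ^ 2 ^ 2 \<Rightarrow> 'k)"
    by (rule vector_space_pw) (unfold_locales, simp_all add: algebra_simps)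
  show ?thesis
    using regular_in_span_mon[OF f]
  proof (induction rule: k.span_induct_alt)
    case base
    have "elem s 0 w = 0" by (simp add: elem_def fun_eq_iff)
    then show ?case by (simp only: coind_def gmod.simps pw.span_zero)
  next
    case (step c f h)
    have "elem s ((\<lambda>x. c * f x) + h) w = pw s c (elem s f w) + elem s h w"
      by (simp add: elem_def fun_eq_iff scale_left_distrib)
    moreover have "elem s f w \<in> gspace A"
      unfolding coind_def gmod.simps by (rule pw.span_base) (use step w in blast)
    moreover have "pw s c (elem s f w) + elem s h w \<in> gspace A"
      using calculation(2) step(2) unfolding coind_def gmod.simps
      by (intro pw.span_add pw.span_scale)
    ultimately show ?case by (simp only:)
  qed
qed

lemma subA: "pw.subspace (gspace A)"
  by (simp add: coind_def)

lemma coind_outside: "\<phi> \<in> gspace A \<Longrightarrow> g \<notin> SL2 \<Longrightarrow> \<phi> g = 0"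
  unfolding coind_def gmod.simps
  by (induction rule: pw.span_induct_alt) (auto simp: elem_def)

lemma coind_in_W: "\<phi> \<in> gspace A \<Longrightarrow> \<phi> g \<in> W"
  unfolding coind_def gmod.simps
proof (induction rule: pw.span_induct_alt)
  case base
  then show ?case using subspace_0[OF subW] by simp
next
  case (step c x y)
  then show ?case
    by (auto simp: elem_def intro!: subspace_add[OF subW] subspace_scale[OF subW] subspace_0[OF subW])
qed

lemma gact_lin: "lin_on (pw s) UNIV (pw s) (gact A h)"
  by (auto simp: lin_on_def fun_eq_iff)

text \<open>Right translation by \<open>h\<close> is expanded through the comultiplication: the
  second tensor factors become the coefficient functions of \<open>h\<close>, the first ones give
  the vectors.\<close>

lemma coind_orbit:
  assumes "\<phi> \<in> gspace A"
  shows "\<exists>xs. (\<forall>(f, w)\<in>set xs. f \<in> regular_functions \<and> w \<in> gspace A) \<and>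
    (\<forall>h\<in>SL2. gact A h \<phi> = (\<Sum>(f, w)\<leftarrow>xs. pw s (f h) w))"
  using assms unfolding coind_def[of s W] gmod.simps(1)
proof (induction rule: pw.span_induct_alt)
  case base
  show ?case by (intro exI[of _ "[]"]) (auto simp: fun_eq_iff)
next
  case (step c \<phi> \<psi>)
  obtain m w where \<phi>: "\<phi> = elem s (mon m) w" "w \<in> W" using step by blast
  obtain xs where xs: "\<forall>(p, q)\<in>set xs. p \<in> regular_functions \<and> q \<in> regular_functions"
    "\<forall>g h::'k^2^2. mon m (g ** h) = (\<Sum>(p, q)\<leftarrow>xs. p g * q h)"
    using regular_comult[OF regular_mon] by blast
  obtain ys where ys: "\<forall>(f, w)\<in>set ys. f \<in> regular_functions \<and> w \<in> gspace A"
    "\<forall>h\<in>SL2. gact A h \<psi> = (\<Sum>(f, w)\<leftarrow>ys. pw s (f h) w)"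
    using step by (auto simp: coind_def)
  define zs where "zs = map (\<lambda>(p, q). (\<lambda>h. c * q h, elem s p w)) xs"
  have zs: "(\<Sum>(f, w)\<leftarrow>zs. pw s (f h) w) = pw s c (gact A h \<phi>)" if "h \<in> SL2" for h
  proof
    fix g
    have "(\<Sum>(f, w)\<leftarrow>zs. pw s (f h) w) g = (\<Sum>(p, q)\<leftarrow>xs. if g \<in> SL2 then s (c * (p g * q h)) w else 0)"
      unfolding zs_def by (induction xs) (auto simp: elem_def mult_ac)
    also have "\<dots> = (if g \<in> SL2 then s (c * (\<Sum>(p, q)\<leftarrow>xs. p g * q h)) w else 0)"
      by (induction xs) (auto simp: distrib_left scale_left_distrib)
    also have "\<dots> = pw s c (gact A h \<phi>) g"
      using xs(2) that by (auto simp: \<phi> elem_def SL2_mult)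
    finally show "(\<Sum>(f, w)\<leftarrow>zs. pw s (f h) w) g = pw s c (gact A h \<phi>) g" .
  qed
  have "\<forall>(f, w)\<in>set zs. f \<in> regular_functions \<and> w \<in> gspace A"
    using xs(1) \<phi>(2) by (auto simp: zs_def intro!: elem_regular regular_functions.mult regular_functions.const)
  moreover have "gact A h ((\<lambda>x. s c (\<phi> x)) + \<psi>) = pw s c (gact A h \<phi>) + gact A h \<psi>" for h
    by (auto simp: fun_eq_iff)
  ultimately have "(\<forall>(f, w)\<in>set (zs @ ys). f \<in> regular_functions \<and> w \<in> gspace A) \<and>
    (\<forall>h\<in>SL2. gact A h ((\<lambda>x. s c (\<phi> x)) + \<psi>) = (\<Sum>(f, w)\<leftarrow>zs @ ys. pw s (f h) w))"
    using ys zs by (simp add: ball_Un)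
  then show ?case unfolding coind_def gmod.simps by blast
qed

lemma rational_coind: "rational_module A"
proof -
  have orb: "\<exists>(n::nat) f w. (\<forall>i<n. f i \<in> regular_functions \<and> w i \<in> gspace A) \<and>
        (\<forall>g\<in>SL2. gact A g \<phi> = (\<Sum>i<n. gscale A (f i g) (w i)))" if \<phi>: "\<phi> \<in> gspace A" for \<phi>
  proof -
    obtain xs where xs: "\<forall>(f, w)\<in>set xs. f \<in> regular_functions \<and> w \<in> gspace A"
      "\<forall>h\<in>SL2. gact A h \<phi> = (\<Sum>(f, w)\<leftarrow>xs. pw s (f h) w)"
      using coind_orbit[OF \<phi>] by blast
    have "\<forall>i<length xs. fst (xs ! i) \<in> regular_functions \<and> snd (xs ! i) \<in> gspace A"
      using xs(1) nth_mem by fastforce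
    moreover have "\<forall>g\<in>SL2. gact A g \<phi> = (\<Sum>i<length xs. gscale A (fst (xs ! i) g) (snd (xs ! i)))"
      using xs(2) by (simp add: sum_list_map_nth case_prod_beta)
    ultimately show ?thesis
      by (intro exI[of _ "length xs"] exI[of _ "\<lambda>i. fst (xs ! i)"] exI[of _ "\<lambda>i. snd (xs ! i)"]) blast
  qed
  have closed: "gact A h \<phi> \<in> gspace A" if \<phi>: "\<phi> \<in> gspace A" and h: "h \<in> SL2" for h \<phi>
  proof -
    obtain n :: nat and f w where "\<forall>i<n. f i \<in> regular_functions \<and> w i \<in> gspace A"
        "\<forall>g\<in>SL2. gact A g \<phi> = (\<Sum>i<n. gscale A (f i g) (w i))"
      using orb[OF \<phi>] by blast
    then show ?thesis
      using h by (auto intro!: pw.subspace_sum[OF subA] pw.subspace_scale[OF subA])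
  qed
  show ?thesis
    unfolding rational_module_def
  proof (intro conjI ballI allI)
    fix \<phi> assume "\<phi> \<in> gspace A"
    then show "gact A (mat 1) \<phi> = \<phi>"
      by (auto simp: fun_eq_iff coind_outside)
  next
    fix g h \<phi> show "g \<in> SL2 \<Longrightarrow> h \<in> SL2 \<Longrightarrow> gact A (g ** h) \<phi> = gact A g (gact A h \<phi>)"
      by (auto simp: fun_eq_iff SL2_mult matrix_mul_assoc)
  next
    fix \<phi> assume "\<phi> \<in> gspace A"
    then show "\<exists>(n::nat) f w. (\<forall>i<n. f i \<in> regular_functions \<and> w i \<in> gspace A) \<and>
        (\<forall>g\<in>SL2. gact A g \<phi> = (\<Sum>i<n. gscale A (f i g) (w i)))" by (rule orb)
  qed (use closed gact_lin subA pw.vector_space_axioms in \<open>simp_all add: lin_on_def\<close>)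
qed

end

section \<open>Coinduced modules are acyclic for the Borel subgroup\<close>

text \<open>Separation of weights: the coefficient of \<open>t ^ k\<close> collects exactly the
  indices with key \<open>k\<close>.\<close>

lemma (in vector_space) poly_group:
  assumes I: "finite I" and T: "infinite T"
    and eq: "\<And>t. t \<in> T \<Longrightarrow> (\<Sum>i\<in>I. scale (t ^ key i) (v i)) = 0"
  shows "(\<Sum>i | i \<in> I \<and> key i = k. v i) = 0"
proof -
  define K where "K = Suc (\<Sum>i\<in>I. key i)"
  have key: "key i < K" if "i \<in> I" for i
    using member_le_sum[OF that, of key] I by (simp add: K_def)
  show ?thesis
  proof (cases "k < K")
    case False
    then have "{i. i \<in> I \<and> key i = k} = {}" using key by auto
    then show ?thesis by (simp only: sum.empty)
  next
    case True
    show ?thesis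
    proof (rule poly_coeffs_zero[OF T _ True])
      fix t assume t: "t \<in> T"
      have "(\<Sum>k<K. scale (t ^ k) (\<Sum>i | i \<in> I \<and> key i = k. v i)) =
          (\<Sum>k<K. \<Sum>i | i \<in> I \<and> key i = k. scale (t ^ key i) (v i))"
        by (simp add: scale_sum_right)
      also have "\<dots> = (\<Sum>i\<in>I. scale (t ^ key i) (v i))"
        by (rule sum.group) (use I key in auto)
      finally show "(\<Sum>k<K. scale (t ^ k) (\<Sum>i | i \<in> I \<and> key i = k. v i)) = 0"
        using eq[OF t] by simp
    qed
  qed
qed

definition row :: "bool \<Rightarrow> 2" where "row b = (if b then 2 else 1)"

text \<open>
  Bihomogeneous regular functions of right weight \<open>2 * \<mu>\<close> and left weight \<open>\<mp>2 * \<nu>\<close>, the sign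
  given by the boolean. For fixed $(b,\nu,N)$ they span, as \<open>\<mu>\<close> varies, a module of the
  unipotent radical that is isomorphic to a truncation of its own coordinate ring.
\<close>

definition Th :: "bool \<times> nat \<times> nat \<Rightarrow> nat \<Rightarrow> 'k::field ^ 2 ^ 2 \<Rightarrow> 'k" where
  "Th i \<mu> g = (case i of (b, \<nu>, N) \<Rightarrow>
     g $ row (\<not> b) $ 1 ^ (N - \<nu>) * g $ row b $ 1 ^ (\<mu> + \<nu>) * g $ row b $ 2 ^ (N - \<mu>))"

text \<open>The inequalities keep the subtractions in \<open>Th\<close> from being truncated. For
  \<open>\<nu> = 0\<close> both families span \<open>a^\<mu> c^\<mu> k[ad]\<close>, because
  \<open>ad\<close> and \<open>bc\<close> differ by 1; only the \<open>True\<close> family is kept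
  there.\<close>

definition Idx :: "nat \<Rightarrow> (bool \<times> nat \<times> nat) set" where
  "Idx \<mu> = {(b, \<nu>, N). \<nu> \<le> N \<and> \<mu> \<le> N \<and> (b \<or> 1 \<le> \<nu>)}"

lemma Idx_le: "i \<in> Idx \<mu> \<Longrightarrow> \<mu> \<le> snd (snd i)"
  by (auto simp: Idx_def)

abbreviation idxN :: "bool \<times> nat \<times> nat \<Rightarrow> nat" where "idxN i \<equiv> snd (snd i)"

lemma matrix_mult_mat2:
  "(g ** mat2 a b c d) $ r $ 1 = g $ r $ 1 * a + g $ r $ 2 * c"
  "(g ** mat2 a b c d) $ r $ 2 = g $ r $ 1 * b + g $ r $ 2 * d"
  by (simp_all add: matrix_matrix_mult_def sum_2)

lemma Th_dmat:
  assumes "i \<in> Idx \<mu>" "t \<noteq> 0"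
  shows "Th i \<mu> (g ** dmat t) = t ^ (2 * \<mu>) * Th i \<mu> g"
proof -
  obtain b \<nu> N where i: "i = (b, \<nu>, N)" by (cases i) auto
  have le: "\<nu> \<le> N" "\<mu> \<le> N" using assms by (auto simp: Idx_def i)
  have "t ^ (N - \<nu>) * t ^ (\<mu> + \<nu>) = t ^ (2 * \<mu>) * t ^ (N - \<mu>)"
    unfolding power_add[symmetric] using le by (intro arg_cong[of _ _ "\<lambda>n. t ^ n"]) simp
  then have "t ^ (N - \<nu>) * t ^ (\<mu> + \<nu>) * inverse t ^ (N - \<mu>) = t ^ (2 * \<mu>)"
    using assms(2) by (simp add: power_inverse)
  then show ?thesis
    by (simp add: Th_def i matrix_mult_mat2 power_mult_distrib) (simp add: mult_ac)
qed

text \<open>Right translation by \<open>umat t\<close> adds \<open>t\<close> times the first column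
  to the second, so only the factor with exponent \<open>N - \<mu>\<close> changes, by the binomial
  theorem.\<close>

lemma Th_umat:
  assumes "i \<in> Idx \<mu>"
  shows "Th i \<mu> (g ** umat t) =
    (\<Sum>n\<le>idxN i - \<mu>. t ^ n * (of_nat ((idxN i - \<mu>) choose n) * Th i (\<mu> + n) g))"
proof -
  obtain b \<nu> N where i: "i = (b, \<nu>, N)" by (cases i) auto
  define x y z where "x = g $ row (\<not> b) $ 1" "y = g $ row b $ 1" "z = g $ row b $ 2"
  have "Th i \<mu> (g ** umat t) = x ^ (N - \<nu>) * y ^ (\<mu> + \<nu>) * (y * t + z) ^ (N - \<mu>)"
    by (simp add: Th_def i matrix_mult_mat2 x_y_z_def)
  also have "\<dots> = (\<Sum>n\<le>N - \<mu>. x ^ (N - \<nu>) * y ^ (\<mu> + \<nu>) *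
      (of_nat ((N - \<mu>) choose n) * (y * t) ^ n * z ^ (N - \<mu> - n)))"
    unfolding binomial_ring sum_distrib_left ..
  also have "\<dots> = (\<Sum>n\<le>N - \<mu>. t ^ n * (of_nat ((N - \<mu>) choose n) * Th i (\<mu> + n) g))"
    by (intro sum.cong refl) (simp add: Th_def i flip: x_y_z_def, simp add: power_add power_mult_distrib mult_ac)
  finally show ?thesis by (simp add: i)
qed

lemma regular_Th: "Th i \<mu> \<in> regular_functions"
proof -
  obtain b \<nu> N where i: "i = (b, \<nu>, N)" by (cases i) auto
  have "(\<lambda>g. g $ row (\<not> b) $ 1 ^ (N - \<nu>) * g $ row b $ 1 ^ (\<mu> + \<nu>) * g $ row b $ 2 ^ (N - \<mu>))
      \<in> regular_functions"
    by (intro regular_functions.mult regular_power regular_functions.entry)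
  then show ?thesis by (simp add: Th_def[abs_def] i)
qed

text \<open>Cancellation patterns for products of powers of \<open>t\<close> and
  \<open>inverse t\<close>; the primed letters are inverses.\<close>

lemma cancel_inverses:
  fixes a b c :: "'a::comm_ring_1"
  shows "a * b = c * (d * e) \<Longrightarrow> d * d' = 1 \<Longrightarrow> e * e' = 1 \<Longrightarrow> a * (b * d' * e') = c"
    and "a * (d * e) = c * b \<Longrightarrow> b * b' = 1 \<Longrightarrow> a * (b' * d * e) = c"
    and "a = r * d * e \<Longrightarrow> b = r * x * y \<Longrightarrow> d * d' = 1 \<Longrightarrow> e * e' = 1 \<Longrightarrow>
      a * ((x * y) * (d' * e') * z) = b * z"
proof -
  assume "a * b = c * (d * e)" "d * d' = 1" "e * e' = 1"
  have "a * (b * d' * e') = (a * b) * d' * e'" by (simp add: mult_ac)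
  also have "\<dots> = c * (d * d') * (e * e')" unfolding \<open>a * b = c * (d * e)\<close> by (simp add: mult_ac)
  finally show "a * (b * d' * e') = c" using \<open>d * d' = 1\<close> \<open>e * e' = 1\<close> by simp
next
  assume "a * (d * e) = c * b" "b * b' = 1"
  have "a * (b' * d * e) = (a * (d * e)) * b'" by (simp add: mult_ac)
  also have "\<dots> = c * (b * b')" unfolding \<open>a * (d * e) = c * b\<close> by (simp add: mult_ac)
  finally show "a * (b' * d * e) = c" using \<open>b * b' = 1\<close> by simp
next
  assume *: "a = r * d * e" "b = r * x * y" "d * d' = 1" "e * e' = 1"
  have "a * ((x * y) * (d' * e') * z) = (r * x * y) * (d * d') * (e * e') * z"
    unfolding *(1) by (simp add: mult_ac)
  then show "a * ((x * y) * (d' * e') * z) = b * z" using * by simp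
qed

locale coinduction2 = coinduction s W for s :: "'k::alg_closed_field \<Rightarrow> 'v::ab_group_add \<Rightarrow> 'v" and W +
  assumes char2: "CHAR('k) = 2"
begin

sublocale co: rational2 A
  by unfold_locales (rule rational_coind, rule char2)

lemma double_zero: "(x::'v) + x = 0"
  using char2 by (rule double_zero_char2)

abbreviation E\<Theta> :: "bool \<times> nat \<times> nat \<Rightarrow> nat \<Rightarrow> 'v \<Rightarrow> 'k ^ 2 ^ 2 \<Rightarrow> 'v" where
  "E\<Theta> i \<mu> w \<equiv> elem s (Th i \<mu>) w"

lemma elem_zero [simp]: "elem s f 0 = 0"
  by (simp add: elem_def fun_eq_iff)

lemma E\<Theta>_wsp:
  assumes "i \<in> Idx \<mu>" "w \<in> W"
  shows "E\<Theta> i \<mu> w \<in> wsp A (2 * \<mu>)"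
proof -
  have "gact A (dmat t) (E\<Theta> i \<mu> w) = gscale A (t ^ (2 * \<mu>)) (E\<Theta> i \<mu> w)" if "t \<noteq> 0" for t
    using that by (auto simp: fun_eq_iff elem_def SL2_mult Th_dmat[OF assms(1)])
  then show ?thesis
    using elem_regular[OF regular_Th assms(2)] by (simp add: wsp_def del: coind_sel)
qed

text \<open>By Lucas' theorem \<open>e_j\<close> removes the binary digit \<open>j\<close> from
  \<open>N - \<mu>\<close>, or gives zero if that digit is absent. On sets of digits this is a
  contraction in an exterior algebra.\<close>

lemma ge_E\<Theta>:
  assumes "i \<in> Idx \<mu>" "w \<in> W"
  shows "ge A j (E\<Theta> i \<mu> w) = (if bit (idxN i - \<mu>) j then E\<Theta> i (\<mu> + 2 ^ j) w else 0)"
proof -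
  have "vexp (gscale A) (\<lambda>t. gact A (umat t) (E\<Theta> i \<mu> w))
      (\<lambda>n. pw s (of_nat ((idxN i - \<mu>) choose n)) (E\<Theta> i (\<mu> + n) w))"
  proof (rule co.vexpI[where K = "Suc (idxN i - \<mu>)"])
    show "\<forall>k\<ge>Suc (idxN i - \<mu>). pw s (of_nat ((idxN i - \<mu>) choose k)) (E\<Theta> i (\<mu> + k) w) = 0"
      by (simp add: binomial_eq_0 fun_eq_iff)
    fix t show "gact A (umat t) (E\<Theta> i \<mu> w) =
      (\<Sum>k<Suc (idxN i - \<mu>). gscale A (t ^ k) (pw s (of_nat ((idxN i - \<mu>) choose k)) (E\<Theta> i (\<mu> + k) w)))"
    proof
      fix g show "gact A (umat t) (E\<Theta> i \<mu> w) g =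
        (\<Sum>k<Suc (idxN i - \<mu>). gscale A (t ^ k) (pw s (of_nat ((idxN i - \<mu>) choose k)) (E\<Theta> i (\<mu> + k) w))) g"
        unfolding sum_fun
        by (cases "g \<in> SL2") (simp_all add: elem_def SL2_mult Th_umat[OF assms(1)] scale_sum_left lessThan_Suc_atMost mult.assoc del: sum.lessThan_Suc)
    qed
  qed
  then have "ge A j (E\<Theta> i \<mu> w) = pw s (of_nat ((idxN i - \<mu>) choose 2 ^ j)) (E\<Theta> i (\<mu> + 2 ^ j) w)"
    by (rule co.E_eqI)
  then show ?thesis
    using char2 by (simp add: of_nat_char2 odd_binomial_power2[symmetric] fun_eq_iff)
qed

definition Tsp :: "nat \<Rightarrow> ('k ^ 2 ^ 2 \<Rightarrow> 'v) set" where
  "Tsp \<mu> = pw.span {E\<Theta> i \<mu> w | i w. i \<in> Idx \<mu> \<and> w \<in> W}"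

lemma Tsp_binomial:
  assumes w: "w \<in> W" and i: "\<And>k. k \<le> n \<Longrightarrow> i k \<in> Idx \<mu>"
    and f: "\<And>g. g \<in> SL2 \<Longrightarrow> f g = (\<Sum>k\<le>n. of_nat (n choose k) * Th (i k) \<mu> g)"
  shows "elem s f w \<in> Tsp \<mu>"
proof -
  have "elem s f w = (\<Sum>k\<le>n. pw s (of_nat (n choose k)) (E\<Theta> (i k) \<mu> w))"
  proof
    fix g show "elem s f w g = (\<Sum>k\<le>n. pw s (of_nat (n choose k)) (E\<Theta> (i k) \<mu> w)) g"
      unfolding sum_fun by (cases "g \<in> SL2") (simp_all add: elem_def f scale_sum_left)
  qed
  also have "\<dots> \<in> Tsp \<mu>"
    unfolding Tsp_def by (intro pw.span_sum pw.span_scale pw.span_base) (use w i in blast)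
  finally show ?thesis .
qed

text \<open>If \<open>y\<close> is large enough, \<open>c\<close> absorbs every factor
  \<open>b\<close> and a power of \<open>bc = ad + 1\<close> is expanded, which uses characteristic
  2. Otherwise \<open>a\<close> absorbs every \<open>d\<close> through \<open>ad = bc + 1\<close>,
  and then \<open>\<nu> \<ge> 1\<close>, as the \<open>False\<close> family requires.\<close>

lemma mon_in_Tsp:
  assumes xy: "x + y = 2 * \<mu> + p + q" and w: "w \<in> W"
  shows "elem s (mon (x, p, y, q)) w \<in> Tsp \<mu>"
proof (cases "p + \<mu> \<le> y")
  case True
  define \<nu> where "\<nu> = y - p - \<mu>"
  have y: "y = p + \<mu> + \<nu>" and xx: "x + \<nu> = \<mu> + q" using True xy by (auto simp: \<nu>_def)
  show ?thesis
  proof (rule Tsp_binomial[OF w, where i = "\<lambda>k. (True, \<nu>, \<mu> + q + k)" and n = p])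
    fix k show "(True, \<nu>, \<mu> + q + k) \<in> Idx \<mu>" using xx by (auto simp: Idx_def)
  next
    fix g :: "'k ^ 2 ^ 2" assume g: "g \<in> SL2"
    define a b c d where "a = g $ 1 $ 1" "b = g $ 1 $ 2" "c = g $ 2 $ 1" "d = g $ 2 $ 2"
    have "a * d - b * c = 1" using g by (simp add: SL2_iff a_b_c_d_def)
    then have bc: "b * c = a * d + 1"
      using minus_CHAR_2[OF char2, of "a * d" "b * c"] by (metis add.commute diff_add_cancel minus_CHAR_2[OF char2])
    have "mon (x, p, y, q) g = a ^ x * c ^ (\<mu> + \<nu>) * d ^ q * (b * c) ^ p"
      by (simp add: mon_def y power_add power_mult_distrib mult_ac flip: a_b_c_d_def)
    also have "\<dots> = (\<Sum>k\<le>p. a ^ x * c ^ (\<mu> + \<nu>) * d ^ q * (of_nat (p choose k) * (a * d) ^ k))"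
      unfolding bc binomial_ring sum_distrib_left by simp
    also have "\<dots> = (\<Sum>k\<le>p. of_nat (p choose k) * Th (True, \<nu>, \<mu> + q + k) \<mu> g)"
    proof (intro sum.cong refl)
      fix k
      have "\<mu> + q + k - \<nu> = x + k" using xx by simp
      then show "a ^ x * c ^ (\<mu> + \<nu>) * d ^ q * (of_nat (p choose k) * (a * d) ^ k) =
          of_nat (p choose k) * Th (True, \<nu>, \<mu> + q + k) \<mu> g"
        by (simp add: Th_def row_def power_add power_mult_distrib mult_ac flip: a_b_c_d_def)
    qed
    finally show "mon (x, p, y, q) g = (\<Sum>k\<le>p. of_nat (p choose k) * Th (True, \<nu>, \<mu> + q + k) \<mu> g)" .
  qed
next
  case False
  define \<nu> where "\<nu> = x - q - \<mu>"
  have x: "x = q + \<mu> + \<nu>" and yy: "y + \<nu> = \<mu> + p" and \<nu>: "1 \<le> \<nu>" using False xy by (auto simp: \<nu>_def)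
  show ?thesis
  proof (rule Tsp_binomial[OF w, where i = "\<lambda>k. (False, \<nu>, \<mu> + p + k)" and n = q])
    fix k show "(False, \<nu>, \<mu> + p + k) \<in> Idx \<mu>" using yy \<nu> by (auto simp: Idx_def)
  next
    fix g :: "'k ^ 2 ^ 2" assume g: "g \<in> SL2"
    define a b c d where "a = g $ 1 $ 1" "b = g $ 1 $ 2" "c = g $ 2 $ 1" "d = g $ 2 $ 2"
    have ad: "a * d = b * c + 1" using g by (simp add: SL2_iff a_b_c_d_def algebra_simps)
    have "mon (x, p, y, q) g = a ^ (\<mu> + \<nu>) * b ^ p * c ^ y * (a * d) ^ q"
      by (simp add: mon_def x power_add power_mult_distrib mult_ac flip: a_b_c_d_def)
    also have "\<dots> = (\<Sum>k\<le>q. a ^ (\<mu> + \<nu>) * b ^ p * c ^ y * (of_nat (q choose k) * (b * c) ^ k))"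
      unfolding ad binomial_ring sum_distrib_left by simp
    also have "\<dots> = (\<Sum>k\<le>q. of_nat (q choose k) * Th (False, \<nu>, \<mu> + p + k) \<mu> g)"
    proof (intro sum.cong refl)
      fix k
      have "\<mu> + p + k - \<nu> = y + k" using yy by simp
      then show "a ^ (\<mu> + \<nu>) * b ^ p * c ^ y * (of_nat (q choose k) * (b * c) ^ k) =
          of_nat (q choose k) * Th (False, \<nu>, \<mu> + p + k) \<mu> g"
        by (simp add: Th_def row_def power_add power_mult_distrib mult_ac flip: a_b_c_d_def)
    qed
    finally show "mon (x, p, y, q) g = (\<Sum>k\<le>q. of_nat (q choose k) * Th (False, \<nu>, \<mu> + p + k) \<mu> g)" .
  qed
qed

lemma wsp_in_Tsp:
  assumes \<phi>: "\<phi> \<in> wsp A (2 * \<mu>)"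
  shows "\<phi> \<in> Tsp \<mu>"
proof -
  have \<phi>A: "\<phi> \<in> gspace A" using \<phi> by (rule co.wsp_in)
  then have "\<phi> \<in> pw.span {elem s (mon m) w | m w. m \<in> UNIV \<and> w \<in> W}"
    by (simp only: coind_def gmod.simps UNIV_I simp_thms)
  then obtain F C where F: "finite F" "\<And>m. C m \<in> W" "\<phi> = (\<Sum>m\<in>F. elem s (mon m) (C m))"
    by (rule span_family[OF vector_space_axioms pw.vector_space_axioms subW elem_lin]) blast
  define out where "out m = (case m of (x, p, y, q) \<Rightarrow> p + q)" for m :: "nat \<times> nat \<times> nat \<times> nat"
  define inn where "inn m = (case m of (x, p, y, q) \<Rightarrow> x + y)" for m :: "nat \<times> nat \<times> nat \<times> nat"
  define L where "L = (\<Sum>m\<in>F. out m)"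
  \<comment> \<open>Right translation by \<open>dmat t\<close> multiplies the monomial by
    \<open>t\<close> to the power \<open>inn m - out m\<close>; since \<open>L\<close> bounds every
    \<open>out m\<close>, the shifted exponent is natural.\<close>
  define key where "key m = inn m + L - out m" for m
  have L: "out m \<le> L" if "m \<in> F" for m
    using member_le_sum[OF that, of out] F(1) by (simp add: L_def)
  have mon_d: "t ^ L * mon m (g ** dmat t) = t ^ key m * mon m g" if m: "m \<in> F" and t: "t \<noteq> 0" for m t and g :: "'k ^ 2 ^ 2"
  proof -
    obtain x p y q where mm: "m = (x, p, y, q)" by (cases m) auto
    have le: "p + q \<le> L" using L[OF m] by (simp add: mm out_def)
    have "t ^ L = t ^ (L - (p + q)) * t ^ p * t ^ q"
      unfolding power_add[symmetric] using le by (intro arg_cong[of _ _ "\<lambda>n. t ^ n"]) simp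
    moreover have "t ^ key m = t ^ (L - (p + q)) * t ^ x * t ^ y"
      unfolding power_add[symmetric] using le
      by (intro arg_cong[of _ _ "\<lambda>n. t ^ n"]) (simp add: key_def mm inn_def out_def)
    moreover have "t ^ p * inverse t ^ p = 1" "t ^ q * inverse t ^ q = 1"
      using t by (simp_all flip: power_mult_distrib)
    moreover have "mon m (g ** dmat t) = (t ^ x * t ^ y) * (inverse t ^ p * inverse t ^ q) * mon m g"
      by (simp add: mm mon_def matrix_mult_mat2 power_mult_distrib mult_ac)
    ultimately show ?thesis
      by (simp only: cancel_inverses(3))
  qed
  have val: "\<phi> g = (\<Sum>m | m \<in> F \<and> key m = 2 * \<mu> + L. s (mon m g) (C m))" if g: "g \<in> SL2" for g
  proof -
    \<comment> \<open>The extra index \<open>None\<close> carries \<open>- \<phi> g\<close> with the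
      exponent given by its weight, so that \<open>poly_group\<close> compares both sides at
      once.\<close>
    define I where "I = insert None (Some ` F)"
    define key' where "key' = case_option (2 * \<mu> + L) key"
    define v where "v = case_option (- \<phi> g) (\<lambda>m. s (mon m g) (C m))"
    have "(\<Sum>i | i \<in> I \<and> key' i = 2 * \<mu> + L. v i) = 0"
    proof (rule poly_group[OF _ infinite_nonzero])
      show "finite I" using F by (simp add: I_def)
      fix t :: 'k assume "t \<in> - {0}"
      then have t: "t \<noteq> 0" by simp
      have "s (t ^ (2 * \<mu> + L)) (\<phi> g) = s (t ^ L) (gact A (dmat t) \<phi> g)"
        using \<phi> t by (simp add: wsp_def power_add mult.commute del: coind_sel(2)) 
      also have "\<dots> = s (t ^ L) (\<phi> (g ** dmat t))" using g by simp
      also have "\<dots> = (\<Sum>m\<in>F. s (t ^ L * mon m (g ** dmat t)) (C m))"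
        unfolding F(3) sum_fun using g t by (simp add: elem_def SL2_mult scale_sum_right)
      also have "\<dots> = (\<Sum>m\<in>F. s (t ^ key m) (s (mon m g) (C m)))"
        using t by (intro sum.cong refl) (simp add: mon_d)
      finally have "s (t ^ (2 * \<mu> + L)) (\<phi> g) = (\<Sum>m\<in>F. s (t ^ key m) (s (mon m g) (C m)))" .
      then show "(\<Sum>i\<in>I. s (t ^ key' i) (v i)) = 0"
        unfolding I_def using F(1) by (simp add: sum.reindex key'_def v_def)
    qed
    moreover have "{i. i \<in> I \<and> key' i = 2 * \<mu> + L} = insert None (Some ` {m. m \<in> F \<and> key m = 2 * \<mu> + L})"
      by (auto simp: I_def key'_def)
    ultimately show ?thesis
      using F(1) by (simp add: sum.reindex v_def)
  qed
  have "\<phi> = (\<Sum>m | m \<in> F \<and> key m = 2 * \<mu> + L. elem s (mon m) (C m))"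
  proof
    fix g show "\<phi> g = (\<Sum>m | m \<in> F \<and> key m = 2 * \<mu> + L. elem s (mon m) (C m)) g"
      unfolding sum_fun using coind_outside[OF \<phi>A, of g] val[of g] by (cases "g \<in> SL2") (simp_all add: elem_def)
  qed
  also have "\<dots> \<in> Tsp \<mu>"
    unfolding Tsp_def
  proof (rule pw.span_sum, fold Tsp_def)
    fix m assume m: "m \<in> {m. m \<in> F \<and> key m = 2 * \<mu> + L}"
    obtain x p y q where mm: "m = (x, p, y, q)" by (cases m) auto
    have "m \<in> F" "key m = 2 * \<mu> + L" using m by simp_all
    then have "x + y = 2 * \<mu> + p + q"
      using L[of m] by (simp add: mm key_def inn_def out_def)
    then show "elem s (mon m) (C m) \<in> Tsp \<mu>"
      unfolding mm using F(2) by (rule mon_in_Tsp)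
  qed
  finally show ?thesis .
qed

lemma E\<Theta>_independent:
  assumes I: "finite I" "I \<subseteq> Idx \<mu>" and eq: "(\<Sum>i\<in>I. E\<Theta> i \<mu> (D i)) = 0" and i0: "i0 \<in> I"
  shows "D i0 = 0"
proof -
  define nu where "nu i = fst (snd i)" for i :: "bool \<times> nat \<times> nat"
  define L where "L = (\<Sum>i\<in>I. nu i)"
  have L: "nu i \<le> L" if "i \<in> I" for i
    using member_le_sum[OF that, of nu] I(1) by (simp add: L_def)
  define key where "key i = (if fst i then 2 * L - 2 * nu i else 2 * L + 2 * nu i)" for i
  define y where "y i z = (if fst i then z ^ (idxN i - \<mu>) else (z - 1) ^ (idxN i - \<mu>))" for i and z :: 'k
  \<comment> \<open>On this family in \<open>SL2\<close>, \<open>Th i \<mu>\<close> becomes a power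
    of \<open>t\<close> determined by \<open>(b, \<nu>)\<close>, times \<open>z\<close> or
    \<open>z - 1\<close> to the power \<open>N - \<mu>\<close>. Powers of \<open>t\<close> separate
    the pairs \<open>(b, \<nu>)\<close>, then \<open>z\<close> separates the values of
    \<open>N\<close>.\<close>
  define g where "g t z = mat2 t (t * (z - 1)) (inverse t) (inverse t * z)" for t z :: 'k
  have g: "g t z \<in> SL2" if "t \<noteq> 0" for t z
    using that by (simp add: g_def field_simps)
  have Th: "t ^ (2 * L) * Th i \<mu> (g t z) = t ^ key i * y i z" if i: "i \<in> I" and t: "t \<noteq> 0" for i t z
  proof -
    obtain b \<nu> N where ii: "i = (b, \<nu>, N)" by (cases i) auto
    have le: "\<nu> \<le> N" "\<mu> \<le> N" using i I(2) by (auto simp: ii Idx_def)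
    have \<nu>: "\<nu> \<le> L" using L[OF i] by (simp add: ii nu_def)
    have inv: "t ^ n * inverse t ^ n = 1" for n using t by (simp flip: power_mult_distrib)
    show ?thesis
    proof (cases b)
      case True
      have "t ^ (2 * L) * t ^ (N - \<nu>) = t ^ (2 * L - 2 * \<nu>) * (t ^ (\<mu> + \<nu>) * t ^ (N - \<mu>))"
        unfolding power_add[symmetric] using le \<nu> by (intro arg_cong[of _ _ "\<lambda>n. t ^ n"]) simp
      then have "t ^ (2 * L) * (t ^ (N - \<nu>) * inverse t ^ (\<mu> + \<nu>) * inverse t ^ (N - \<mu>)) = t ^ (2 * L - 2 * \<nu>)"
        by (rule cancel_inverses(1)) (rule inv)+
      then show ?thesis
        using True by (simp add: Th_def ii row_def g_def key_def y_def nu_def power_mult_distrib) (metis mult.assoc)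
    next
      case False
      have "t ^ (2 * L) * (t ^ (\<mu> + \<nu>) * t ^ (N - \<mu>)) = t ^ (2 * L + 2 * \<nu>) * t ^ (N - \<nu>)"
        unfolding power_add[symmetric] using le \<nu> by (intro arg_cong[of _ _ "\<lambda>n. t ^ n"]) simp
      then have "t ^ (2 * L) * (inverse t ^ (N - \<nu>) * t ^ (\<mu> + \<nu>) * t ^ (N - \<mu>)) = t ^ (2 * L + 2 * \<nu>)"
        by (rule cancel_inverses(2)) (rule inv)
      then show ?thesis
        using False by (simp add: Th_def ii row_def g_def key_def y_def nu_def power_mult_distrib) (metis mult.assoc)
    qed
  qed
  define I0 where "I0 = {i. i \<in> I \<and> key i = key i0}"
  have I0: "finite I0" "i0 \<in> I0" using I i0 by (auto simp: I0_def)
  have sum0: "(\<Sum>i\<in>I0. s (y i z) (D i)) = 0" for z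
    unfolding I0_def
  proof (rule poly_group[OF I(1) infinite_nonzero])
    fix t :: 'k assume "t \<in> - {0}"
    then have t: "t \<noteq> 0" by simp
    have "(\<Sum>i\<in>I. s (t ^ key i) (s (y i z) (D i))) = (\<Sum>i\<in>I. s (t ^ (2 * L) * Th i \<mu> (g t z)) (D i))"
      using t by (intro sum.cong refl) (simp add: Th)
    also have "\<dots> = s (t ^ (2 * L)) ((\<Sum>i\<in>I. E\<Theta> i \<mu> (D i)) (g t z))"
      unfolding sum_fun using g[OF t] by (simp add: elem_def scale_sum_right)
    finally show "(\<Sum>i\<in>I. s (t ^ key i) (s (y i z) (D i))) = 0"
      unfolding eq by simp
  qed
  \<comment> \<open>Keys are at most \<open>2 * L\<close> in the \<open>True\<close> family and
    larger in the \<open>False\<close> family, where \<open>\<nu> \<ge> 1\<close>; equal keys thus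
    force the same family and the same \<open>\<nu>\<close>.\<close>
  have same: "fst i = fst i0 \<and> nu i = nu i0" if "i \<in> I0" for i
  proof -
    have "i \<in> I" "key i = key i0" using that by (auto simp: I0_def)
    moreover have "\<not> fst i \<longrightarrow> nu i \<ge> 1" "\<not> fst i0 \<longrightarrow> nu i0 \<ge> 1"
      using \<open>i \<in> I\<close> i0 I(2) by (auto simp: Idx_def nu_def)
    moreover have "nu i \<le> L" "nu i0 \<le> L" using \<open>i \<in> I\<close> i0 L by auto
    ultimately show ?thesis
      unfolding key_def by (cases "fst i"; cases "fst i0"; simp; arith)
  qed
  have "(\<Sum>i\<in>I0. s (t ^ (idxN i - \<mu>)) (D i)) = 0" for t
  proof -
    have "(\<Sum>i\<in>I0. s (t ^ (idxN i - \<mu>)) (D i)) = (\<Sum>i\<in>I0. s (y i (if fst i0 then t else t + 1)) (D i))"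
      by (intro sum.cong refl) (auto simp: y_def dest: same)
    then show ?thesis using sum0 by simp
  qed
  then have "(\<Sum>i | i \<in> I0 \<and> idxN i - \<mu> = idxN i0 - \<mu>. D i) = 0"
    by (intro poly_group[OF I0(1) infinite_alg_closed, where key = "\<lambda>i. idxN i - \<mu>"])
  moreover have "{i. i \<in> I0 \<and> idxN i - \<mu> = idxN i0 - \<mu>} = {i0}"
  proof -
    have "i = i0" if "i \<in> I0" "idxN i - \<mu> = idxN i0 - \<mu>" for i
    proof -
      have "\<mu> \<le> idxN i" "\<mu> \<le> idxN i0" using that I0 I(2) by (auto simp: I0_def Idx_def)
      then show ?thesis using same[OF that(1)] that(2) by (simp add: prod_eq_iff nu_def)
    qed
    then show ?thesis using I0(2) by auto
  qed
  ultimately show ?thesis by simp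
qed

text \<open>In the coordinates \<open>C M i\<close> the differential acts on each index
  \<open>i\<close> separately. The inner sum is the one in the cocycle condition of
  \<open>koszul_homotopy\<close> with \<open>N = idxN i\<close>.\<close>

lemma dK_comb:
  assumes I: "finite I" and C: "\<And>M i. C M i \<in> W" "\<And>M i. C M i \<noteq> 0 \<Longrightarrow> i \<in> Idx (wt M)"
    and F: "\<And>M. F M = (\<Sum>i\<in>I. E\<Theta> i (wt M) (C M i))"
  shows "dK A F M = (\<Sum>i\<in>I. E\<Theta> i (wt M)
    (\<Sum>j\<in>set_mset M. if bit (idxN i - wt (M - {#j#})) j then C (M - {#j#}) i else 0))"
proof -
  have inA: "E\<Theta> i \<mu> w \<in> gspace A" if "w \<in> W" for i \<mu> w
    by (rule elem_regular[OF regular_Th that])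
  have "ge A j (F (M - {#j#})) =
      (\<Sum>i\<in>I. E\<Theta> i (wt M) (if bit (idxN i - wt (M - {#j#})) j then C (M - {#j#}) i else 0))" if j: "j \<in># M" for j
  proof -
    have "ge A j (F (M - {#j#})) = (\<Sum>i\<in>I. ge A j (E\<Theta> i (wt (M - {#j#})) (C (M - {#j#}) i)))"
      unfolding F by (rule co.E_sum) (rule inA[OF C(1)])
    also have "\<dots> = (\<Sum>i\<in>I. E\<Theta> i (wt M) (if bit (idxN i - wt (M - {#j#})) j then C (M - {#j#}) i else 0))"
    proof (intro sum.cong refl)
      fix i
      show "ge A j (E\<Theta> i (wt (M - {#j#})) (C (M - {#j#}) i)) =
        E\<Theta> i (wt M) (if bit (idxN i - wt (M - {#j#})) j then C (M - {#j#}) i else 0)"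
      proof (cases "C (M - {#j#}) i = 0")
        case False
        show ?thesis
          using ge_E\<Theta>[OF C(2)[OF False] C(1), of j] wt_remove[OF j] by simp
      qed (simp add: co.E_zero)
    qed
    finally show ?thesis .
  qed
  then have "dK A F M = (\<Sum>j\<in>set_mset M. \<Sum>i\<in>I.
      E\<Theta> i (wt M) (if bit (idxN i - wt (M - {#j#})) j then C (M - {#j#}) i else 0))"
    unfolding dK_def by (intro sum.cong refl)
  also have "\<dots> = (\<Sum>i\<in>I. \<Sum>j\<in>set_mset M.
      E\<Theta> i (wt M) (if bit (idxN i - wt (M - {#j#})) j then C (M - {#j#}) i else 0))"
    by (rule sum.swap)
  also have "\<dots> = (\<Sum>i\<in>I. E\<Theta> i (wt M)
      (\<Sum>j\<in>set_mset M. if bit (idxN i - wt (M - {#j#})) j then C (M - {#j#}) i else 0))"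
    by (intro sum.cong refl lin_on_add_sum[OF vector_space_axioms subspace_UNIV elem_lin, symmetric]) simp
  finally show ?thesis .
qed

text \<open>The complex splits over the indices \<open>(b, \<nu>, N)\<close> into combinatorial
  complexes with coefficients in \<open>W\<close>. The homotopy gives a primitive in each of
  them.\<close>

lemma acyclic_coind: "acyclic_module A"
  unfolding acyclic_module_def
proof (intro allI subsetI)
  fix t F assume F: "F \<in> cocycles A (Suc t)"
  then have Fc: "F \<in> cochains A (Suc t)" and dF: "\<And>M. dK A F M = 0"
    by (auto simp: cocycles_def)
  note FD = co.cochainsD[OF Fc]
  have "\<exists>I C. finite I \<and> I \<subseteq> Idx (wt M) \<and> (\<forall>i. C i \<in> W) \<and> F M = (\<Sum>i\<in>I. E\<Theta> i (wt M) (C i))" for M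
  proof -
    have "F M \<in> pw.span {E\<Theta> i (wt M) w | i w. i \<in> Idx (wt M) \<and> w \<in> W}"
      using wsp_in_Tsp[OF FD(1)] by (simp add: Tsp_def)
    then show ?thesis
      by (rule span_family[OF vector_space_axioms pw.vector_space_axioms subW elem_lin]) blast
  qed
  then obtain I' where "\<forall>M. \<exists>C. finite (I' M) \<and> I' M \<subseteq> Idx (wt M) \<and> (\<forall>i. C i \<in> W) \<and>
      F M = (\<Sum>i\<in>I' M. E\<Theta> i (wt M) (C i))"
    using choice[of "\<lambda>M I. \<exists>C. finite I \<and> I \<subseteq> Idx (wt M) \<and> (\<forall>i. C i \<in> W) \<and>
      F M = (\<Sum>i\<in>I. E\<Theta> i (wt M) (C i))"] by blast
  from choice[OF this] obtain C' where C': "\<forall>M. finite (I' M) \<and> I' M \<subseteq> Idx (wt M) \<and> (\<forall>i. C' M i \<in> W) \<and>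
      F M = (\<Sum>i\<in>I' M. E\<Theta> i (wt M) (C' M i))" by blast
  then have I': "\<And>M. finite (I' M)" "\<And>M. I' M \<subseteq> Idx (wt M)" "\<And>M i. C' M i \<in> W"
    by blast+
  have I'4: "F M = (\<Sum>i\<in>I' M. E\<Theta> i (wt M) (C' M i))" for M
    using C' by blast
  \<comment> \<open>As \<open>F\<close> has finitely many nonzero values, one finite index set
    serves all \<open>M\<close>; missing coefficients are set to zero.\<close>
  define I where "I = (\<Union>M\<in>{M. F M \<noteq> 0}. I' M)"
  define C where "C M i = (if F M \<noteq> 0 \<and> i \<in> I' M then C' M i else 0)" for M i
  have I: "finite I" using FD(4) I'(1) by (simp add: I_def)
  have CW: "C M i \<in> W" for M i using I'(3) subspace_0[OF subW] by (simp add: C_def)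
  have Cnz: "F M \<noteq> 0 \<and> i \<in> Idx (wt M)" if "C M i \<noteq> 0" for M i
    using that I'(2) by (auto simp: C_def split: if_splits)
  have FC: "F M = (\<Sum>i\<in>I. E\<Theta> i (wt M) (C M i))" for M
  proof (cases "F M = 0")
    case True
    then show ?thesis by (simp add: C_def)
  next
    case False
    have "(\<Sum>i\<in>I. E\<Theta> i (wt M) (C M i)) = (\<Sum>i\<in>I' M. E\<Theta> i (wt M) (C' M i))"
      by (rule sum.mono_neutral_cong_right) (use I False in \<open>auto simp: C_def I_def\<close>)
    then show ?thesis using I'4[of M] by simp
  qed
  define D where "D M i = (\<Sum>j\<in>set_mset M. if bit (idxN i - wt (M - {#j#})) j then C (M - {#j#}) i else 0)" for M i
  have D0: "D M i = 0" if i: "i \<in> I" for M i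
  proof (rule ccontr)
    assume nz: "D M i \<noteq> 0"
    \<comment> \<open>Independence is available only for admissible indices, so the coefficients of
      \<open>dK A F M\<close> must first vanish outside \<open>Idx (wt M)\<close>.\<close>
    have Didx: "i \<in> Idx (wt M)" if nz: "D M i \<noteq> 0" for i
    proof -
      obtain j where "j \<in># M" "(if bit (idxN i - wt (M - {#j#})) j then C (M - {#j#}) i else 0) \<noteq> 0"
        using nz unfolding D_def by (rule sum.not_neutral_contains_not_neutral)
      then have j: "j \<in># M" "bit (idxN i - wt (M - {#j#})) j" "C (M - {#j#}) i \<noteq> 0"
        by presburger+
      have "i \<in> Idx (wt (M - {#j#}))" using Cnz[OF j(3)] by simp
      moreover have "wt M \<le> idxN i"
        using bit_imp_le[OF j(2)] wt_remove[OF j(1)] calculation by (auto simp: Idx_def)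
      ultimately show ?thesis by (auto simp: Idx_def)
    qed
    have "(\<Sum>i\<in>{i \<in> I. D M i \<noteq> 0}. E\<Theta> i (wt M) (D M i)) = (\<Sum>i\<in>I. E\<Theta> i (wt M) (D M i))"
      by (rule sum.mono_neutral_left) (use I in auto)
    also have "\<dots> = dK A F M"
      unfolding D_def by (rule dK_comb[OF I CW _ FC, symmetric]) (use Cnz in blast)
    finally have "(\<Sum>i\<in>{i \<in> I. D M i \<noteq> 0}. E\<Theta> i (wt M) (D M i)) = 0"
      by (simp only: dF)
    then have "D M i = 0"
      by (rule E\<Theta>_independent[rotated 2]) (use I i nz Didx in auto)
    then show False using nz by simp
  qed
  define H where "H M i = koszul_homotopy (idxN i) (\<lambda>M. C M i) M" for M i
  have Hnz: "\<exists>j. C (add_mset j M) i \<noteq> 0 \<and> i \<in> Idx (wt M)" if nz: "H M i \<noteq> 0" for M i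
  proof -
    obtain j where j: "C (add_mset j M) i \<noteq> 0" "wt (add_mset j M) \<le> idxN i"
      using nz unfolding H_def by (rule koszul_homotopy_nonzero)
    then show ?thesis using Cnz[OF j(1)] by (intro exI[of _ j]) (auto simp: Idx_def)
  qed
  have HW: "H M i \<in> W" for M i
    using CW subspace_0[OF subW] by (simp add: H_def koszul_homotopy_def Let_def)
  have HC: "(\<Sum>j\<in>set_mset M. if bit (idxN i - wt (M - {#j#})) j then H (M - {#j#}) i else 0) = C M i"
    if "i \<in> I" "M \<noteq> {#}" for M i
    unfolding H_def
  proof (rule koszul_homotopy[OF double_zero _ _ that(2)])
    fix M assume "idxN i < wt M"
    then show "C M i = 0" using Cnz[of M i] Idx_le[of i "wt M"] by linarith
  next
    fix M show "(\<Sum>j\<in>set_mset M. if bit (idxN i - wt (M - {#j#})) j then C (M - {#j#}) i else 0) = 0"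
      using D0[OF that(1)] by (simp add: D_def)
  qed
  define G where "G M = (\<Sum>i\<in>I. E\<Theta> i (wt M) (H M i))" for M
  have Gnz: "\<exists>j. F (add_mset j M) \<noteq> 0" if nz: "G M \<noteq> 0" for M
  proof -
    obtain i where "E\<Theta> i (wt M) (H M i) \<noteq> 0"
      using sum.not_neutral_contains_not_neutral[OF nz[unfolded G_def]] by blast
    then have "H M i \<noteq> 0" by auto
    then show ?thesis using Hnz Cnz by blast
  qed
  have "G M \<in> wsp A (2 * wt M)" for M
    unfolding G_def
  proof (rule co.subspace_sum[OF co.wsp_sub])
    fix i show "E\<Theta> i (wt M) (H M i) \<in> wsp A (2 * wt M)"
      using E\<Theta>_wsp[of i "wt M" "H M i"] Hnz[of M i] HW[of M i]
      by (cases "H M i = 0") (auto simp del: coind_sel)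
  qed
  moreover have "G M = 0" if "size M \<noteq> t" for M
  proof (rule ccontr)
    assume "G M \<noteq> 0"
    then obtain j where "F (add_mset j M) \<noteq> 0" using Gnz by blast
    then show False using FD(3)[of "add_mset j M"] that by simp
  qed
  moreover have "finite {M. G M \<noteq> 0}"
  proof (rule finite_subset)
    show "{M. G M \<noteq> 0} \<subseteq> (\<Union>M'\<in>{M. F M \<noteq> 0}. (\<lambda>j. M' - {#j#}) ` set_mset M')"
    proof
      fix M assume "M \<in> {M. G M \<noteq> 0}"
      then obtain j where j: "F (add_mset j M) \<noteq> 0" using Gnz by blast
      have "M = add_mset j M - {#j#}" "j \<in># add_mset j M" by simp_all
      then show "M \<in> (\<Union>M'\<in>{M. F M \<noteq> 0}. (\<lambda>j. M' - {#j#}) ` set_mset M')"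
        using j by blast
    qed
  qed (use FD(4) in simp)
  ultimately have G: "G \<in> cochains A t" by (simp add: cochains_def)
  have "F M = dK A G M" for M
  proof (cases "M = {#}")
    case True
    then show ?thesis using FD(3)[of M] by (simp add: dK_def)
  next
    case False
    have "dK A G M = (\<Sum>i\<in>I. E\<Theta> i (wt M)
        (\<Sum>j\<in>set_mset M. if bit (idxN i - wt (M - {#j#})) j then H (M - {#j#}) i else 0))"
      by (rule dK_comb[OF I HW _ G_def]) (use Hnz in blast)
    also have "\<dots> = F M"
      unfolding FC using False by (intro sum.cong refl) (simp add: HC)
    finally show ?thesis by simp
  qed
  then show "F \<in> dK A ` cochains A t" using G by blast
qed

end

section \<open>Modules of countable dimension\<close>

text \<open>Countable dimension without a choice of basis. It passes to coinduced modules and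
  quotients, and guarantees a place in any infinite-dimensional universe.\<close>

definition countable_span :: "('k::field \<Rightarrow> 'v::ab_group_add \<Rightarrow> 'v) \<Rightarrow> 'v set \<Rightarrow> bool" where
  "countable_span s X \<longleftrightarrow> (\<exists>C. countable C \<and> X \<subseteq> module.span s C)"

text \<open>Each vector of \<open>B\<close> lies in the span of a finite part of \<open>C\<close>;
  such a span meets \<open>B\<close> in a finite set, and there are countably many finite
  parts.\<close>

lemma (in vector_space) independent_countable:
  assumes B: "independent B" "B \<subseteq> span C" and C: "countable C"
  shows "countable B"
proof -
  have "B \<subseteq> (\<Union>F\<in>{F. finite F \<and> F \<subseteq> C}. B \<inter> span F)"
  proof
    fix x assume x: "x \<in> B"
    then have "x \<in> span C" using B(2) by blast
    then obtain F r where F: "finite F" "F \<subseteq> C" "x = (\<Sum>a\<in>F. scale (r a) a)"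
      unfolding span_explicit by blast
    have "x \<in> span F" unfolding F(3) by (intro span_sum span_scale span_base)
    then show "x \<in> (\<Union>F\<in>{F. finite F \<and> F \<subseteq> C}. B \<inter> span F)" using F x by blast
  qed
  moreover have "finite (B \<inter> span F)" if "finite F" for F
    using independent_span_bound[OF that, of "B \<inter> span F"] independent_mono[OF B(1)] by blast
  then have "countable (\<Union>F\<in>{F. finite F \<and> F \<subseteq> C}. B \<inter> span F)"
    using countable_Collect_finite_subset[OF C] by (intro countable_UN) (auto intro: countable_finite)
  ultimately show ?thesis by (rule countable_subset)
qed

text \<open>Embeds \<open>X / S\<close> into the universe: a basis of \<open>S\<close> is extended
  to one of \<open>X\<close>; its old part goes to zero and its countable new part goes injectively
  into a basis of the universe.\<close>

lemma exists_map_with_kernel: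
  assumes "vector_space s" "vector_space sc"
    and inf: "\<not> (\<exists>B. finite B \<and> module.span sc B = UNIV)"
    and S: "module.subspace s S" "S \<subseteq> X" and X: "module.subspace s X" "countable_span s X"
  obtains \<pi> where "lin_on s UNIV sc \<pi>" "\<And>x. x \<in> X \<Longrightarrow> \<pi> x = 0 \<longleftrightarrow> x \<in> S"
proof -
  interpret vector_space_pair s sc
    by (intro vector_space_pair.intro assms)
  obtain BS where BS: "BS \<subseteq> S" "vs1.independent BS" "S \<subseteq> vs1.span BS"
    using vs1.maximal_independent_subset[of S] by blast
  obtain B where B: "BS \<subseteq> B" "B \<subseteq> X" "vs1.independent B" "X \<subseteq> vs1.span B"
    using vs1.maximal_independent_subset_extend[of BS X] BS S(2) by blast
  obtain C where "countable C" "X \<subseteq> vs1.span C" using X(2) by (auto simp: countable_span_def)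
  then have cB: "countable B" using vs1.independent_countable[OF B(3)] B(2) by blast
  obtain D where D: "vs2.independent D" "UNIV \<subseteq> vs2.span D"
    using vs2.maximal_independent_subset[of UNIV] by blast
  have "infinite D" using inf D(2) by blast
  then obtain f :: "nat \<Rightarrow> _" where f: "inj f" "range f \<subseteq> D"
    using infinite_countable_subset by blast
  define \<iota> where "\<iota> b = f (to_nat_on B b)" for b
  have \<iota>: "inj_on \<iota> B" "\<iota> ` B \<subseteq> D"
    using f inj_on_to_nat_on[OF cB] by (auto simp: \<iota>_def inj_on_def)
  obtain \<pi> where \<pi>: "Vector_Spaces.linear s sc \<pi>" "\<forall>x\<in>B. \<pi> x = (if x \<in> BS then 0 else \<iota> x)"
    using linear_independent_extend[OF B(3), of "\<lambda>x. if x \<in> BS then 0 else \<iota> x"] by blast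
  interpret \<pi>: Vector_Spaces.linear s sc \<pi> by fact
  have spS: "vs1.span BS = S"
    using BS S(1) by (metis vs1.span_subspace)
  have zero: "\<pi> x = 0" if "x \<in> S" for x
    using \<pi>.eq_0_on_span[of BS x] that spS \<pi>(2) B(1) by (metis (no_types, lifting) subsetD)
  have "\<pi> ` (B - BS) = \<iota> ` (B - BS)" using \<pi>(2) by (intro image_cong) auto
  then have "vs2.independent (\<pi> ` (B - BS))"
    using vs2.independent_mono[OF D(1), of "\<pi> ` (B - BS)"] \<iota>(2) by (metis Diff_subset image_mono subset_trans)
  moreover have "inj_on \<pi> (B - BS)"
    using \<iota>(1) \<pi>(2) by (auto simp: inj_on_def)
  ultimately have inj: "inj_on \<pi> (vs1.span (B - BS))"
    by (rule \<pi>.inj_on_span_independent_image)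
  have "x \<in> S" if x: "x \<in> X" "\<pi> x = 0" for x
  proof -
    have "x \<in> vs1.span (BS \<union> (B - BS))" using x B(1,4) by (metis Un_Diff_cancel subset_Un_eq subsetD)
    then obtain y z where yz: "x = y + z" "y \<in> vs1.span BS" "z \<in> vs1.span (B - BS)"
      unfolding vs1.span_Un by blast
    then have "\<pi> z = 0" using x zero spS by (simp add: \<pi>.add)
    then have "z = 0" using inj yz(3) by (auto dest: inj_onD[of _ _ z 0] intro: vs1.span_zero)
    then show ?thesis using yz spS by simp
  qed
  moreover have "lin_on s UNIV sc \<pi>" by (simp add: lin_on_def \<pi>.add \<pi>.scale)
  ultimately show ?thesis using that zero by blast
qed

text \<open>Taking the quotient as the image of a linear map with kernel \<open>S\<close> places it
  in a prescribed type. With \<open>S = {0}\<close> the same construction copies a module into the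
  universe.\<close>

lemma exists_quotient_module:
  fixes V :: "('k::alg_closed_field, 'w::ab_group_add) gmod" and sc :: "'k \<Rightarrow> 'v::ab_group_add \<Rightarrow> 'v"
  assumes V: "rational_module V" and S: "submodule_of V S"
    and cs: "countable_span (gscale V) (gspace V)"
    and sc: "vector_space sc" and inf: "\<not> (\<exists>B. finite B \<and> module.span sc B = UNIV)"
  obtains Q \<pi> where "rational_module Q" "gscale Q = sc" "countable_span sc (gspace Q)"
    "\<pi> \<in> gHom V Q" "\<pi> ` gspace V = gspace Q" "\<And>x. x \<in> gspace V \<Longrightarrow> \<pi> x = 0 \<longleftrightarrow> x \<in> S"
proof -
  interpret V: rational V by standard fact
  interpret sc: vector_space sc by fact
  have SV: "S \<subseteq> gspace V" "V.subspace S" "\<And>g v. g \<in> SL2 \<Longrightarrow> v \<in> S \<Longrightarrow> gact V g v \<in> S"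
    using S by (auto simp: submodule_of_def)
  obtain p where p: "lin_on (gscale V) UNIV sc p" "\<And>x. x \<in> gspace V \<Longrightarrow> p x = 0 \<longleftrightarrow> x \<in> S"
    by (rule exists_map_with_kernel[OF V.vector_space_axioms sc inf SV(2,1) V.sub cs]) blast
  have padd: "p (x + y) = p x + p y" and pscale: "p (gscale V c x) = sc c (p x)" for x y c
    using p(1) by (auto simp: lin_on_def)
  have pdiff: "p (x - y) = p x - p y" for x y
    using padd[of "x - y" y] by simp
  have psum: "p (\<Sum>i\<in>A. gscale V (a i) (f i)) = (\<Sum>i\<in>A. sc (a i) (p (f i)))" for A a and f :: "nat \<Rightarrow> _"
    by (rule lin_on_sum[OF V.vector_space_axioms V.subspace_UNIV p(1)]) simp
  \<comment> \<open>The action goes through an arbitrary preimage; the fact \<open>act\<close> shows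
    that the result does not depend on it, because \<open>S\<close> is stable.\<close>
  define Q where "Q = \<lparr>gspace = p ` gspace V, gscale = sc,
    gact = (\<lambda>g y. p (gact V g (inv_into (gspace V) p y)))\<rparr>"
  have Qsel: "gspace Q = p ` gspace V" "gscale Q = sc" by (simp_all add: Q_def)
  have act: "gact Q g (p x) = p (gact V g x)" if g: "g \<in> SL2" and x: "x \<in> gspace V" for g x
  proof -
    define x' where "x' = inv_into (gspace V) p (p x)"
    have x': "x' \<in> gspace V" "p x' = p x"
      using x by (simp_all add: x'_def inv_into_into f_inv_into_f)
    then have "x' - x \<in> S" using p(2)[of "x' - x"] x by (simp add: V.diff_in pdiff)
    then have "gact V g (x' - x) \<in> S" using SV(3) g by blast
    then have "p (gact V g (x' - x)) = 0" using p(2) SV(1) by blast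
    moreover have "gact V g x' = gact V g (x' - x) + gact V g x"
      using V.act_add[OF g, of "x' - x" x] x x' by (simp add: V.diff_in)
    ultimately show ?thesis by (simp add: Q_def padd flip: x'_def)
  qed
  have "\<exists>(n::nat) f w. (\<forall>i<n. f i \<in> regular_functions \<and> w i \<in> gspace Q) \<and>
      (\<forall>g\<in>SL2. gact Q g y = (\<Sum>i<n. sc (f i g) (w i)))" if y: "y \<in> gspace Q" for y
  proof -
    obtain x where x: "x \<in> gspace V" "y = p x" using y Qsel by blast
    obtain n :: nat and f w where f: "\<And>i. i < n \<Longrightarrow> f i \<in> regular_functions" "\<And>i. i < n \<Longrightarrow> w i \<in> gspace V"
      "\<And>g. g \<in> SL2 \<Longrightarrow> gact V g x = (\<Sum>i<n. gscale V (f i g) (w i))"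
      using V.orbit[OF x(1)] by metis
    then show ?thesis
      by (intro exI[of _ n] exI[of _ f] exI[of _ "\<lambda>i. p (w i)"]) (auto simp: x act psum Qsel)
  qed
  moreover have "sc.subspace (gspace Q)"
    unfolding sc.subspace_def Qsel
  proof (intro conjI ballI allI)
    have "p 0 = 0" using p(2)[of 0] V.subspace_0[OF SV(2)] by simp
    then show "0 \<in> p ` gspace V" by (metis V.zero_in image_eqI)
    fix x y assume "x \<in> p ` gspace V" "y \<in> p ` gspace V"
    then show "x + y \<in> p ` gspace V" by (auto simp: V.add_in simp flip: padd)
  next
    fix c x assume "x \<in> p ` gspace V"
    then show "sc c x \<in> p ` gspace V" by (auto simp: V.scale_in simp flip: pscale)
  qed
  ultimately have ratQ: "rational_module Q"
    unfolding rational_module_def using sc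
    by (auto simp: Qsel act V.act_in V.add_in V.scale_in V.act_add V.act_scale V.act_one V.act_mult SL2_mult
        simp flip: padd pscale)
  have "countable_span sc (gspace Q)"
  proof -
    obtain C where C: "countable C" "gspace V \<subseteq> V.span C" using cs by (auto simp: countable_span_def)
    have "p x \<in> sc.span (p ` C)" if "x \<in> V.span C" for x
      using that
    proof (induction rule: V.span_induct_alt)
      case base
      have "p 0 = 0" using p(2)[of 0] V.subspace_0[OF SV(2)] by simp
      then show ?case by (simp add: sc.span_zero)
    next
      case (step c x y)
      then have "sc c (p x) + p y \<in> sc.span (p ` C)"
        by (intro sc.span_add[OF sc.span_scale[OF sc.span_base]]) auto
      then show ?case by (simp add: padd pscale)
    qed
    then show ?thesis
      unfolding countable_span_def Qsel using C by (intro exI[of _ "p ` C"]) auto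
  qed
  moreover have "(\<lambda>x. if x \<in> gspace V then p x else 0) \<in> gHom V Q"
    by (rule gHomI) (auto simp: Qsel lin_on_def V.add_in V.scale_in V.act_in padd pscale act)
  moreover have "(\<lambda>x. if x \<in> gspace V then p x else 0) ` gspace V = gspace Q"
    by (auto simp: Qsel)
  ultimately show ?thesis
    using that[of Q "\<lambda>x. if x \<in> gspace V then p x else 0"] ratQ p(2) Qsel by auto
qed

section \<open>Frobenius reciprocity and injective modules\<close>

context rational_hom
begin

lemma inj_on_if_kernel_zero:
  assumes "\<And>v. v \<in> gspace V \<Longrightarrow> \<phi> v = 0 \<Longrightarrow> v = 0"
  shows "inj_on \<phi> (gspace V)"
proof (rule inj_onI)
  fix x y assume "x \<in> gspace V" "y \<in> gspace V" "\<phi> x = \<phi> y"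
  then show "x = y" using assms[of "x - y"] by (simp add: hom_diff V.diff_in)
qed

lemma inverse_hom:
  assumes inj: "inj_on \<phi> (gspace V)"
  obtains \<sigma> where "\<sigma> \<in> gHom (W\<lparr>gspace := \<phi> ` gspace V\<rparr>) V" "\<And>v. v \<in> gspace V \<Longrightarrow> \<sigma> (\<phi> v) = v"
proof -
  define \<sigma> where "\<sigma> y = (if y \<in> \<phi> ` gspace V then inv_into (gspace V) \<phi> y else 0)" for y
  have \<sigma>: "\<sigma> (\<phi> v) = v" if "v \<in> gspace V" for v
    using that inj by (simp add: \<sigma>_def)
  have "\<sigma> (\<phi> v + \<phi> w) = v + w" if "v \<in> gspace V" "w \<in> gspace V" for v w
    using \<sigma>[OF V.add_in[OF that]] that by (simp add: hom_add)
  moreover have "\<sigma> (gscale W c (\<phi> v)) = gscale V c v" if "v \<in> gspace V" for c v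
    using \<sigma>[OF V.scale_in[OF that]] that by (simp add: hom_scale)
  moreover have "\<sigma> (gact W g (\<phi> v)) = gact V g v" if "g \<in> SL2" "v \<in> gspace V" for g v
    using \<sigma>[OF V.act_in[OF that]] that by (simp add: hom_act)
  ultimately have "\<sigma> \<in> gHom (W\<lparr>gspace := \<phi> ` gspace V\<rparr>) V"
    using \<sigma> by (auto simp: gHom_def) (simp add: \<sigma>_def)
  then show ?thesis using that \<sigma> by blast
qed

end

lemma gHom_comp:
  assumes "\<phi> \<in> gHom V W" "\<psi> \<in> gHom W X" "\<psi> 0 = 0"
  shows "\<psi> \<circ> \<phi> \<in> gHom V X"
  using assms by (auto simp: gHom_def)

text \<open>Frobenius reciprocity: \<open>L\<close> corresponds to the homomorphism
  \<open>v \<mapsto> (g \<mapsto> L (g v))\<close>, from which evaluation at the identity recovers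
  \<open>L\<close>.\<close>

definition frob :: "('k::field, 'w::ab_group_add) gmod \<Rightarrow> ('w \<Rightarrow> 'v::zero) \<Rightarrow> 'w \<Rightarrow> 'k ^ 2 ^ 2 \<Rightarrow> 'v" where
  "frob V L v g = (if g \<in> SL2 \<and> v \<in> gspace V then L (gact V g v) else 0)"

context coinduction
begin

lemma frob_hom:
  fixes V :: "('k, 'w::ab_group_add) gmod"
  assumes V: "rational_module V" and L: "lin_on (gscale V) (gspace V) s L"
    and LW: "\<And>v. v \<in> gspace V \<Longrightarrow> L v \<in> W"
  shows "frob V L \<in> gHom V A"
proof (rule gHomI)
  interpret V: rational V by standard fact
  fix v assume v: "v \<in> gspace V"
  obtain n :: nat and f w where f: "\<And>i. i < n \<Longrightarrow> f i \<in> regular_functions" "\<And>i. i < n \<Longrightarrow> w i \<in> gspace V"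
      "\<And>g. g \<in> SL2 \<Longrightarrow> gact V g v = (\<Sum>i<n. gscale V (f i g) (w i))"
      using V.orbit[OF v] by metis
  have "frob V L v = (\<Sum>i<n. elem s (f i) (L (w i)))"
  proof
    fix g show "frob V L v g = (\<Sum>i<n. elem s (f i) (L (w i))) g"
      unfolding sum_fun using v f lin_on_sum[OF V.vector_space_axioms V.sub L, of "{..<n}" w "\<lambda>i. f i g"]
      by (simp add: frob_def elem_def)
  qed
  also have "\<dots> \<in> gspace A"
    by (rule pw.subspace_sum[OF subA]) (use f LW in \<open>auto intro: elem_regular\<close>)
  finally show "frob V L v \<in> gspace A" .
  show "frob V L (gact V h v) = gact A h (frob V L v)" if h: "h \<in> SL2" for h
    using v h by (auto simp: fun_eq_iff frob_def V.act_in V.act_mult SL2_mult)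
next
  interpret V: rational V by standard fact
  show "lin_on (gscale V) (gspace V) (gscale A) (frob V L)"
    using L by (auto simp: lin_on_def fun_eq_iff frob_def V.add_in V.scale_in V.act_add V.act_scale V.act_in)
next
  fix v assume "v \<notin> gspace V"
  then show "frob V L v = 0" by (simp add: fun_eq_iff frob_def)
qed

text \<open>Injectivity reduces to linear algebra: evaluate at the identity, extend the resulting
  linear map from \<open>S\<close> to \<open>V\<close>, and return by Frobenius reciprocity. A copy
  is needed since coinduced modules live in a function type, outside the universe.\<close>

lemma injective_copy:
  fixes I :: "('k, 'u::ab_group_add) gmod"
  assumes I: "rational_module I" and \<tau>: "\<tau> \<in> gHom A I" "\<tau> ` gspace A = gspace I"
    and ker: "\<And>x. x \<in> gspace A \<Longrightarrow> \<tau> x = 0 \<Longrightarrow> x = 0"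
  shows "injective_module I"
  unfolding injective_module_def
proof (intro conjI allI impI ballI, rule I, elim conjE)
  interpret \<tau>: rational_hom A I \<tau>
    by unfold_locales (rule rational_coind I \<tau>(1))+
  fix V :: "('k, 'u) gmod" and S \<phi>
  assume V: "rational_module V" and S: "submodule_of V S" and \<phi>: "\<phi> \<in> gHom (V\<lparr>gspace := S\<rparr>) I"
  interpret V: rational V by standard fact
  have SV: "S \<subseteq> gspace V" "V.subspace S" "\<And>g v. g \<in> SL2 \<Longrightarrow> v \<in> S \<Longrightarrow> gact V g v \<in> S"
    using S by (auto simp: submodule_of_def)
  obtain \<sigma> where "\<sigma> \<in> gHom (I\<lparr>gspace := \<tau> ` gspace A\<rparr>) A" and \<sigma>\<tau>: "\<And>x. x \<in> gspace A \<Longrightarrow> \<sigma> (\<tau> x) = x"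
    by (rule \<tau>.inverse_hom[OF \<tau>.inj_on_if_kernel_zero[OF ker]]) blast+
  then have \<sigma>: "\<sigma> \<in> gHom I A" by (simp add: \<tau>(2))
  interpret \<sigma>: rational_hom I A \<sigma> by unfold_locales (rule \<sigma>)
  have \<phi>in: "\<phi> v \<in> gspace I" if "v \<in> S" for v using gHomD(1)[OF \<phi>] that by simp
  have \<tau>\<sigma>: "\<tau> (\<sigma> y) = y" if "y \<in> gspace I" for y using that \<sigma>\<tau> \<tau>(2) by force
  have \<sigma>\<phi>: "\<sigma> \<circ> \<phi> \<in> gHom (V\<lparr>gspace := S\<rparr>) A" by (rule gHom_comp[OF \<phi> \<sigma>]) simp
  define L where "L v = \<sigma> (\<phi> v) (mat 1)" for v
  have "lin_on (gscale V) S s L"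
    using gHomD(2)[OF \<sigma>\<phi>] by (simp add: lin_on_def L_def)
  moreover have "L v \<in> W" if "v \<in> S" for v
    unfolding L_def by (rule coind_in_W) (rule \<sigma>.hom_in[OF \<phi>in[OF that]])
  ultimately obtain L' where L': "lin_on (gscale V) UNIV s L'" "\<And>x. x \<in> S \<Longrightarrow> L' x = L x" "\<And>x. L' x \<in> W"
    by (rule lin_on_extend[OF V.vector_space_axioms vector_space_axioms SV(2) subW]) blast+
  have fr: "frob V L' \<in> gHom V A"
    by (rule frob_hom[OF V]) (use L' in \<open>auto simp: lin_on_def\<close>)
  have eq: "frob V L' v = \<sigma> (\<phi> v)" if v: "v \<in> S" for v
  proof
    fix g
    show "frob V L' v g = \<sigma> (\<phi> v) g"
    proof (cases "g \<in> SL2")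
      case False
      then show ?thesis using coind_outside[OF \<sigma>.hom_in[OF \<phi>in[OF v]]] by (simp add: frob_def)
    next
      case True
      then have "\<sigma> (\<phi> (gact V g v)) = gact A g (\<sigma> (\<phi> v))"
        using gHomD(3)[OF \<sigma>\<phi> True, of v] v by simp
      then show ?thesis
        using True v SV by (auto simp: frob_def L' L_def)
    qed
  qed
  have "\<tau> \<circ> frob V L' \<in> gHom V I" by (rule gHom_comp[OF fr \<tau>(1)]) simp
  moreover have "\<forall>v\<in>S. \<tau> (frob V L' v) = \<phi> v"
    using eq \<tau>\<sigma> \<phi>in by simp
  ultimately show "\<exists>\<psi>\<in>gHom V I. \<forall>v\<in>S. \<psi> v = \<phi> v"
    by (intro bexI[of _ "\<tau> \<circ> frob V L'"]) simp_all
qed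

lemma countable_coind:
  assumes "countable_span s W"
  shows "countable_span (gscale A) (gspace A)"
proof -
  obtain C where C: "countable C" "W \<subseteq> span C" using assms by (auto simp: countable_span_def)
  define D where "D = (\<lambda>(m, c). elem s (mon m) c) ` (UNIV \<times> C)"
  have "elem s (mon m) w \<in> pw.span D" if "w \<in> span C" for m w
    using that
  proof (induction rule: span_induct_alt)
    case base
    have "elem s (mon m) 0 = 0" by (simp add: elem_def fun_eq_iff)
    then show ?case by (simp only: pw.span_zero)
  next
    case (step c x y)
    have "elem s (mon m) x \<in> pw.span D"
      by (rule pw.span_base) (use step in \<open>force simp: D_def\<close>)
    then have "pw s c (elem s (mon m) x) + elem s (mon m) y \<in> pw.span D"
      using step by (intro pw.span_add pw.span_scale)
    moreover have "elem s (mon m) (s c x + y) = pw s c (elem s (mon m) x) + elem s (mon m) y"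
      by (auto simp: elem_def fun_eq_iff scale_right_distrib mult.commute)
    ultimately show ?case by (simp only:)
  qed
  then have "gspace A \<subseteq> pw.span D"
    unfolding coind_def gmod.simps using C(2) by (intro pw.span_minimal) auto
  moreover have "countable D" unfolding D_def using C by (intro countable_image countable_SIGMA) auto
  ultimately show ?thesis by (auto simp: countable_span_def)
qed

end

section \<open>Existence of injective resolutions\<close>

lemma zero_submodule:
  fixes V :: "('k::alg_closed_field, 'v::ab_group_add) gmod"
  assumes "rational_module V"
  shows "submodule_of V {0}"
proof -
  interpret rational V by unfold_locales (rule assms)
  show ?thesis by (simp add: submodule_of_def)
qed

lemma image_submodule:
  fixes V :: "('k::alg_closed_field, 'v::ab_group_add) gmod" and W :: "('k, 'w::ab_group_add) gmod"
  assumes V: "rational_module V" and W: "rational_module W" and \<phi>: "\<phi> \<in> gHom V W"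
  shows "submodule_of W (\<phi> ` gspace V)"
proof -
  interpret rational_hom V W \<phi> by unfold_locales fact+
  show ?thesis
    unfolding submodule_of_def W.subspace_def
  proof (intro conjI subsetI ballI allI)
    show "0 \<in> \<phi> ` gspace V" by (metis V.zero_in hom_zero image_eqI)
  qed (auto simp: hom_in V.add_in V.scale_in V.act_in simp flip: hom_add hom_scale hom_act)
qed

locale universe = vector_space sc for sc :: "'k::alg_closed_field \<Rightarrow> 'v::ab_group_add \<Rightarrow> 'v" +
  assumes inf: "\<not> (\<exists>B. finite B \<and> span B = UNIV)"
begin

text \<open>The invariant kept along a resolution: countable dimension for the fixed scalar
  multiplication lets the next coinduced module and the next quotient be copied into
  \<open>'v\<close>.\<close>

definition good :: "('k, 'v) gmod \<Rightarrow> bool" where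
  "good Z \<longleftrightarrow> rational_module Z \<and> gscale Z = sc \<and> countable_span sc (gspace Z)"

lemma coinduced_copy:
  fixes Z :: "('k, 'w::ab_group_add) gmod"
  assumes Z: "rational_module Z" and cs: "countable_span (gscale Z) (gspace Z)"
  obtains Q \<tau> where "good Q" "\<tau> \<in> gHom (coind (gscale Z) (gspace Z)) Q"
    "\<tau> ` gspace (coind (gscale Z) (gspace Z)) = gspace Q"
    "\<And>x. x \<in> gspace (coind (gscale Z) (gspace Z)) \<Longrightarrow> \<tau> x = 0 \<Longrightarrow> x = 0"
proof -
  interpret Z: rational Z by standard fact
  interpret C: coinduction "gscale Z" "gspace Z" by unfold_locales (rule Z.sub)
  obtain Q \<tau> where "rational_module Q" "gscale Q = sc" "countable_span sc (gspace Q)"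
    "\<tau> \<in> gHom C.A Q" "\<tau> ` gspace C.A = gspace Q" "\<And>x. x \<in> gspace C.A \<Longrightarrow> \<tau> x = 0 \<longleftrightarrow> x \<in> {0}"
    by (rule exists_quotient_module[OF C.rational_coind zero_submodule[OF C.rational_coind]
          C.countable_coind[OF cs] vector_space_axioms inf]) blast
  then show ?thesis using that[of Q \<tau>] by (simp add: good_def)
qed

lemma frob_id_hom:
  fixes Z :: "('k, 'w::ab_group_add) gmod"
  assumes Z: "rational_module Z"
  shows "frob Z (\<lambda>v. v) \<in> gHom Z (coind (gscale Z) (gspace Z))"
proof -
  interpret Z: rational Z by standard fact
  interpret C: coinduction "gscale Z" "gspace Z" by unfold_locales (rule Z.sub)
  show ?thesis by (rule C.frob_hom[OF Z]) (auto simp: lin_on_def)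
qed

lemma frob_id_one: "rational_module Z \<Longrightarrow> v \<in> gspace Z \<Longrightarrow> frob Z (\<lambda>v. v) v (mat 1) = v"
  by (simp add: frob_def rational_module_def)

text \<open>\<open>I\<close> is a copy of the module coinduced from the underlying space of
  \<open>Z\<close>, and \<open>Z'\<close> is the cokernel of the embedding, which is injective by
  evaluation at the identity.\<close>

lemma resolution_step:
  assumes Z: "good Z"
  obtains I :: "('k, 'v) gmod" and \<epsilon> \<pi> Z' where "injective_module I" "\<epsilon> \<in> gHom Z I" "inj_on \<epsilon> (gspace Z)"
    "good Z'" "\<pi> \<in> gHom I Z'" "\<pi> ` gspace I = gspace Z'"
    "{x \<in> gspace I. \<pi> x = 0} = \<epsilon> ` gspace Z"
proof -
  have ratZ: "rational_module Z" and scZ: "gscale Z = sc" and cZ: "countable_span sc (gspace Z)"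
    using Z by (auto simp: good_def)
  interpret Z: rational Z by standard fact
  interpret C: coinduction "gscale Z" "gspace Z" by unfold_locales (rule Z.sub)
  obtain I \<tau> where I: "good I" and \<tau>: "\<tau> \<in> gHom C.A I" "\<tau> ` gspace C.A = gspace I"
    "\<And>x. x \<in> gspace C.A \<Longrightarrow> \<tau> x = 0 \<Longrightarrow> x = 0"
    by (rule coinduced_copy[OF ratZ]) (use cZ scZ in auto)
  have ratI: "rational_module I" using I by (simp add: good_def)
  interpret \<tau>: rational_hom C.A I \<tau>
    by unfold_locales (rule C.rational_coind ratI \<tau>(1))+
  note fr = frob_id_hom[OF ratZ]
  define \<epsilon> where "\<epsilon> = \<tau> \<circ> frob Z (\<lambda>v. v)"
  have \<epsilon>: "\<epsilon> \<in> gHom Z I"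
    unfolding \<epsilon>_def by (rule gHom_comp[OF fr \<tau>(1)]) simp
  interpret \<epsilon>: rational_hom Z I \<epsilon> by unfold_locales (rule \<epsilon>)
  have ker: "v = 0" if v: "v \<in> gspace Z" "\<epsilon> v = 0" for v
  proof -
    have "frob Z (\<lambda>v. v) v = 0" using \<tau>(3) v gHomD(1)[OF fr] by (simp add: \<epsilon>_def)
    then have "frob Z (\<lambda>v. v) v (mat 1) = 0" by simp
    then show ?thesis using frob_id_one[OF ratZ v(1)] by simp
  qed
  have inj: "inj_on \<epsilon> (gspace Z)" by (rule \<epsilon>.inj_on_if_kernel_zero[OF ker])
  have "countable_span (gscale I) (gspace I)" using I by (simp add: good_def)
  then obtain Z' \<pi> where "rational_module Z'" "gscale Z' = sc" "countable_span sc (gspace Z')"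
    "\<pi> \<in> gHom I Z'" "\<pi> ` gspace I = gspace Z'" "\<And>x. x \<in> gspace I \<Longrightarrow> \<pi> x = 0 \<longleftrightarrow> x \<in> \<epsilon> ` gspace Z"
    by (rule exists_quotient_module[OF ratI image_submodule[OF ratZ ratI \<epsilon>] _ vector_space_axioms inf]) blast+
  moreover have "injective_module I"
    by (rule C.injective_copy[OF ratI \<tau>])
  ultimately show ?thesis
    using that[of I \<epsilon> Z' \<pi>] \<epsilon> inj \<epsilon>.hom_in by (auto simp: good_def)
qed

lemma exists_injective_resolution:
  fixes V :: "('k, 'w::ab_group_add) gmod"
  assumes V: "rational_module V" and cs: "countable_span (gscale V) (gspace V)"
  shows "\<exists>(I :: nat \<Rightarrow> ('k, 'v) gmod) \<epsilon> d. injective_resolution V I \<epsilon> d"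
proof -
  \<comment> \<open>\<open>V\<close> lives in another type and is first copied into the
    universe.\<close>
  obtain Z0 \<iota> where Z0: "rational_module Z0" "gscale Z0 = sc" "countable_span sc (gspace Z0)"
    and \<iota>: "\<iota> \<in> gHom V Z0" "\<iota> ` gspace V = gspace Z0" "\<And>x. x \<in> gspace V \<Longrightarrow> \<iota> x = 0 \<longleftrightarrow> x \<in> {0}"
    by (rule exists_quotient_module[OF V zero_submodule[OF V] cs vector_space_axioms inf]) blast
  interpret \<iota>: rational_hom V Z0 \<iota> by unfold_locales (rule V Z0 \<iota>)+
  define R where "R Z x = (case x of (I, \<epsilon>, \<pi>, Z') \<Rightarrow>
    injective_module I \<and> \<epsilon> \<in> gHom Z I \<and> inj_on \<epsilon> (gspace Z) \<and>
    good Z' \<and> \<pi> \<in> gHom I Z' \<and> \<pi> ` gspace I = gspace Z' \<and>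
    {x \<in> gspace I. \<pi> x = 0} = \<epsilon> ` gspace Z)"
    for Z :: "('k, 'v) gmod" and x :: "('k, 'v) gmod \<times> ('v \<Rightarrow> 'v) \<times> ('v \<Rightarrow> 'v) \<times> ('k, 'v) gmod"
  define f where "f Z = (SOME x. R Z x)" for Z
  have f: "R Z (f Z)" if "good Z" for Z
    unfolding f_def
    by (rule resolution_step[OF that], rule_tac x = "(I, \<epsilon>, \<pi>, Z')" in someI) (simp add: R_def)
  \<comment> \<open>\<open>Z n\<close> is the n-th cosyzygy; composing \<open>p n\<close> with the
    embedding \<open>e (Suc n)\<close> gives the differential.\<close>
  define Z where "Z = rec_nat Z0 (\<lambda>_ Z. snd (snd (snd (f Z))))"
  define I where "I n = fst (f (Z n))" for n
  define e where "e n = fst (snd (f (Z n)))" for n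
  define p where "p n = fst (snd (snd (f (Z n))))" for n
  have ZS: "Z (Suc n) = snd (snd (snd (f (Z n))))" for n by (simp add: Z_def)
  have good: "good (Z n)" for n
  proof (induction n)
    case 0
    then show ?case using Z0 by (simp add: Z_def good_def)
  next
    case (Suc n)
    then show ?case using f[OF Suc] by (simp add: ZS R_def case_prod_beta)
  qed
  have I: "injective_module (I n)" and e: "e n \<in> gHom (Z n) (I n)" "inj_on (e n) (gspace (Z n))"
    and p: "p n \<in> gHom (I n) (Z (Suc n))" "p n ` gspace (I n) = gspace (Z (Suc n))"
    and ex: "{x \<in> gspace (I n). p n x = 0} = e n ` gspace (Z n)" for n
    using f[OF good[of n]] by (simp_all add: ZS R_def case_prod_beta I_def e_def p_def)
  have rat: "rational_module (Z n)" "rational_module (I n)" for n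
    using good[of n] I[of n] by (simp_all add: good_def injective_module_def)
  have e0: "e n 0 = 0" for n
  proof -
    interpret en: rational_hom "Z n" "I n" "e n" by unfold_locales (rule rat e)+
    show ?thesis by simp
  qed
  have enz: "e n x = 0 \<longleftrightarrow> x = 0" if x: "x \<in> gspace (Z n)" for n x
  proof -
    interpret Zn: rational "Z n" by unfold_locales (rule rat)
    show ?thesis using inj_onD[OF e(2), of n x 0] e0[of n] x by auto
  qed
  have Z0': "Z 0 = Z0" by (simp add: Z_def)
  have inj\<iota>: "inj_on \<iota> (gspace V)" by (rule \<iota>.inj_on_if_kernel_zero) (simp add: \<iota>(3))
  have "injective_resolution V I (e 0 \<circ> \<iota>) (\<lambda>n. e (Suc n) \<circ> p n)"
    unfolding injective_resolution_def
  proof (intro conjI allI)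
    show "injective_module (I n)" for n by (rule I)
    show "e 0 \<circ> \<iota> \<in> gHom V (I 0)"
      by (rule gHom_comp[OF \<iota>(1)]) (use e(1)[of 0] e0[of 0] Z0' in simp_all)
    show "e (Suc n) \<circ> p n \<in> gHom (I n) (I (Suc n))" for n
      by (intro gHom_comp[where W = "Z (Suc n)"] p(1) e(1) e0)
    show "inj_on (e 0 \<circ> \<iota>) (gspace V)"
      by (rule comp_inj_on[OF inj\<iota>]) (use e(2)[of 0] Z0' \<iota>(2) in simp)
    have ker: "{x \<in> gspace (I n). (e (Suc n) \<circ> p n) x = 0} = e n ` gspace (Z n)" for n
      using ex[of n] enz[of _ "Suc n"] gHomD(1)[OF p(1)[of n]] by auto
    show "(e 0 \<circ> \<iota>) ` gspace V = {x \<in> gspace (I 0). (e (Suc 0) \<circ> p 0) x = 0}"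
      unfolding ker image_comp[symmetric] \<iota>(2) Z0' ..
    show "(e (Suc n) \<circ> p n) ` gspace (I n) = {x \<in> gspace (I (Suc n)). (e (Suc (Suc n)) \<circ> p (Suc n)) x = 0}" for n
      unfolding ker image_comp[symmetric] p(2) ..
  qed
  then show ?thesis by blast
qed

text \<open>
  A cocycle with values in an injective module takes values in a finite-dimensional submodule \<open>W\<close>;
  it becomes a coboundary in the module coinduced from \<open>W\<close>, of which \<open>W\<close> is a submodule, and
  injectivity pushes the primitive back.
\<close>

lemma injective_acyclic:
  fixes I :: "('k, 'v) gmod"
  assumes I: "injective_module I" and char2: "CHAR('k) = 2"
  shows "acyclic_module I"
  unfolding acyclic_module_def
proof (intro allI subsetI)
  fix t F assume F: "F \<in> cocycles I (Suc t)"
  have ratI: "rational_module I" using I by (simp add: injective_module_def)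
  interpret I: rational I by standard fact
  have Fc: "F \<in> cochains I (Suc t)" and dF: "\<And>M. dK I F M = 0" using F by (auto simp: cocycles_def)
  note FD = I.cochainsD[OF Fc]
  define X where "X = F ` {M. F M \<noteq> 0}"
  have X: "finite X" "X \<subseteq> gspace I" using FD by (auto simp: X_def)
  \<comment> \<open>The submodule generated by the values of the cocycle. Rationality bounds each
    orbit by a finite span, so its dimension is finite whatever the size of
    \<open>I\<close>.\<close>
  define W where "W = I.span {gact I g v | g v. g \<in> SL2 \<and> v \<in> X}"
  have WI: "W \<subseteq> gspace I"
    unfolding W_def by (rule I.span_minimal) (use X I.act_in I.sub in auto)
  have "v \<in> gspace I \<and> gact I g v \<in> W" if g: "g \<in> SL2" and v: "v \<in> W" for g v
    using v unfolding W_def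
  proof (induction rule: I.span_induct_alt)
    case base
    then show ?case using g by (simp add: I.span_zero)
  next
    case (step c x y)
    then obtain h v where h: "x = gact I h v" "h \<in> SL2" "v \<in> X" by blast
    have y: "y \<in> gspace I" using step by blast
    have v: "v \<in> gspace I" using h X by blast
    have "gact I g (gscale I c x + y) = gscale I c (gact I (g ** h) v) + gact I g y"
      using g h v y by (simp add: I.act_add I.act_scale I.scale_in I.act_in I.act_mult)
    also have "\<dots> \<in> I.span {gact I g v | g v. g \<in> SL2 \<and> v \<in> X}"
    proof (rule I.span_add[OF I.span_scale[OF I.span_base]])
      show "gact I (g ** h) v \<in> {gact I g v | g v. g \<in> SL2 \<and> v \<in> X}"
        using g h SL2_mult by blast
    qed (use step in blast)
    finally show ?case using h v y by (simp add: I.add_in I.scale_in I.act_in)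
  qed
  then have actW: "gact I g v \<in> W" if "g \<in> SL2" "v \<in> W" for g v using that by blast
  have subW: "I.subspace W" by (simp add: W_def)
  have XW: "x \<in> W" if "x \<in> X" for x
    unfolding W_def by (rule I.span_base) (use that X I.act_one in \<open>force intro!: exI[of _ "mat 1"]\<close>)
  have FW: "F M \<in> W" for M
    using XW I.subspace_0[OF subW] by (cases "F M = 0") (auto simp: X_def)
  have "\<exists>C. finite C \<and> (\<forall>g\<in>SL2. gact I g v \<in> I.span C)" if v: "v \<in> X" for v
  proof -
    have "v \<in> gspace I" using v X by blast
    then obtain n :: nat and f w where f: "\<And>g. g \<in> SL2 \<Longrightarrow> gact I g v = (\<Sum>i<n. gscale I (f i g) (w i))"
      using I.orbit by metis
    have "gact I g v \<in> I.span (w ` {..<n})" if "g \<in> SL2" for g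
      unfolding f[OF that] by (rule I.span_sum, rule I.span_scale, rule I.span_base) simp
    then show ?thesis
      by (intro exI[of _ "w ` {..<n}"]) simp
  qed
  then obtain C where C: "\<And>v. v \<in> X \<Longrightarrow> finite (C v)" "\<And>v g. v \<in> X \<Longrightarrow> g \<in> SL2 \<Longrightarrow> gact I g v \<in> I.span (C v)"
    by metis
  have "{gact I g v | g v. g \<in> SL2 \<and> v \<in> X} \<subseteq> I.span (\<Union>v\<in>X. C v)"
  proof
    fix x assume "x \<in> {gact I g v | g v. g \<in> SL2 \<and> v \<in> X}"
    then obtain g v where "x = gact I g v" "g \<in> SL2" "v \<in> X" by blast
    then have "x \<in> I.span (C v)" "C v \<subseteq> (\<Union>v\<in>X. C v)" using C(2) by blast+
    then show "x \<in> I.span (\<Union>v\<in>X. C v)" using I.span_mono by blast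
  qed
  then have "W \<subseteq> I.span (\<Union>v\<in>X. C v)"
    unfolding W_def by (rule I.span_minimal) simp
  moreover have "finite (\<Union>v\<in>X. C v)" using X C by blast
  ultimately have cW: "countable_span (gscale I) W"
    unfolding countable_span_def using countable_finite by blast
  define U where "U = I\<lparr>gspace := W\<rparr>"
  have U: "gspace U = W" "gscale U = gscale I" "gact U = gact I" by (simp_all add: U_def)
  have subU: "submodule_of I W" using WI subW actW by (simp add: submodule_of_def)
  have ratU: "rational_module U" unfolding U_def by (rule rational_submodule[OF ratI subU])
  interpret U: rational U by standard fact
  interpret C: coinduction2 "gscale U" "gspace U"
    by unfold_locales (rule U.sub, rule char2)
  obtain Q \<tau> where Q: "good Q" and \<tau>: "\<tau> \<in> gHom C.A Q" "\<tau> ` gspace C.A = gspace Q"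
    "\<And>x. x \<in> gspace C.A \<Longrightarrow> \<tau> x = 0 \<Longrightarrow> x = 0"
    by (rule coinduced_copy[OF ratU]) (use cW U in auto)
  have ratQ: "rational_module Q" using Q by (simp add: good_def)
  interpret \<tau>: rational_hom C.A Q \<tau>
    by unfold_locales (rule ratQ \<tau>(1))+
  define \<epsilon> where "\<epsilon> = frob U (\<lambda>v. v)"
  have \<epsilon>: "\<epsilon> \<in> gHom U C.A" unfolding \<epsilon>_def by (rule frob_id_hom[OF ratU])
  interpret \<epsilon>: rational_hom U C.A \<epsilon> by unfold_locales (rule \<epsilon>)
  have \<epsilon>1: "\<epsilon> w (mat 1) = w" if "w \<in> W" for w
    unfolding \<epsilon>_def by (rule frob_id_one[OF ratU]) (simp add: U that)
  have \<tau>\<epsilon>: "\<tau> \<circ> \<epsilon> \<in> gHom U Q" by (rule gHom_comp[OF \<epsilon> \<tau>(1)]) simp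
  \<comment> \<open>A copy of \<open>W\<close> inside the universe: injectivity of \<open>I\<close>
    extends the inverse map from \<open>S\<close> back to \<open>W\<close>, followed by inclusion,
    to all of \<open>Q\<close>.\<close>
  define S where "S = (\<tau> \<circ> \<epsilon>) ` W"
  have subS: "submodule_of Q S"
    using image_submodule[OF ratU ratQ \<tau>\<epsilon>] by (simp add: S_def U)
  interpret \<tau>\<epsilon>: rational_hom U Q "\<tau> \<circ> \<epsilon>" by unfold_locales (rule \<tau>\<epsilon>)
  have "inj_on (\<tau> \<circ> \<epsilon>) (gspace U)"
  proof (rule \<tau>\<epsilon>.inj_on_if_kernel_zero)
    fix w assume w: "w \<in> gspace U" "(\<tau> \<circ> \<epsilon>) w = 0"
    then have "\<epsilon> w = 0" using \<tau>(3)[OF \<epsilon>.hom_in[OF w(1)]] by simp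
    then show "w = 0" using \<epsilon>1[of w] w(1) by (simp add: U)
  qed
  then obtain \<phi> where "\<phi> \<in> gHom (Q\<lparr>gspace := (\<tau> \<circ> \<epsilon>) ` gspace U\<rparr>) U"
    and \<phi>: "\<And>w. w \<in> W \<Longrightarrow> \<phi> ((\<tau> \<circ> \<epsilon>) w) = w"
    by (rule \<tau>\<epsilon>.inverse_hom) (simp add: U)
  then have "\<phi> \<in> gHom (Q\<lparr>gspace := S\<rparr>) I"
    using WI by (auto simp: gHom_def U S_def)
  then obtain \<psi> where \<psi>: "\<psi> \<in> gHom Q I" "\<And>y. y \<in> S \<Longrightarrow> \<psi> y = \<phi> y"
    using I ratQ subS unfolding injective_module_def by blast
  interpret \<psi>: rational_hom Q I \<psi> by unfold_locales (rule \<psi>)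
  have FU: "F \<in> cochains U (Suc t)"
    using Fc FW by (auto simp: cochains_def wsp_def U)
  \<comment> \<open>Divided powers depend only on scalars and action, so restriction to the
    submodule does not change the differential.\<close>
  have "dK U F M = dK I F M" for M by (simp add: dK_def gE_def U)
  then have "(\<lambda>M. \<epsilon> (F M)) \<in> cocycles C.A (Suc t)"
    using \<epsilon>.comp_cochains[OF FU] \<epsilon>.comp_dK[OF FU] dF by (simp add: cocycles_def)
  then obtain G where G: "G \<in> cochains C.A t" "(\<lambda>M. \<epsilon> (F M)) = dK C.A G"
    using C.acyclic_coind unfolding acyclic_module_def by blast
  define H where "H M = \<psi> (\<tau> (G M))" for M
  have \<tau>G: "(\<lambda>M. \<tau> (G M)) \<in> cochains Q t" by (rule \<tau>.comp_cochains[OF G(1)])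
  have H: "H \<in> cochains I t"
    using \<psi>.comp_cochains[OF \<tau>G] by (simp add: H_def[abs_def])
  have "F M = dK I H M" for M
  proof -
    have "dK I H M = \<psi> (dK Q (\<lambda>M. \<tau> (G M)) M)"
      using \<psi>.comp_dK[OF \<tau>G] by (simp add: H_def[abs_def])
    also have "\<dots> = \<psi> (\<tau> (dK C.A G M))" by (simp only: \<tau>.comp_dK[OF G(1)])
    also have "dK C.A G M = \<epsilon> (F M)" using G(2) by (simp add: fun_eq_iff)
    also have "\<psi> (\<tau> (\<epsilon> (F M))) = F M"
      using \<psi>(2)[of "\<tau> (\<epsilon> (F M))"] \<phi>[OF FW] FW by (simp add: S_def)
    finally show ?thesis by simp
  qed
  then show "F \<in> dK I ` cochains I t" using H by blast
qed

end

section \<open>Dimension shifting\<close>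

text \<open>\<open>R\<close> is a linear correspondence that induces an isomorphism of the
  quotients. A relation is used because connecting maps involve choices and are functions only
  modulo boundaries.\<close>

lemma quotient_has_dim_transfer:
  fixes s1 :: "'k::field \<Rightarrow> 'a::ab_group_add \<Rightarrow> 'a" and s2 :: "'k \<Rightarrow> 'b::ab_group_add \<Rightarrow> 'b"
  assumes vs: "vector_space s1" "vector_space s2"
    and Z: "module.subspace s1 Z" "module.subspace s2 Z'" and B0: "0 \<in> B"
    and add: "\<And>x x' y y'. x \<in> Z \<Longrightarrow> x' \<in> Z \<Longrightarrow> y \<in> Z' \<Longrightarrow> y' \<in> Z' \<Longrightarrow> R x y \<Longrightarrow> R x' y' \<Longrightarrow> R (x + x') (y + y')"
    and scale: "\<And>c x y. x \<in> Z \<Longrightarrow> y \<in> Z' \<Longrightarrow> R x y \<Longrightarrow> R (s1 c x) (s2 c y)"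
    and tot1: "\<And>x. x \<in> Z \<Longrightarrow> \<exists>y\<in>Z'. R x y" and tot2: "\<And>y. y \<in> Z' \<Longrightarrow> \<exists>x\<in>Z. R x y"
    and B: "\<And>x y. x \<in> Z \<Longrightarrow> y \<in> Z' \<Longrightarrow> R x y \<Longrightarrow> x \<in> B \<longleftrightarrow> y \<in> B'"
    and dim: "quotient_has_dim s1 Z B N"
  shows "quotient_has_dim s2 Z' B' N"
proof -
  interpret s1: vector_space s1 by fact
  interpret s2: vector_space s2 by fact
  obtain S where S: "finite S" "card S = N" "S \<subseteq> Z"
    and ind: "\<And>c. (\<Sum>x\<in>S. s1 (c x) x) \<in> B \<Longrightarrow> \<forall>x\<in>S. c x = 0"
    and gen: "\<And>z. z \<in> Z \<Longrightarrow> \<exists>c. z - (\<Sum>x\<in>S. s1 (c x) x) \<in> B"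
    using dim unfolding quotient_has_dim_def by blast
  obtain r where r: "\<And>x. x \<in> Z \<Longrightarrow> r x \<in> Z'" "\<And>x. x \<in> Z \<Longrightarrow> R x (r x)"
    using tot1 by metis
  have zero: "R 0 0"
  proof -
    have "0 \<in> Z" using Z(1) by (rule s1.subspace_0)
    then have "R (s1 0 0) (s2 0 (r 0))" by (intro scale r)
    then show ?thesis by simp
  qed
  have Rsum: "(\<Sum>x\<in>T. s1 (c x) x) \<in> Z \<and> (\<Sum>x\<in>T. s2 (c x) (r x)) \<in> Z' \<and>
      R (\<Sum>x\<in>T. s1 (c x) x) (\<Sum>x\<in>T. s2 (c x) (r x))" if "finite T" "T \<subseteq> Z" for T c
    using that
  proof (induction T)
    case empty
    then show ?case using zero s1.subspace_0[OF Z(1)] s2.subspace_0[OF Z(2)] by simp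
  next
    case (insert a T)
    then have a: "a \<in> Z" and IH: "(\<Sum>x\<in>T. s1 (c x) x) \<in> Z" "(\<Sum>x\<in>T. s2 (c x) (r x)) \<in> Z'"
      "R (\<Sum>x\<in>T. s1 (c x) x) (\<Sum>x\<in>T. s2 (c x) (r x))" by auto
    have "s1 (c a) a \<in> Z" "s2 (c a) (r a) \<in> Z'" "R (s1 (c a) a) (s2 (c a) (r a))"
      using a r by (auto intro: s1.subspace_scale[OF Z(1)] s2.subspace_scale[OF Z(2)] scale)
    then show ?case
      using insert.hyps IH by (auto intro: s1.subspace_add[OF Z(1)] s2.subspace_add[OF Z(2)] add)
  qed
  have Rdiff: "R (x - x') (y - y')" if "x \<in> Z" "x' \<in> Z" "y \<in> Z'" "y' \<in> Z'" "R x y" "R x' y'" for x x' y y'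
  proof -
    have "R (x + s1 (-1) x') (y + s2 (-1) y')"
      using that by (intro add scale s1.subspace_scale[OF Z(1)] s2.subspace_scale[OF Z(2)])
    then show ?thesis by simp
  qed
  \<comment> \<open>Basis representatives with the same image under \<open>r\<close> would differ by
    an element of \<open>B\<close>, against independence; so their number is preserved.\<close>
  have inj: "inj_on r S"
  proof (rule inj_onI, rule ccontr)
    fix x y assume xy: "x \<in> S" "y \<in> S" "r x = r y" "x \<noteq> y"
    have "x \<in> Z" "y \<in> Z" using xy S(3) by auto
    then have "R (x - y) (r x - r y)"
      by (intro Rdiff r)
    then have "R (x - y) 0" using xy(3) by simp
    moreover have "x - y \<in> Z" "0 \<in> Z" using xy S(3) s1.subspace_diff[OF Z(1)] s1.subspace_0[OF Z(1)] by auto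
    moreover have "0 \<in> Z'" using Z(2) by (rule s2.subspace_0)
    ultimately have "x - y \<in> B" using B[of "x - y" 0] B[of 0 0] zero B0 by blast
    define c where "c z = (if z = x then 1 else if z = y then -1 else 0 :: 'k)" for z
    have "(\<Sum>z\<in>S. s1 (c z) z) = (\<Sum>z\<in>{x, y}. s1 (c z) z)"
      by (rule sum.mono_neutral_right) (use S(1) xy in \<open>auto simp: c_def\<close>)
    also have "\<dots> = x - y" using xy by (simp add: c_def)
    finally have "c x = 0" using ind[of c] \<open>x - y \<in> B\<close> xy by simp
    then show False by (simp add: c_def)
  qed
  show ?thesis
    unfolding quotient_has_dim_def
  proof (intro exI[of _ "r ` S"] conjI allI impI ballI)
    show "finite (r ` S)" "card (r ` S) = N" "r ` S \<subseteq> Z'"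
      using S inj r by (auto simp: card_image)
  next
    fix c y assume c: "(\<Sum>y\<in>r ` S. s2 (c y) y) \<in> B'" and y: "y \<in> r ` S"
    have "(\<Sum>y\<in>r ` S. s2 (c y) y) = (\<Sum>x\<in>S. s2 (c (r x)) (r x))"
      using inj by (simp add: sum.reindex)
    then have "(\<Sum>x\<in>S. s1 (c (r x)) x) \<in> B"
      using c Rsum[OF S(1,3), of "\<lambda>x. c (r x)"] B by auto
    then show "c y = 0" using ind[of "\<lambda>x. c (r x)"] y by auto
  next
    fix z' assume z': "z' \<in> Z'"
    then obtain z where z: "z \<in> Z" "R z z'" using tot2 by blast
    then obtain c where c: "z - (\<Sum>x\<in>S. s1 (c x) x) \<in> B" using gen by blast
    note Rs = Rsum[OF S(1,3), of c]
    have "z' - (\<Sum>x\<in>S. s2 (c x) (r x)) \<in> B'"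
      using B[of "z - (\<Sum>x\<in>S. s1 (c x) x)" "z' - (\<Sum>x\<in>S. s2 (c x) (r x))"] c Rs z z'
        Rdiff[of z "\<Sum>x\<in>S. s1 (c x) x" z' "\<Sum>x\<in>S. s2 (c x) (r x)"]
        s1.subspace_diff[OF Z(1)] s2.subspace_diff[OF Z(2)] by blast
    moreover have "(\<Sum>y\<in>r ` S. s2 (c (inv_into S r y)) y) = (\<Sum>x\<in>S. s2 (c x) (r x))"
      using inj by (simp add: sum.reindex)
    ultimately show "\<exists>c. z' - (\<Sum>y\<in>r ` S. s2 (c y) y) \<in> B'"
      by (intro exI[of _ "\<lambda>y. c (inv_into S r y)"]) simp
  qed
qed

definition koszul_dim :: "('k::field, 'v::ab_group_add) gmod \<Rightarrow> nat \<Rightarrow> nat \<Rightarrow> bool" where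
  "koszul_dim V t N \<longleftrightarrow> quotient_has_dim (pw (gscale V)) (cocycles V t) (coboundaries V t) N"

context rational
begin

lemma cocycles_subspace: "module.subspace (pw (gscale V)) (cocycles V t)"
proof -
  interpret pw: vector_space "pw (gscale V) :: 'k \<Rightarrow> (nat multiset \<Rightarrow> 'v) \<Rightarrow> nat multiset \<Rightarrow> 'v"
    by (rule vector_space_pw) (rule vector_space_axioms)
  show ?thesis
    unfolding pw.subspace_def
    using dK_add[of _ t _ t] dK_scale[of _ t] cochains_add[of _ t] cochains_scale[of _ t] cochains_zero[of t]
    by (auto simp: cocycles_def zero_fun_def plus_fun_def) (simp add: dK_def)
qed

lemma zero_coboundary: "0 \<in> coboundaries V t"
proof (cases t)
  case (Suc i)
  have "dK V (\<lambda>M. 0) = 0" by (simp add: fun_eq_iff dK_def)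
  then show ?thesis
    using cochains_zero[of i] by (auto simp: coboundaries_def Suc image_iff intro!: bexI[of _ "\<lambda>M. 0"])
qed (simp add: coboundaries_def zero_fun_def)

end

text \<open>The connecting map of \<open>0 \<rightarrow> Z \<rightarrow> I \<rightarrow> Z'
  \<rightarrow> 0\<close>, where \<open>I\<close> is acyclic. The denominator is the image of the
  cocycles of \<open>I\<close>, because for \<open>t = 0\<close> the invariants of \<open>I\<close>
  need not vanish.\<close>

lemma dimension_shift:
  fixes Z :: "('k::alg_closed_field, 'u::ab_group_add) gmod" and I :: "('k, 'v::ab_group_add) gmod"
    and Z' :: "('k, 'w::ab_group_add) gmod"
  assumes char2: "CHAR('k) = 2" and Z: "rational_module Z"
    and I: "rational_module I" "acyclic_module I" and Z': "rational_module Z'"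
    and i: "i \<in> gHom Z I" "inj_on i (gspace Z)" and ex: "i ` gspace Z = {x \<in> gspace I. p x = 0}"
    and p: "p \<in> gHom I Z'" "p ` gspace I = gspace Z'"
    and dim: "koszul_dim Z (Suc t) N"
  shows "quotient_has_dim (pw (gscale Z')) (cocycles Z' t) ((\<lambda>h M. p (h M)) ` cocycles I t) N"
proof -
  interpret i: rational_hom Z I i by unfold_locales (rule Z I i)+
  interpret p: rational_hom I Z' p by unfold_locales (rule Z' p)+
  interpret I2: rational2 I by unfold_locales (rule char2)
  have eqI: "f M = g M" if "f \<in> cochains Z u" "g \<in> cochains Z u" "i (f M) = i (g M)" for f g u M
    using inj_onD[OF i(2) that(3)] i.V.cochainsD(2) that(1,2) by blast
  have lift: "\<exists>g\<in>cochains Z u. \<forall>M. i (g M) = f M" if f: "f \<in> cochains I u" "\<And>M. p (f M) = 0" for f u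
    by (rule i.lift_cochain[OF f(1)]) (use ex f(2) i.W.cochainsD(2)[OF f(1)] in auto)
  have pi: "p (i (f M)) = 0" if "f \<in> cochains Z u" for f u M
    using ex i.V.cochainsD(2)[OF that, of M] by blast
  have pK: "p (dK I h M) = dK Z' z M" if "h \<in> cochains I u" "\<And>M. p (h M) = z M" for h z u M
    using p.comp_dK[OF that(1), of M] that(2) by simp
  have iK: "i (dK Z g M) = dK I f M" if "g \<in> cochains Z u" "\<And>M. i (g M) = f M" for g f u M
    using i.comp_dK[OF that(1), of M] that(2) by simp
  \<comment> \<open>The zigzag of the snake lemma: \<open>z\<close> is lifted to \<open>h\<close> in
    \<open>I\<close>, and the differential of \<open>h\<close> comes from \<open>f\<close>.\<close>
  define R where "R f z = (\<exists>h\<in>cochains I t. (\<forall>M. p (h M) = z M) \<and> (\<forall>M. dK I h M = i (f M)))" for f z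
  show ?thesis
  proof (rule quotient_has_dim_transfer[where R = R])
    show "quotient_has_dim (pw (gscale Z)) (cocycles Z (Suc t)) (coboundaries Z (Suc t)) N"
      using dim by (simp add: koszul_dim_def)
    show "\<exists>z\<in>cocycles Z' t. R f z" if f: "f \<in> cocycles Z (Suc t)" for f
    proof -
      have fc: "f \<in> cochains Z (Suc t)" using f by (simp add: cocycles_def)
      have "(\<lambda>M. i (f M)) \<in> cocycles I (Suc t)"
        using f i.comp_cochains[OF fc] i.comp_dK[OF fc] by (simp add: cocycles_def)
      then obtain h where h: "h \<in> cochains I t" "(\<lambda>M. i (f M)) = dK I h"
        using I(2) unfolding acyclic_module_def by blast
      have hM: "dK I h M = i (f M)" for M using h(2) by (simp add: fun_eq_iff)
      have "(\<lambda>M. p (h M)) \<in> cocycles Z' t"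
        using p.comp_cochains[OF h(1)] p.comp_dK[OF h(1)] hM pi[OF fc] by (simp add: cocycles_def)
      then show ?thesis
        unfolding R_def using h(1) hM by (intro bexI[of _ "\<lambda>M. p (h M)"] bexI[of _ h]) simp_all
    qed
    show "\<exists>f\<in>cocycles Z (Suc t). R f z" if z: "z \<in> cocycles Z' t" for z
    proof -
      have zc: "z \<in> cochains Z' t" "\<And>M. dK Z' z M = 0" using z by (auto simp: cocycles_def)
      obtain h where h: "h \<in> cochains I t" "\<And>M. p (h M) = z M"
        by (rule p.lift_cochain[OF zc(1)]) (use p.W.cochainsD(2)[OF zc(1)] p(2) in auto)
      have "\<And>M. p (dK I h M) = 0" using pK[OF h] zc(2) by simp
      then obtain f where f: "f \<in> cochains Z (Suc t)" "\<And>M. i (f M) = dK I h M"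
        using lift[OF i.W.dK_in[OF h(1)]] by blast
      have "i (dK Z f M) = 0" for M
        using iK[OF f, of M] I2.dK_dK[OF h(1)] by simp
      then have "dK Z f M = 0" for M
        using eqI[OF i.V.dK_in[OF f(1)] i.V.cochains_zero] by simp
      then have "f \<in> cocycles Z (Suc t)" using f(1) by (simp add: cocycles_def)
      then show ?thesis
        unfolding R_def using h f(2) by (intro bexI[of _ f] bexI[of _ h]) simp_all
    qed
    show "f \<in> coboundaries Z (Suc t) \<longleftrightarrow> z \<in> (\<lambda>h M. p (h M)) ` cocycles I t"
      if f: "f \<in> cocycles Z (Suc t)" and z: "z \<in> cocycles Z' t" and R: "R f z" for f z
    proof -
      have fc: "f \<in> cochains Z (Suc t)" using f by (simp add: cocycles_def)
      obtain h where h: "h \<in> cochains I t" "\<And>M. p (h M) = z M" "\<And>M. dK I h M = i (f M)"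
        using R by (auto simp: R_def)
      note hI = i.W.cochainsD(2)[OF h(1)]
      have "z \<in> (\<lambda>h M. p (h M)) ` cocycles I t" if g: "g \<in> cochains Z t" "f = dK Z g" for g
      proof (rule image_eqI)
        note ig = i.comp_cochains[OF g(1)]
        show "(\<lambda>M. h M - i (g M)) \<in> cocycles I t"
          using i.W.cochains_diff[OF h(1) ig] i.W.dK_diff[OF h(1) ig] i.comp_dK[OF g(1)] h(3) g(2)
          by (simp add: cocycles_def)
        show "z = (\<lambda>M. p (h M - i (g M)))"
          using h(2) pi[OF g(1)] hI i.W.cochainsD(2)[OF ig] by (simp add: fun_eq_iff p.hom_diff)
      qed
      moreover have "f \<in> dK Z ` cochains Z t" if c: "c \<in> cocycles I t" "z = (\<lambda>M. p (c M))" for c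
      proof -
        have cc: "c \<in> cochains I t" "\<And>M. dK I c M = 0" using c by (auto simp: cocycles_def)
        have "p (h M - c M) = 0" for M
          using h(2) c(2) hI i.W.cochainsD(2)[OF cc(1)] by (simp add: p.hom_diff)
        then obtain g where g: "g \<in> cochains Z t" "\<And>M. i (g M) = h M - c M"
          using lift[OF i.W.cochains_diff[OF h(1) cc(1)]] by blast
        have "i (f M) = i (dK Z g M)" for M
          using iK[OF g, of M] i.W.dK_diff[OF h(1) cc(1)] h(3) cc(2) by simp
        then have "f = dK Z g" using eqI[OF fc i.V.dK_in[OF g(1)]] by blast
        then show ?thesis using g(1) by blast
      qed
      ultimately show ?thesis by (auto simp: coboundaries_def)
    qed
  next
    fix f f' z z' assume f: "f \<in> cocycles Z (Suc t)" "f' \<in> cocycles Z (Suc t)" and "R f z" "R f' z'"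
    then obtain h h' where h: "h \<in> cochains I t" "\<And>M. p (h M) = z M" "\<And>M. dK I h M = i (f M)"
      "h' \<in> cochains I t" "\<And>M. p (h' M) = z' M" "\<And>M. dK I h' M = i (f' M)"
      by (auto simp: R_def)
    have "f M \<in> gspace Z" "f' M \<in> gspace Z" for M
      using f by (auto simp: cocycles_def intro: i.V.cochainsD(2))
    then show "R (f + f') (z + z')"
      unfolding R_def using h i.W.cochainsD(2)
      by (intro bexI[of _ "\<lambda>M. h M + h' M"]) (auto simp: i.W.dK_add p.hom_add i.hom_add i.W.cochains_add)
  next
    fix c f z assume f: "f \<in> cocycles Z (Suc t)" and "R f z"
    then obtain h where h: "h \<in> cochains I t" "\<And>M. p (h M) = z M" "\<And>M. dK I h M = i (f M)"
      by (auto simp: R_def)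
    have "f M \<in> gspace Z" for M
      using f by (auto simp: cocycles_def intro: i.V.cochainsD(2))
    then show "R (pw (gscale Z) c f) (pw (gscale Z') c z)"
      unfolding R_def using h i.W.cochainsD(2)
      by (intro bexI[of _ "\<lambda>M. gscale I c (h M)"])
        (auto simp: i.W.dK_scale p.hom_scale i.hom_scale i.W.cochains_scale)
  qed (intro vector_space_pw i.V.vector_space_axioms p.W.vector_space_axioms i.V.cocycles_subspace
      p.W.cocycles_subspace i.V.zero_coboundary)+
qed

text \<open>In positive degrees cocycles of \<open>I\<close> are coboundaries, and cochains of
  \<open>Z'\<close> lift to \<open>I\<close>. Hence the quotient produced by a shift is the
  cohomology of \<open>Z'\<close>, and shifting can continue.\<close>

lemma image_cocycles_eq_coboundaries:
  fixes I :: "('k::alg_closed_field, 'v::ab_group_add) gmod" and Z' :: "('k, 'w::ab_group_add) gmod"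
  assumes char2: "CHAR('k) = 2" and I: "rational_module I" "acyclic_module I" and Z': "rational_module Z'"
    and p: "p \<in> gHom I Z'" "p ` gspace I = gspace Z'"
  shows "(\<lambda>h M. p (h M)) ` cocycles I (Suc t) = coboundaries Z' (Suc t)"
proof -
  interpret rational_hom I Z' p by unfold_locales (rule I Z' p)+
  interpret I2: rational2 I by unfold_locales (rule char2)
  show ?thesis
  proof (intro equalityI subsetI)
    fix z assume "z \<in> (\<lambda>h M. p (h M)) ` cocycles I (Suc t)"
    then obtain h where "h \<in> cochains I t" "z = (\<lambda>M. p (dK I h M))"
      using I(2) by (auto simp: acyclic_module_def)
    then show "z \<in> coboundaries Z' (Suc t)"
      using comp_cochains comp_dK by (auto simp: coboundaries_def fun_eq_iff intro!: image_eqI)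
  next
    fix z assume "z \<in> coboundaries Z' (Suc t)"
    then obtain k where k: "k \<in> cochains Z' t" "z = dK Z' k" by (auto simp: coboundaries_def)
    obtain h where h: "h \<in> cochains I t" "\<And>M. p (h M) = k M"
      by (rule lift_cochain[OF k(1)]) (use W.cochainsD(2)[OF k(1)] p(2) in auto)
    have kh: "k = (\<lambda>M. p (h M))" using h by auto
    have "z M = p (dK I h M)" for M
      unfolding k(2) kh by (rule comp_dK[OF h(1)])
    then have "z = (\<lambda>M. p (dK I h M))" by blast
    then show "z \<in> (\<lambda>h M. p (h M)) ` cocycles I (Suc t)" using I2.dK_cocycle[OF h(1)] by blast
  qed
qed

section \<open>Rational cohomology as cohomology of the Koszul complex\<close>

context universe
begin

text \<open>Shifting along the cosyzygies ends in degree 0. There both complexes give the invariants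
  of a kernel modulo the image of the invariants of \<open>I n\<close>.\<close>

lemma koszul_dim_imp_Ext:
  fixes V :: "('k, 'w::ab_group_add) gmod" and I :: "nat \<Rightarrow> ('k, 'v) gmod"
  assumes char2: "CHAR('k) = 2" and V: "rational_module V" and res: "injective_resolution V I \<epsilon> d"
    and dim: "koszul_dim V (Suc n) N"
  shows "quotient_has_dim (\<lambda>c \<phi> x. gscale (I (Suc n)) c (\<phi> x))
    (Ext_cocycles trivial_module I d (Suc n)) (Ext_coboundaries trivial_module I d (Suc n)) N"
proof -
  have inj: "injective_module (I i)" and \<epsilon>: "\<epsilon> \<in> gHom V (I 0)" "inj_on \<epsilon> (gspace V)"
    "\<epsilon> ` gspace V = {x \<in> gspace (I 0). d 0 x = 0}"
    and d: "d i \<in> gHom (I i) (I (Suc i))"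
    and ex: "d i ` gspace (I i) = {x \<in> gspace (I (Suc i)). d (Suc i) x = 0}" for i
    using res by (auto simp: injective_resolution_def)
  have rat: "rational_module (I i)" for i using inj[of i] by (simp add: injective_module_def)
  have acy: "acyclic_module (I i)" for i by (rule injective_acyclic[OF inj char2])
  \<comment> \<open>The cosyzygies of the given resolution, as kernels inside its terms.\<close>
  define Z where "Z i = (I i)\<lparr>gspace := {x \<in> gspace (I i). d i x = 0}\<rparr>" for i
  have Zsel: "gspace (Z i) = {x \<in> gspace (I i). d i x = 0}" "gscale (Z i) = gscale (I i)"
    "gact (Z i) = gact (I i)" for i by (simp_all add: Z_def)
  have ratZ: "rational_module (Z i)" for i
  proof -
    interpret D: rational_hom "I i" "I (Suc i)" "d i" by unfold_locales (rule rat d)+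
    have "submodule_of (I i) {x \<in> gspace (I i). d i x = 0}"
      unfolding submodule_of_def D.V.subspace_def
      by (auto simp: D.V.add_in D.V.scale_in D.V.act_in D.hom_add D.hom_scale D.hom_act)
    then show ?thesis unfolding Z_def by (rule rational_submodule[OF rat])
  qed
  have dZ: "d i \<in> gHom (I i) (Z (Suc i))" "d i ` gspace (I i) = gspace (Z (Suc i))" for i
    using d[of i] ex[of i] by (auto simp: gHom_def Zsel)
  define \<iota> where "\<iota> i x = (if x \<in> gspace (Z i) then x else 0)" for i x
  have \<iota>: "\<iota> i \<in> gHom (Z i) (I i)" "inj_on (\<iota> i) (gspace (Z i))"
    "\<iota> i ` gspace (Z i) = {x \<in> gspace (I i). d i x = 0}" for i
  proof -
    interpret Zi: rational "Z i" by unfold_locales (rule ratZ)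
    show "\<iota> i \<in> gHom (Z i) (I i)"
      using Zi.add_in Zi.scale_in Zi.act_in by (auto simp: gHom_def \<iota>_def Zsel)
  qed (auto simp: \<iota>_def inj_on_def Zsel)
  note shift_step = dimension_shift[OF char2 _ rat acy ratZ _ _ _ dZ]
  \<comment> \<open>Each step trades one degree for one cosyzygy, so \<open>j\<close> has to vary in
    the induction.\<close>
  have shift: "koszul_dim (Z j) (Suc t) N \<Longrightarrow>
    quotient_has_dim (pw (gscale (I (Suc (j + t))))) (cocycles (Z (Suc (j + t))) 0)
      ((\<lambda>h M. d (j + t) (h M)) ` cocycles (I (j + t)) 0) N" for j t
  proof (induction t arbitrary: j)
    case 0
    then show ?case using shift_step[OF ratZ \<iota>, of j 0 N] by (simp add: Zsel)
  next
    case (Suc t)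
    then have "koszul_dim (Z (Suc j)) (Suc t) N"
      using shift_step[OF ratZ \<iota>, of j "Suc t" N] image_cocycles_eq_coboundaries[OF char2 rat acy ratZ dZ]
      by (simp add: koszul_dim_def)
    then show ?case using Suc.IH[of "Suc j"] by simp
  qed
  \<comment> \<open>The first shift starts at \<open>V\<close>, which lives in another type and is
    therefore kept out of the induction.\<close>
  have dim0: "quotient_has_dim (pw (gscale (I (Suc n)))) (cocycles (Z (Suc n)) 0)
      ((\<lambda>h M. d n (h M)) ` cocycles (I n) 0) N"
  proof (cases n)
    case 0
    then show ?thesis using shift_step[OF V \<epsilon>, of 0 N] dim by (simp add: Zsel)
  next
    case (Suc k)
    then have "koszul_dim (Z 1) (Suc k) N"
      using shift_step[OF V \<epsilon>, of "Suc k" N] image_cocycles_eq_coboundaries[OF char2 rat acy ratZ dZ, of 0 k] dim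
      by (simp add: koszul_dim_def)
    then show ?thesis using shift[of 1 k] Suc by simp
  qed
  interpret D: rational_hom "I n" "I (Suc n)" "d n" by unfold_locales (rule rat d)+
  interpret I2: rational2 "I n" by unfold_locales (rule char2)
  interpret Z2: rational2 "Z (Suc n)" by unfold_locales (rule ratZ, rule char2)
  have triv: "gspace trivial_module = (UNIV :: 'k set)" "gscale trivial_module = ((*) :: 'k \<Rightarrow> 'k \<Rightarrow> 'k)"
    "gact trivial_module g x = (x :: 'k)" for g x
    by (simp_all add: trivial_module_def)
  have from_triv: "(\<lambda>x. gscale X x v) \<in> gHom trivial_module X"
    if X: "rational_module X" and v: "v \<in> gspace X" "\<And>g. g \<in> SL2 \<Longrightarrow> gact X g v = v" for X :: "('k, 'v) gmod" and v
  proof -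
    interpret X: rational X by unfold_locales (rule X)
    show ?thesis
      using v by (auto simp: gHom_def triv X.scale_in X.scale_left_distrib X.act_scale)
  qed
  have triv_form: "\<phi> x = gscale X x (\<phi> 1)" "\<phi> 1 \<in> gspace X" "g \<in> SL2 \<Longrightarrow> gact X g (\<phi> 1) = \<phi> 1"
    if \<phi>: "\<phi> \<in> gHom trivial_module X" for X :: "('k, 'v) gmod" and \<phi> x g
  proof -
    have "\<phi> (x * 1) = gscale X x (\<phi> 1)"
      using gHomD(2)[OF \<phi>] unfolding lin_on_def triv by blast
    then show "\<phi> x = gscale X x (\<phi> 1)" by simp
    show "\<phi> 1 \<in> gspace X" by (rule gHomD(1)[OF \<phi>]) (simp add: triv)
    show "gact X g (\<phi> 1) = \<phi> 1" if "g \<in> SL2"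
      using gHomD(3)[OF \<phi> that, of 1] by (simp add: triv)
  qed
  have Ecoc: "Ext_cocycles trivial_module I d (Suc n) = gHom trivial_module (Z (Suc n))"
    by (auto simp: Ext_cocycles_def gHom_def triv Zsel)
  interpret pk: vector_space "(\<lambda>c \<phi> x. gscale (I (Suc n)) c (\<phi> x)) :: 'k \<Rightarrow> ('k \<Rightarrow> 'v) \<Rightarrow> 'k \<Rightarrow> 'v"
    by (rule vector_space_pw[OF D.W.vector_space_axioms])
  show ?thesis
    unfolding Ecoc
  \<comment> \<open>A cocycle of degree 0 is supported on the empty multiset, and a homomorphism
    from the trivial module is determined by its value at 1; both amount to an invariant
    vector.\<close>
  proof (rule quotient_has_dim_transfer[where R = "\<lambda>f \<phi>. f {#} = \<phi> 1"])
    show "quotient_has_dim (pw (gscale (I (Suc n)))) (cocycles (Z (Suc n)) 0)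
      ((\<lambda>h M. d n (h M)) ` cocycles (I n) 0) N" by (rule dim0)
    show "vector_space (pw (gscale (I (Suc n))) :: 'k \<Rightarrow> (nat multiset \<Rightarrow> 'v) \<Rightarrow> nat multiset \<Rightarrow> 'v)"
      by (rule vector_space_pw[OF D.W.vector_space_axioms])
    show "vector_space ((\<lambda>c \<phi> x. gscale (I (Suc n)) c (\<phi> x)) :: 'k \<Rightarrow> ('k \<Rightarrow> 'v) \<Rightarrow> 'k \<Rightarrow> 'v)" by (rule pk.vector_space_axioms)
    show "module.subspace (pw (gscale (I (Suc n)))) (cocycles (Z (Suc n)) 0)"
      using Z2.cocycles_subspace by (simp add: Zsel)
    show "pk.subspace (gHom trivial_module (Z (Suc n)))"
      unfolding pk.subspace_def
      using Z2.zero_in Z2.add_in Z2.scale_in Z2.act_add Z2.act_scale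
      by (auto simp: gHom_def triv Zsel[of "Suc n"] D.W.scale_right_distrib mult.commute add_ac)
    show "0 \<in> (\<lambda>h M. d n (h M)) ` cocycles (I n) 0"
      by (rule image_eqI[of _ _ "\<lambda>M. 0"]) (simp_all add: fun_eq_iff cocycles_def dK_def)
    show "\<exists>\<phi>\<in>gHom trivial_module (Z (Suc n)). f {#} = \<phi> 1" if f: "f \<in> cocycles (Z (Suc n)) 0" for f
    proof -
      have "f {#} \<in> gspace (Z (Suc n))" "\<And>g. g \<in> SL2 \<Longrightarrow> gact (Z (Suc n)) g (f {#}) = f {#}"
        using f unfolding Z2.cocycles_0_iff by blast+
      then show ?thesis
        by (intro bexI[OF _ from_triv[OF ratZ]]) simp_all
    qed
    show "\<exists>f\<in>cocycles (Z (Suc n)) 0. f {#} = \<phi> 1" if \<phi>: "\<phi> \<in> gHom trivial_module (Z (Suc n))" for \<phi>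
      using triv_form(2,3)[OF \<phi>] by (intro bexI[of _ "\<lambda>M. if M = {#} then \<phi> 1 else 0"]) (simp_all add: Z2.cocycles_0_iff)
    show "f \<in> (\<lambda>h M. d n (h M)) ` cocycles (I n) 0 \<longleftrightarrow> \<phi> \<in> Ext_coboundaries trivial_module I d (Suc n)"
      if f: "f \<in> cocycles (Z (Suc n)) 0" and \<phi>: "\<phi> \<in> gHom trivial_module (Z (Suc n))" and eq: "f {#} = \<phi> 1" for f \<phi>
    proof -
      have \<phi>x: "\<phi> x = gscale (I (Suc n)) x (\<phi> 1)" for x
        by (rule triv_form(1)[OF \<phi>, unfolded Zsel])
      have "\<phi> \<in> (\<lambda>\<phi>. d n \<circ> \<phi>) ` gHom trivial_module (I n)"
        if h: "h \<in> cocycles (I n) 0" "f = (\<lambda>M. d n (h M))" for h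
      proof (rule image_eqI)
        have v: "h {#} \<in> gspace (I n)" "\<And>g. g \<in> SL2 \<Longrightarrow> gact (I n) g (h {#}) = h {#}"
          using h(1) unfolding I2.cocycles_0_iff by blast+
        then show "(\<lambda>x. gscale (I n) x (h {#})) \<in> gHom trivial_module (I n)" by (intro from_triv rat)
        show "\<phi> = d n \<circ> (\<lambda>x. gscale (I n) x (h {#}))"
        proof
          fix x
          have "\<phi> x = gscale (I (Suc n)) x (d n (h {#}))"
            using eq h(2) by (subst \<phi>x) simp
          then show "\<phi> x = (d n \<circ> (\<lambda>x. gscale (I n) x (h {#}))) x"
            using v by (simp add: D.hom_scale)
        qed
      qed
      moreover have "f \<in> (\<lambda>h M. d n (h M)) ` cocycles (I n) 0"
        if \<psi>: "\<psi> \<in> gHom trivial_module (I n)" "\<phi> = d n \<circ> \<psi>" for \<psi>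
      proof (rule image_eqI)
        show "(\<lambda>M. if M = {#} then \<psi> 1 else 0) \<in> cocycles (I n) 0"
          using triv_form(2,3)[OF \<psi>(1)] by (simp add: I2.cocycles_0_iff)
        have "f M = d n (if M = {#} then \<psi> 1 else 0)" for M
          using f eq \<psi>(2) by (cases "M = {#}") (auto simp: Z2.cocycles_0_iff)
        then show "f = (\<lambda>M. d n (if M = {#} then \<psi> 1 else 0))" by blast
      qed
      ultimately show ?thesis by (auto simp: Ext_coboundaries_def)
    qed
  qed simp_all
qed

end

section \<open>The twisted natural module\<close>

lemma frobenius_power: "(frobenius ^^ m) g $ i $ j = (g $ i $ j :: 'k::field) ^ (CHAR('k) ^ m)"
  by (induction m) (simp_all add: frobenius_def mult.commute flip: power_mult)

lemma twist_sel [simp]: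
  "gspace (frobenius_twist m natural_module) = UNIV"
  "gscale (frobenius_twist m natural_module) = (*s)"
  "gact (frobenius_twist m natural_module) g v = (frobenius ^^ m) g *v v"
  by (simp_all add: frobenius_twist_def natural_module_def)

locale twisted_natural =
  fixes m :: nat and ty :: "'k::alg_closed_field itself"
  assumes char2: "CHAR('k) = 2"
begin

definition T :: "('k, 'k ^ 2) gmod" where "T = frobenius_twist m natural_module"

abbreviation q :: nat where "q \<equiv> 2 ^ m"

abbreviation e1 :: "'k \<Rightarrow> 'k ^ 2" where "e1 x \<equiv> vector [x, 0]"

lemma T_sel [simp]: "gspace T = UNIV" "gscale T = (*s)"
  "gact T g v $ 1 = g $ 1 $ 1 ^ q * v $ 1 + g $ 1 $ 2 ^ q * v $ 2"
  "gact T g v $ 2 = g $ 2 $ 1 ^ q * v $ 1 + g $ 2 $ 2 ^ q * v $ 2"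
  by (simp_all add: T_def matrix_vector_mult_def sum_2 frobenius_power char2)

lemma zero_power_q [simp]: "(0::'k) ^ q = 0"
  by (simp add: power_0_left)

lemma add_power_q: "(x + y :: 'k) ^ q = x ^ q + y ^ q"
  by (rule freshmans_dream'[where n = m]) (simp_all add: char2)

lemma rational_T: "rational_module T"
  unfolding rational_module_def
proof (intro conjI ballI allI impI)
  show "vector_space (gscale T)"
    by unfold_locales (simp_all add: vec_eq_iff algebra_simps)
  then interpret vector_space "gscale T" .
  show "subspace (gspace T)" by simp
  fix v assume "v \<in> gspace T"
  show "\<exists>(n::nat) f w. (\<forall>i<n. f i \<in> regular_functions \<and> w i \<in> gspace T) \<and>
      (\<forall>g\<in>SL2. gact T g v = (\<Sum>i<n. gscale T (f i g) (w i)))"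
  proof (intro exI conjI allI impI ballI)
    define f where "f i g = (if i = 0 then g $ 1 $ 1 ^ q * v $ 1 + g $ 1 $ 2 ^ q * v $ 2
      else g $ 2 $ 1 ^ q * v $ 1 + g $ 2 $ 2 ^ q * v $ 2)" for i :: nat and g :: "'k ^ 2 ^ 2"
    define w where "w i = (if i = 0 then vector [1, 0] else vector [0, 1] :: 'k ^ 2)" for i :: nat
    have "(\<lambda>g. g $ a $ 1 ^ q * v $ 1 + g $ a $ 2 ^ q * v $ 2) \<in> regular_functions" for a
      by (intro regular_functions.add regular_functions.mult regular_power regular_functions.entry regular_functions.const)
    then show "f i \<in> regular_functions" for i
      by (cases "i = 0") (simp_all add: f_def[abs_def])
    show "w i \<in> gspace T" for i by simp
    show "gact T g v = (\<Sum>i<2. gscale T (f i g) (w i))" for g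
      by (simp add: vec_eq_iff forall_2 numeral_2_eq_2 f_def w_def del: One_nat_def)
  qed
qed (simp_all add: vec_eq_iff forall_2 algebra_simps mat_def matrix_matrix_mult_def sum_2 add_power_q power_mult_distrib)

sublocale rational2 T
  by unfold_locales (rule rational_T, rule char2)

text \<open>\<open>umat t\<close> adds \<open>t ^ q\<close> times the second coordinate to the
  first, so \<open>E^(q)\<close>, that is \<open>e_m\<close>, is the only nonzero divided power
  besides the identity.\<close>

lemma E_T:
  assumes "n > 0"
  shows "gE T n v = (if n = q then e1 (v $ 2) else 0)"
proof -
  have "vexp (gscale T) (\<lambda>t. gact T (umat t) v)
      (\<lambda>n. (if n = 0 then v else 0) + (if n = q then e1 (v $ 2) else 0))"
  proof (rule vexpI[where K = "Suc q"])
    show "\<forall>k\<ge>Suc q. (if k = 0 then v else 0) + (if k = q then e1 (v $ 2) else 0) = 0" by auto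
    fix t :: 'k
    have "(\<Sum>k<Suc q. gscale T (t ^ k) ((if k = 0 then v else 0) + (if k = q then e1 (v $ 2) else 0))) =
        (\<Sum>k<Suc q. (if k = 0 then v else 0)) + (\<Sum>k<Suc q. if k = q then t ^ q *s e1 (v $ 2) else 0)"
      unfolding sum.distrib[symmetric] by (intro sum.cong refl) (auto simp: vector_add_ldistrib)
    also have "\<dots> = v + t ^ q *s e1 (v $ 2)" by (simp add: sum.delta del: sum.lessThan_Suc)
    also have "\<dots> = gact T (umat t) v"
      by (simp add: vec_eq_iff forall_2)
    finally show "gact T (umat t) v =
      (\<Sum>k<Suc q. gscale T (t ^ k) ((if k = 0 then v else 0) + (if k = q then e1 (v $ 2) else 0)))" ..
  qed
  then show ?thesis using assms E_eqI by fastforce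
qed

lemma powers_eq_imp_eq:
  assumes "\<And>s::'k. s \<noteq> 0 \<Longrightarrow> s ^ a = s ^ b"
  shows "a = b"
proof (rule ccontr)
  assume "a \<noteq> b"
  define P :: "'k poly" where "P = monom 1 a - monom 1 b"
  have "coeff P a = 1" using \<open>a \<noteq> b\<close> by (simp add: P_def)
  then have "finite {x. poly P x = 0}" using poly_roots_finite[of P] by fastforce
  moreover have "- {0} \<subseteq> {x. poly P x = 0}" using assms by (auto simp: P_def poly_monom)
  ultimately have "finite (- {0::'k})" by (rule finite_subset[rotated])
  then show False using infinite_nonzero by blast
qed

text \<open>The torus has weight \<open>q\<close> on the first coordinate and \<open>-q\<close> on
  the second; the latter is negative, so only the highest weight line meets the spaces
  \<open>wsp\<close>.\<close>

lemma wsp_T: "v \<in> wsp T n \<longleftrightarrow> v $ 2 = 0 \<and> (v $ 1 = 0 \<or> n = q)"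
proof
  assume v: "v \<in> wsp T n"
  have eq: "s ^ q * v $ 1 = s ^ n * v $ 1" "inverse s ^ q * v $ 2 = s ^ n * v $ 2" if "s \<noteq> 0" for s
  proof -
    have "gact T (dmat s) v = gscale T (s ^ n) v" using v that by (simp add: wsp_def del: T_sel)
    then have "gact T (dmat s) v $ 1 = (s ^ n *s v) $ 1" "gact T (dmat s) v $ 2 = (s ^ n *s v) $ 2" by simp_all
    then show "s ^ q * v $ 1 = s ^ n * v $ 1" "inverse s ^ q * v $ 2 = s ^ n * v $ 2" by simp_all
  qed
  have "v $ 2 = 0"
  proof (rule ccontr)
    assume "v $ 2 \<noteq> 0"
    then have "s ^ (n + q) = s ^ 0" if "s \<noteq> 0" for s :: 'k
      using eq(2)[OF that] that by (simp add: power_add power_inverse field_simps)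
    then have "n + q = 0" by (rule powers_eq_imp_eq)
    then show False by simp
  qed
  moreover have "n = q" if "v $ 1 \<noteq> 0"
    using eq(1) that by (intro powers_eq_imp_eq) (metis mult_right_cancel)
  ultimately show "v $ 2 = 0 \<and> (v $ 1 = 0 \<or> n = q)" by blast
next
  assume "v $ 2 = 0 \<and> (v $ 1 = 0 \<or> n = q)"
  then show "v \<in> wsp T n" by (auto simp: wsp_def vec_eq_iff forall_2)
qed

section \<open>The complex of the twisted module and its cohomology\<close>

definition monomials :: "nat multiset set" where
  "monomials = {M. size M = m \<and> 2 * wt M = q}"

text \<open>\<open>e_m\<close> reads the second coordinate, which vanishes on every value of a
  cochain.\<close>

lemma dK_T: "f \<in> cochains T t \<Longrightarrow> dK T f M = 0"
  using cochainsD(1)[of f t] by (auto simp: dK_def E_T wsp_T vec_eq_iff forall_2 intro!: sum.neutral)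

lemma finite_monomials: "finite monomials"
proof (rule finite_subset)
  show "monomials \<subseteq> mset ` {xs. set xs \<subseteq> {..<m} \<and> length xs = m}"
  proof
    fix M assume M: "M \<in> monomials"
    have "j < m" if j: "j \<in># M" for j
    proof -
      have "2 ^ j \<le> wt M" using wt_remove[OF j] by simp
      then have "(2::nat) ^ Suc j \<le> 2 ^ m" using M by (simp add: monomials_def)
      then show ?thesis using power_le_imp_le_exp[of "2::nat" "Suc j" m] by simp
    qed
    moreover obtain xs where xs: "M = mset xs" using ex_mset by metis
    ultimately show "M \<in> mset ` {xs. set xs \<subseteq> {..<m} \<and> length xs = m}"
      using M by (auto simp: monomials_def)
  qed
  show "finite (mset ` {xs. set xs \<subseteq> {..<m} \<and> length xs = m})"
    by (intro finite_imageI finite_lists_length_eq) simp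
qed

text \<open>With zero differential every cochain is a cocycle and only zero is a coboundary;
  indicator functions of the monomials, with values in the highest weight line, form a
  basis.\<close>

lemma koszul_dim_T:
  assumes "m \<ge> 1"
  shows "koszul_dim T m (card monomials)"
proof -
  define \<delta> where "\<delta> M M' = (if M' = M then e1 1 else 0)" for M M' :: "nat multiset"
  have nz: "e1 1 \<noteq> 0" by (metis vector_2(1) zero_index zero_neq_one)
  have inj: "inj_on \<delta> monomials"
    using nz by (auto simp: inj_on_def \<delta>_def fun_eq_iff)
  have \<delta>: "\<delta> M \<in> cocycles T m" if M: "M \<in> monomials" for M
  proof -
    have "\<delta> M \<in> cochains T m"
      using M by (auto simp: cochains_def \<delta>_def wsp_T monomials_def)
    then show ?thesis by (simp add: cocycles_def dK_T)
  qed
  have cob: "coboundaries T m = {\<lambda>M. 0}"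
  proof -
    obtain i where "m = Suc i" using assms by (cases m) auto
    moreover have "dK T ` cochains T i = {\<lambda>M. 0}"
    proof
      show "dK T ` cochains T i \<subseteq> {\<lambda>M. 0}" using dK_T by (auto simp: fun_eq_iff)
      have "(\<lambda>M. 0) = dK T (\<lambda>M. 0)" using dK_T[OF cochains_zero] by (simp add: fun_eq_iff)
      then show "{\<lambda>M. 0} \<subseteq> dK T ` cochains T i" using cochains_zero[of i] by blast
    qed
    ultimately show ?thesis by (simp add: coboundaries_def)
  qed
  have ev: "(\<Sum>x\<in>\<delta> ` monomials. pw (gscale T) (c x) x) M = (if M \<in> monomials then c (\<delta> M) *s e1 1 else 0)" for c M
  proof -
    have "(\<Sum>x\<in>\<delta> ` monomials. pw (gscale T) (c x) x) M = (\<Sum>M'\<in>monomials. c (\<delta> M') *s \<delta> M' M)"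
      using inj by (simp add: sum_fun sum.reindex)
    also have "\<dots> = (\<Sum>M'\<in>monomials. if M' = M then c (\<delta> M) *s e1 1 else 0)"
      by (intro sum.cong refl) (auto simp: \<delta>_def)
    finally show ?thesis using finite_monomials by (simp add: sum.delta)
  qed
  show ?thesis
    unfolding koszul_dim_def quotient_has_dim_def
  proof (intro exI[of _ "\<delta> ` monomials"] conjI allI impI ballI)
    show "finite (\<delta> ` monomials)" "card (\<delta> ` monomials) = card monomials" "\<delta> ` monomials \<subseteq> cocycles T m"
      using finite_monomials inj \<delta> by (auto simp: card_image)
  next
    fix c x assume c: "(\<Sum>x\<in>\<delta> ` monomials. pw (gscale T) (c x) x) \<in> coboundaries T m" and "x \<in> \<delta> ` monomials"
    then obtain M where M: "x = \<delta> M" "M \<in> monomials" by blast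
    have "(\<Sum>x\<in>\<delta> ` monomials. pw (gscale T) (c x) x) M = 0" using c unfolding cob by simp
    then have "c x *s e1 1 = 0" unfolding ev using M by simp
    then show "c x = 0" using nz by auto
  next
    fix f assume "f \<in> cocycles T m"
    then have f: "f \<in> cochains T m" by (simp add: cocycles_def)
    define c where "c x = f (inv_into monomials \<delta> x) $ 1" for x
    have "(\<Sum>x\<in>\<delta> ` monomials. pw (gscale T) (c x) x) M = f M" for M
    proof (cases "M \<in> monomials")
      case True
      have "f M $ 2 = 0" using cochainsD(1)[OF f, of M] by (simp add: wsp_T)
      then show ?thesis
        unfolding ev using True inj by (simp add: c_def vec_eq_iff forall_2)
    next
      case False
      have "f M = 0"
      proof (cases "size M = m")
        case True
        then have "2 * wt M \<noteq> q" using False by (simp add: monomials_def)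
        then show ?thesis using cochainsD(1)[OF f, of M] by (simp add: wsp_T vec_eq_iff forall_2)
      qed (use cochainsD(3)[OF f] in auto)
      then show ?thesis unfolding ev using False by simp
    qed
    then have "f - (\<Sum>x\<in>\<delta> ` monomials. pw (gscale T) (c x) x) = (\<lambda>M. 0)"
      by (simp add: fun_eq_iff)
    then show "\<exists>c. f - (\<Sum>x\<in>\<delta> ` monomials. pw (gscale T) (c x) x) \<in> coboundaries T m"
      unfolding cob by blast
  qed
qed

end

section \<open>Counting monomials\<close>

text \<open>If the largest exponent \<open>a\<close> is positive, it occurs at least twice. Merging
  two parts of exponent \<open>a\<close> into one of exponent \<open>a - 1\<close> leaves one part
  fewer, and induction bounds \<open>a - 1\<close>.\<close>

lemma half_partition_bound:
  fixes E :: "nat multiset"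
  assumes "size E = Suc n" "(\<Sum>e\<in>#E. (1 / 2 :: rat) ^ e) = 1" "e \<in># E"
  shows "e \<le> n"
  using assms
proof (induction n arbitrary: E e)
  case 0
  then obtain x where "E = {#x#}" using size_1_singleton_mset by auto
  then have "(1 / 2 :: rat) ^ e = 1" using 0 by simp
  moreover have "(1 / 2 :: rat) ^ Suc k < 1" for k
    by (rule power_Suc_less_one) simp_all
  ultimately have "e \<noteq> Suc k" for k by (metis less_irrefl)
  then show ?case using not0_implies_Suc[of e] by auto
next
  case (Suc n)
  define a where "a = Max (set_mset E)"
  have a: "a \<in># E" "\<And>e. e \<in># E \<Longrightarrow> e \<le> a"
    using Suc.prems(3) by (auto simp: a_def intro!: Max_in)
  show ?case
  proof (cases "a = 0")
    case True
    then show ?thesis using a(2)[OF Suc.prems(3)] by simp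
  next
    case False
    obtain F where F: "E = add_mset a F" using a(1) by (metis insert_DiffM)
    have "of_nat (\<Sum>e\<in>#E. 2 ^ (a - e)) = (2 ^ a * (\<Sum>e\<in>#E. (1 / 2) ^ e) :: rat)"
      using a(2)
    proof (induction E)
      case (add x E)
      have "(2::rat) ^ (a - x) = 2 ^ a * (1 / 2) ^ x"
        using add.prems[of x] by (simp add: power_diff power_one_over field_simps)
      then show ?case using add by (simp add: distrib_left)
    qed simp
    then have "of_nat (\<Sum>e\<in>#E. 2 ^ (a - e)) = (of_nat (2 ^ a) :: rat)"
      using Suc.prems(2) by simp
    then have sum: "(\<Sum>e\<in>#E. 2 ^ (a - e)) = (2 ^ a :: nat)"
      unfolding of_nat_eq_iff .
    \<comment> \<open>After multiplication by \<open>2 ^ a\<close>, a single part of exponent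
      \<open>a\<close> would be the only odd summand of an even total.\<close>
    have "a \<in># F"
    proof (rule ccontr)
      assume "a \<notin># F"
      then have "\<forall>e\<in>#F. even (2 ^ (a - e) :: nat)"
        using a(2) F by (metis add_mset_remove_trivial diff_is_0_eq dvd_power even_numeral in_diffD le_antisym not_gr_zero)
      then have "even (\<Sum>e\<in>#F. 2 ^ (a - e) :: nat)"
        by (induction F) auto
      moreover have "2 ^ a = Suc (\<Sum>e\<in>#F. 2 ^ (a - e))" using sum F by simp
      ultimately have "odd (2 ^ a :: nat)" by (simp only: even_Suc simp_thms)
      then show False using False by simp
    qed
    then obtain F' where F': "F = add_mset a F'" by (metis insert_DiffM)
    define E' where "E' = add_mset (a - 1) F'"
    have "(1 / 2 :: rat) ^ (a - 1) = (1 / 2) ^ a + (1 / 2) ^ a"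
      using False by (cases a) auto
    then have "(\<Sum>e\<in>#E'. (1 / 2 :: rat) ^ e) = 1"
      using Suc.prems(2) by (simp add: E'_def F F' add.assoc)
    moreover have "size E' = Suc n" using Suc.prems(1) by (simp add: E'_def F F')
    ultimately have "a - 1 \<le> n" using Suc.IH[of E' "a - 1"] by (simp add: E'_def)
    then show ?thesis using a(2)[OF Suc.prems(3)] by simp
  qed
qed

text \<open>Multiplication by \<open>2 ^ n\<close>; the bound on the exponents makes the truncated
  subtraction exact.\<close>

lemma half_power_sum_iff:
  fixes E :: "nat multiset"
  assumes "\<And>e. e \<in># E \<Longrightarrow> e \<le> n"
  shows "(\<Sum>e\<in>#E. (1 / 2 :: rat) ^ e) = 1 \<longleftrightarrow> wt (image_mset (\<lambda>e. n - e) E) = 2 ^ n"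
proof -
  have "of_nat (wt (image_mset (\<lambda>e. n - e) E)) = (2 ^ n * (\<Sum>e\<in>#E. (1 / 2) ^ e) :: rat)"
    using assms
  proof (induction E)
    case (add x E)
    have "(2::rat) ^ (n - x) = 2 ^ n * (1 / 2) ^ x"
      using add.prems[of x] by (simp add: power_diff power_one_over field_simps)
    then show ?case using add by (simp add: distrib_left)
  qed simp
  then have "(\<Sum>e\<in>#E. (1 / 2 :: rat) ^ e) = 1 \<longleftrightarrow>
      of_nat (wt (image_mset (\<lambda>e. n - e) E)) = (of_nat (2 ^ n) :: rat)"
    by simp
  then show ?thesis unfolding of_nat_eq_iff .
qed

text \<open>With \<open>n = m - 1\<close>, the reflection \<open>e \<mapsto> n - e\<close> is an
  involution on exponents up to \<open>n\<close> and exchanges sum 1 with weight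
  \<open>2 ^ n\<close>. Both sides need the bound \<open>n\<close>, since subtraction is
  truncated.\<close>

lemma (in twisted_natural) card_monomials:
  assumes "m \<ge> 1"
  shows "card monomials = half_partitions (m - 1)"
proof -
  obtain n where n: "m = Suc n" using assms by (cases m) auto
  define P where "P = {E :: nat multiset. size E = m \<and> (\<Sum>e\<in>#E. (1 / 2 :: rat) ^ e) = 1}"
  define r where "r = image_mset (\<lambda>e. n - e)"
  have rr: "r (r E) = E" if "\<And>e. e \<in># E \<Longrightarrow> e \<le> n" for E
    using that by (simp add: r_def multiset.map_comp cong: multiset.map_cong)
  have le: "e \<le> n" if "E \<in> P" "e \<in># E" for E e
    using half_partition_bound[of E n e] that by (simp add: P_def n)
  have le': "e \<le> n" if M: "M \<in> monomials" "e \<in># M" for M e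
  proof -
    have "2 * wt M = 2 ^ m" using M(1) by (simp add: monomials_def)
    then have "wt M = 2 ^ n" by (simp add: n)
    moreover have "2 ^ e \<le> wt M" using wt_remove[OF M(2)] by linarith
    ultimately have "(2::nat) ^ e \<le> 2 ^ n" by (simp only:)
    then show ?thesis by (rule power_le_imp_le_exp[rotated]) simp
  qed
  have "bij_betw r P monomials"
  proof (rule bij_betw_byWitness[where f' = r])
    show "\<forall>E\<in>P. r (r E) = E" "\<forall>M\<in>monomials. r (r M) = M" using rr le le' by blast+
    show "r ` P \<subseteq> monomials"
    proof safe
      fix E assume E: "E \<in> P"
      then have "wt (r E) = 2 ^ n"
        using half_power_sum_iff[of E n] le[OF E] by (simp add: P_def r_def)
      then have "2 * wt (r E) = q" by (simp add: n)
      then show "r E \<in> monomials" using E by (simp add: monomials_def P_def r_def)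
    qed
    show "r ` monomials \<subseteq> P"
    proof safe
      fix M assume M: "M \<in> monomials"
      have "(\<Sum>e\<in>#r M. (1 / 2 :: rat) ^ e) = 1 \<longleftrightarrow> wt (r (r M)) = 2 ^ n"
        unfolding r_def by (rule half_power_sum_iff) auto
      moreover have "2 * wt M = 2 ^ m" "size M = m" using M by (simp_all add: monomials_def)
      moreover have "r (r M) = M" by (rule rr) (rule le'[OF M])
      ultimately show "r M \<in> P"
        by (simp add: P_def n) (simp add: r_def n)
    qed
  qed
  then have "card P = card monomials" by (rule bij_betw_same_card)
  moreover have "m - 1 + 1 = m" using assms by simp
  ultimately show ?thesis by (simp only: half_partitions_def P_def)
qed

text \<open>The universe is left open: any type with an infinite-dimensional vector space structure
  over the field will do, because the twisted module has finite dimension and its resolution can be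
  built in countable dimension.\<close>

theorem mainTheorem3:
  fixes m :: nat
    and sc :: "'k::alg_closed_field \<Rightarrow> 'v::ab_group_add \<Rightarrow> 'v"
  assumes "CHAR('k) = 2"
    and "m \<ge> 1"
    and "vector_space sc"
    and "\<not> (\<exists>B. finite B \<and> module.span sc B = UNIV)"
  shows "rational_cohomology_has_dim TYPE('v) m
           (frobenius_twist m (natural_module :: ('k, 'k ^ 2) gmod)) (half_partitions (m - 1))"
proof -
  interpret universe sc using assms(3,4) by (simp add: universe_def universe_axioms_def)
  interpret T: twisted_natural m "TYPE('k)" by unfold_locales (rule assms(1))
  obtain n where n: "m = Suc n" using assms(2) by (cases m) auto
  have dim: "koszul_dim T.T m (half_partitions (m - 1))"
    using T.koszul_dim_T[OF assms(2)] T.card_monomials[OF assms(2)] by simp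
  have "v \<in> T.span {vector [1, 0], vector [0, 1]}" for v :: "'k ^ 2"
  proof -
    have "v = v $ 1 *s vector [1, 0] + v $ 2 *s vector [0, 1]" by (simp add: vec_eq_iff forall_2)
    also have "\<dots> \<in> T.span {vector [1, 0], vector [0, 1]}"
      using T.span_add[OF T.span_scale[OF T.span_base] T.span_scale[OF T.span_base],
          of "vector [1, 0]" "{vector [1, 0], vector [0, 1]}" "vector [0, 1]" "v $ 1" "v $ 2"] by simp
    finally show ?thesis .
  qed
  then have "countable_span (gscale T.T) (gspace T.T)"
    unfolding countable_span_def by (intro exI[of _ "{vector [1, 0], vector [0, 1]}"]) auto
  then have "\<exists>(I :: nat \<Rightarrow> ('k, 'v) gmod) \<epsilon> d. injective_resolution T.T I \<epsilon> d"
    by (rule exists_injective_resolution[OF T.rational_T])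
  moreover have "koszul_dim T.T (Suc n) (half_partitions (m - 1))"
    by (subst n[symmetric]) (rule dim)
  ultimately show ?thesis
    using koszul_dim_imp_Ext[OF assms(1) T.rational_T, where n = n]
    unfolding rational_cohomology_has_dim_def Ext_has_dim_def T.T_def[symmetric] n[symmetric] by blast
qed

end
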